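(* Let $X$ be a separable dual Banach space. Then the following are equivalent: (i) $X$ has an FDD; (ii) $X$ admits a small GCCR; (iii) $X$ admits a small subset which is a Lipschitz retract of $X$.
   Context: All Banach spaces are real. A dual Banach space is one of the form $Z^*$ for a Banach space $Z$. A sequence $(X_n)_{n\in\mathbb{N}}$ of nonzero finite dimensional subspaces of $X$ is an FDD (finite dimensional decomposition) if for every $x\in X$ there is a unique sequence $x_n\in X_n$ with $\|x-\sum_{i=1}^n x_i\|\to0$. A set $K\subset X$ is a Lipschitz retract of $X$ if there is a Lipschitz map $R:X\to K$ with $R|_K=\mathrm{Id}_K$. A GCCR (generating convex compact retract) of $X$ is a convex compact Lipschitz retract $K$ of $X$ whose closed linear span is $X$. A fundamental sequence in $X$ is a sequence $\beta=(e_n)\subset X$ whose closed linear span is $X$; put $E_n^\beta=\mathrm{span}\{e_1,\dots,e_n\}$. For a bounded set $K\subset X$ define the inner radii $r_n^\beta=\sup\{r\ge0: B_{E_n^\beta}(x,r)\subset K\cap E_n^\beta \text{ for some } x\in E_n^\beta\}$, where $B_{E_n^\beta}(x,r)$ is the closed ball in $E_n^\beta$ with centre $x$ and radius $r$, and the heights $h_n^\beta=\sup\{d(x,E_n^\beta): x\in K\}$. A bounded set $K\subset X$ is small if there exist $\varepsilon\in(0,1)$, a fundamental sequence $\beta$ in $X$ and a strictly increasing $\sigma:\mathbb{N}\to\mathbb{N}$ such that for all $n\in\mathbb{N}$ $$0<\frac{h_{\sigma(n)}^\beta}{r_{\sigma(n)}^\beta}\le\frac{1}{2\sigma(n)^2\left(\left(1+\frac{2}{\varepsilon}\right)^{\sigma(n)}+2\right)}.$$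 *)

theory Defs
  imports "HOL-Analysis.Analysis"
begin

text \<open>
  The ambient Banach space \<open>X\<close> is a type \<open>'a\<close>. That it is of the form \<open>Z\<^sup>*\<close> is witnessed by
  a surjective linear isometry \<open>J\<close> onto the space of bounded linear functionals with the operator
  norm, \<open>Z\<close> being the type \<open>'z\<close>; \<open>X = Z\<^sup>*\<close> on the nose is the case \<open>J = id\<close>.
\<close>

definition dual_identification ::
    "('a::real_normed_vector \<Rightarrow> ('z::real_normed_vector \<Rightarrow>\<^sub>L real)) \<Rightarrow> bool" where
  "dual_identification J \<longleftrightarrow> linear J \<and> (\<forall>x. norm (J x) = norm x) \<and> surj J"

definition FDD :: "(nat \<Rightarrow> 'a::real_normed_vector set) \<Rightarrow> bool" where
  "FDD V \<longleftrightarrow>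
     (\<forall>n. subspace (V n) \<and> (\<exists>B. finite B \<and> span B = V n) \<and> V n \<noteq> {0}) \<and>
     (\<forall>x. \<exists>!y. (\<forall>n. y n \<in> V n) \<and> y sums x)"

definition lipschitz_retract :: "'a::metric_space set \<Rightarrow> bool" where
  "lipschitz_retract K \<longleftrightarrow>
     (\<exists>R L. L-lipschitz_on UNIV R \<and> range R \<subseteq> K \<and> (\<forall>x\<in>K. R x = x))"

definition GCCR :: "'a::real_normed_vector set \<Rightarrow> bool" where
  "GCCR K \<longleftrightarrow> convex K \<and> compact K \<and> lipschitz_retract K \<and> closure (span K) = UNIV"

definition fundamental :: "(nat \<Rightarrow> 'a::real_normed_vector) \<Rightarrow> bool" where
  "fundamental \<beta> \<longleftrightarrow> closure (span (range \<beta>)) = UNIV"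

text \<open>Sequences are indexed from 0, so the mathematical \<open>e\<^sub>1, \<dots>, e\<^sub>n\<close> are \<open>\<beta> 0, \<dots>, \<beta> (n - 1)\<close>.\<close>

definition Espan :: "(nat \<Rightarrow> 'a::real_vector) \<Rightarrow> nat \<Rightarrow> 'a set" where
  "Espan \<beta> n = span (\<beta> ` {..<n})"

text \<open>
  The suprema are taken in \<open>[0, \<infinity>]\<close>: the supremum of no radii (\<open>K\<close> disjoint from the span) is
  \<open>0\<close>, and \<open>r\<^sub>n = \<infinity>\<close> is possible when the span is \<open>{0}\<close>. In \<^typ>\<open>ennreal\<close> a quotient \<open>h / r\<close>
  with finite \<open>h\<close> is \<open>0\<close> or \<open>\<infinity>\<close> when \<open>r \<in> {0, \<infinity>}\<close>, so \<open>0 < h / r \<le> c\<close> with finite \<open>c\<close> forces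
  \<open>0 < r < \<infinity>\<close> and \<open>h > 0\<close>.
\<close>

definition inner_radius :: "(nat \<Rightarrow> 'a::real_normed_vector) \<Rightarrow> 'a set \<Rightarrow> nat \<Rightarrow> ennreal" where
  "inner_radius \<beta> K n =
     Sup {ennreal r | r. 0 \<le> r \<and>
       (\<exists>x \<in> Espan \<beta> n. cball x r \<inter> Espan \<beta> n \<subseteq> K \<inter> Espan \<beta> n)}"

definition height :: "(nat \<Rightarrow> 'a::real_normed_vector) \<Rightarrow> 'a set \<Rightarrow> nat \<Rightarrow> ennreal" where
  "height \<beta> K n = (SUP x\<in>K. ennreal (infdist x (Espan \<beta> n)))"

text \<open>The positive natural numbers are meant as range of \<open>\<sigma>\<close>.\<close>

definition small :: "'a::real_normed_vector set \<Rightarrow> bool" where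
  "small K \<longleftrightarrow> bounded K \<and>
     (\<exists>(\<epsilon>::real) \<beta> (\<sigma>::nat \<Rightarrow> nat).
        0 < \<epsilon> \<and> \<epsilon> < 1 \<and> fundamental \<beta> \<and> strict_mono \<sigma> \<and> (\<forall>n. 0 < \<sigma> n) \<and>
        (\<forall>n. 0 < height \<beta> K (\<sigma> n) / inner_radius \<beta> K (\<sigma> n) \<and>
             height \<beta> K (\<sigma> n) / inner_radius \<beta> K (\<sigma> n)
               \<le> ennreal (1 / (2 * real (\<sigma> n) ^ 2 * ((1 + 2 / \<epsilon>) ^ \<sigma> n + 2)))))"

end

(*
FDD to retract.  Choose weights a_n decreasing very fast and let K consist of the x whose coordinates
x_n satisfy sum |x_n| / a_n <= 1.  The retraction keeps coordinates until the accumulated weight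
would exceed 1, truncates the coordinate where this happens and drops the later ones.  When the
first coordinates of two points exhaust weight differently, the coordinates that only one of them
retains have size at most a_(n+1) times the difference of weights, which the decay of the a_n makes
comparable to the distance of the points; so the map is Lipschitz for every FDD.

Retract to FDD.  Rescaled around the centre of an inscribed ball, a small retract gives a Lipschitz
map f that is the identity on the unit ball of E = E_n and takes values eta-close to E.  Let phi_k be
norming functionals of a net of M points of the sphere of E.  Averaging f over a box with M short
edges, along given vectors v_k, and n long edges, along an Auerbach basis of E, makes it
differentiable along the edges, and linearity of the derivative in the direction yields
trace (sum_k phi_k (x) v_k) <= C sum_k |v_k| whenever this operator maps E into E; the hypothesis on
heights and radii says that the short edges can be long compared to eta and their total length
short compared to 1/n^2.  By Hahn-Banach (Helly) this trace inequality is dual to the existence of a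
weak-star continuous projection onto E of norm bounded independently of n.  The preadjoints S_n of
these projections converge weakly to the identity, convex combinations converge strongly, and the
Johnson-Rosenthal-Zippin correction S_m + T - S_m T makes the projections commute.
*)

theory Submission
  imports Defs "Jordan_Normal_Form.Determinant"
begin

section \<open>Separation by functionals\<close>

text \<open>The box depends on the operator under test. It lies in the finite dimensional span of
  the edges, so no measure on X is involved, and derivatives are available in exactly the directions
  whose linear relation is used: each image of a basis vector of E is a combination of short edges
  and, lying in E, also of long edges. Comparing the two expressions gives the trace inequality,
  which is why the operator has to map E into E. The obstruction in Helly's theorem for tuples in Z
  is a tuple v_k in the dual of Z, that is, in X, and it automatically defines such an operator. A
  solution therefore consists of vectors of Z, and the projection has a preadjoint; this is the
  point where duality of X enters. The number (1 + 2/\<epsilon>)^n in the definition of a small set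
  bounds the cardinality M of an \<epsilon>-net of the sphere of E. The factor n^2 collects one n
  from the length 1/n of the long edges and one from the n diagonal entries of the trace. The net
  norms E only up to 1 - \<epsilon>, so \<epsilon> enters the bound of the projections and must be
  the same for all n.\<close>

definition sublinear_on :: "('b::real_vector \<Rightarrow> real) \<Rightarrow> bool" where
  "sublinear_on p \<longleftrightarrow> (\<forall>x y. p (x + y) \<le> p x + p y) \<and> (\<forall>c x. 0 \<le> c \<longrightarrow> p (c *\<^sub>R x) = c * p x)"

lemma sublinear_onD:
  assumes "sublinear_on p"
  shows "p (x + y) \<le> p x + p y" "0 \<le> c \<Longrightarrow> p (c *\<^sub>R x) = c * p x" "p 0 = 0" "- p (- x) \<le> p x"
proof -
  show add: "p (x + y) \<le> p x + p y" for x y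
    using assms by (simp add: sublinear_on_def)
  show hom: "0 \<le> c \<Longrightarrow> p (c *\<^sub>R x) = c * p x" for c x
    using assms by (simp add: sublinear_on_def)
  show zero: "p 0 = 0"
    using hom[of 0 0] by simp
  show "- p (- x) \<le> p x"
    using add[of x "- x"] zero by simp
qed

lemma sublinear_onI:
  fixes q :: "'b::real_vector \<Rightarrow> real"
  assumes add: "\<And>x y. q (x + y) \<le> q x + q y" and zero: "q 0 = 0"
    and hom_le: "\<And>c x. 0 < c \<Longrightarrow> q (c *\<^sub>R x) \<le> c * q x"
  shows "sublinear_on q"
proof -
  have "q (c *\<^sub>R y) = c * q y" if c: "c \<ge> 0" for c y
  proof (cases "c = 0")
    case False
    then have pos: "c > 0" using c by simp
    have "q (inverse c *\<^sub>R (c *\<^sub>R y)) \<le> inverse c * q (c *\<^sub>R y)"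
      using pos by (intro hom_le) auto
    then have "c * q y \<le> q (c *\<^sub>R y)"
      using pos by (simp add: field_simps)
    then show ?thesis using hom_le[OF pos, of y] by simp
  qed (simp add: zero)
  then show ?thesis using add by (simp add: sublinear_on_def)
qed

text \<open>This is the competitor for a minimal \<open>m\<close>: it is sublinear, lies below
  \<open>m\<close>, and is at most \<open>- m x\<close> at \<open>- x\<close>. Minimality forces
  \<open>q = m\<close>, hence \<open>m (- x) \<le> - m x\<close>, and a sublinear functional that is
  odd is linear.\<close>

lemma sublinear_inf_shift:
  fixes m :: "'b::real_vector \<Rightarrow> real" and x :: 'b
  assumes m: "sublinear_on m"
  defines "q \<equiv> \<lambda>y. INF t\<in>{0..}. m (y + t *\<^sub>R x) - t * m x"
  shows "sublinear_on q" "q y \<le> m y" "q (- x) \<le> - m x"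
proof -
  note sub = sublinear_onD[OF m]
  have lower: "- m (- y) \<le> m (y + t *\<^sub>R x) - t * m x" if "t \<ge> 0" for t y
    using sub(1)[of "y + t *\<^sub>R x" "- y"] sub(2)[OF that, of x] by simp
  have bdd: "bdd_below ((\<lambda>t. m (y + t *\<^sub>R x) - t * m x) ` {0..})" for y
    using lower by (intro bdd_belowI[of _ "- m (- y)"]) auto
  have le: "q y \<le> m (y + t *\<^sub>R x) - t * m x" if "t \<ge> 0" for t y
    unfolding q_def using that by (intro cINF_lower[OF bdd]) auto
  have ge: "c \<le> q y" if "\<And>t. t \<ge> 0 \<Longrightarrow> c \<le> m (y + t *\<^sub>R x) - t * m x" for c y
    unfolding q_def using that by (intro cINF_greatest) auto
  show "q y \<le> m y" using le[of 0 y] by simp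
  show "q (- x) \<le> - m x" using le[of 1 "- x"] sub(3) by simp
  have add: "q (y + z) \<le> q y + q z" for y z
  proof -
    have "q (y + z) - (m (z + t *\<^sub>R x) - t * m x) \<le> q y" if t: "t \<ge> 0" for t
    proof (rule ge)
      fix s :: real assume s: "s \<ge> 0"
      have "q (y + z) \<le> m (y + z + (s + t) *\<^sub>R x) - (s + t) * m x"
        using s t by (intro le) auto
      also have "\<dots> \<le> m (y + s *\<^sub>R x) + m (z + t *\<^sub>R x) - (s + t) * m x"
        using sub(1)[of "y + s *\<^sub>R x" "z + t *\<^sub>R x"] by (simp add: algebra_simps)
      finally show "q (y + z) - (m (z + t *\<^sub>R x) - t * m x) \<le> m (y + s *\<^sub>R x) - s * m x"
        by (simp add: algebra_simps)
    qed
    then have "q (y + z) - q y \<le> q z"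
      by (intro ge) (simp add: algebra_simps)
    then show ?thesis by simp
  qed
  have hom_le: "q (c *\<^sub>R y) \<le> c * q y" if c: "c > 0" for c y
  proof -
    have "q (c *\<^sub>R y) / c \<le> q y"
    proof (rule ge)
      fix t :: real assume t: "t \<ge> 0"
      have "q (c *\<^sub>R y) \<le> m (c *\<^sub>R y + (c * t) *\<^sub>R x) - (c * t) * m x"
        using c t by (intro le) auto
      also have "\<dots> = c * (m (y + t *\<^sub>R x) - t * m x)"
        using sub(2)[of c "y + t *\<^sub>R x"] c by (simp add: algebra_simps)
      finally show "q (c *\<^sub>R y) / c \<le> m (y + t *\<^sub>R x) - t * m x"
        using c by (simp add: field_simps)
    qed
    then show ?thesis using c by (simp add: field_simps)
  qed
  have zero: "q 0 = 0"
  proof (rule antisym)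
    show "q 0 \<le> 0" using le[of 0 0] sub(3) by simp
    show "0 \<le> q 0" by (rule ge) (simp add: sub(2))
  qed
  show "sublinear_on q" using add zero hom_le by (rule sublinear_onI)
qed

text \<open>A pointwise minimal sublinear functional is linear.\<close>

lemma sublinear_dominates_linear:
  fixes p :: "'b::real_vector \<Rightarrow> real"
  assumes p: "sublinear_on p"
  obtains h where "linear h" "\<And>x. h x \<le> p x"
proof -
  define A where "A = {q. sublinear_on q \<and> q \<le> p}"
  have "\<exists>m\<in>A. \<forall>a\<in>A. m \<ge> a \<longrightarrow> a = m"
  proof (rule predicate_Zorn)
    show "partial_order_on A (relation_of (\<ge>) A)"
      by (rule partial_order_on_relation_ofI) auto
    fix C assume C: "C \<in> Chains (relation_of (\<ge>) A)"
    then have CA: "C \<subseteq> A" and tot: "\<And>a b. a \<in> C \<Longrightarrow> b \<in> C \<Longrightarrow> a \<le> b \<or> b \<le> a"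
      by (auto simp: Chains_def relation_of_def)
    show "\<exists>u\<in>A. \<forall>a\<in>C. a \<ge> u"
    proof (cases "C = {}")
      case True
      then show ?thesis using p by (auto simp: A_def)
    next
      case False
      define u where "u = (\<lambda>x. INF q\<in>C. q x)"
      have sl: "sublinear_on q" "q \<le> p" if "q \<in> C" for q
        using CA that by (auto simp: A_def)
      have bdd: "bdd_below ((\<lambda>q. q x) ` C)" for x
      proof (rule bdd_belowI)
        fix r assume "r \<in> (\<lambda>q. q x) ` C"
        then obtain q where q: "q \<in> C" "r = q x" by auto
        have "- p (- x) \<le> - q (- x)" using sl(2)[OF q(1)] by (simp add: le_funD)
        also have "\<dots> \<le> q x" by (rule sublinear_onD(4)[OF sl(1)[OF q(1)]])
        finally show "- p (- x) \<le> r" using q by simp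
      qed
      have le: "u x \<le> q x" if "q \<in> C" for q x
        unfolding u_def using that by (intro cINF_lower[OF bdd])
      have ge: "c \<le> u x" if "\<And>q. q \<in> C \<Longrightarrow> c \<le> q x" for c x
        unfolding u_def using that False by (intro cINF_greatest) auto
      have "u (x + y) \<le> u x + u y" for x y
      proof -
        have "u (x + y) - q y \<le> u x" if q: "q \<in> C" for q
        proof (rule ge)
          fix r assume r: "r \<in> C"
          \<comment> \<open>Subadditivity survives the infimum over a chain because two members can
            be replaced by the smaller one, which is subadditive itself.\<close>
          obtain s where s: "s \<in> C" "s \<le> q" "s \<le> r"
            using tot[OF q r] q r by blast
          have "u (x + y) \<le> s x + s y"
            using le[OF s(1), of "x + y"] sublinear_onD(1)[OF sl(1)[OF s(1)], of x y] by simp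
          then show "u (x + y) - q y \<le> r x"
            using s(2,3) by (smt (verit) le_funD)
        qed
        then have "u (x + y) - u x \<le> u y"
          by (intro ge) (simp add: algebra_simps)
        then show ?thesis by simp
      qed
      moreover have "u (c *\<^sub>R x) = c * u x" if c: "c \<ge> 0" for c x
      proof -
        have "u (c *\<^sub>R x) = (INF r\<in>(\<lambda>q. q x) ` C. c * r)"
          unfolding u_def image_image
          by (rule INF_cong) (auto simp: sublinear_onD(2)[OF sl(1)] c)
        also have "\<dots> = c * (INF q\<in>C. q x)"
        proof -
          have "c * Inf ((\<lambda>q. q x) ` C) = Inf ((*) c ` (\<lambda>q. q x) ` C)"
            using False bdd c 
            by (intro continuous_at_Inf_mono) (auto intro!: monoI mult_left_mono continuous_intros)
          then show ?thesis by simp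
        qed
        finally show ?thesis by (simp add: u_def)
      qed
      ultimately have "sublinear_on u" by (simp add: sublinear_on_def)
      moreover obtain q where "q \<in> C" using False by auto
      then have "u \<le> p" using le sl(2) by (meson le_funI le_funD order_trans)
      ultimately show ?thesis using le by (auto simp: A_def le_fun_def)
    qed
  qed
  then obtain m where m: "sublinear_on m" "m \<le> p"
    and min: "\<And>a. sublinear_on a \<Longrightarrow> a \<le> p \<Longrightarrow> a \<le> m \<Longrightarrow> a = m"
    unfolding A_def by blast
  have neg: "m (- x) = - m x" for x
  proof -
    define q where "q = (\<lambda>y. INF t\<in>{0..}. m (y + t *\<^sub>R x) - t * m x)"
    have q: "sublinear_on q" "q y \<le> m y" "q (- x) \<le> - m x" for y
      using sublinear_inf_shift[OF m(1), where x = x] by (simp_all add: q_def)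
    have "q \<le> m" using q(2) by (simp add: le_fun_def)
    then have "q = m" using q(1) m(2) by (intro min) (auto intro: order_trans)
    then have "m (- x) \<le> - m x" using q(3) by simp
    then show ?thesis using sublinear_onD(4)[OF m(1), of x] by simp
  qed
  have "linear m"
  proof (rule linearI)
    fix x y :: 'b
    have "m (- x + - y) \<le> m (- x) + m (- y)" by (rule sublinear_onD(1)[OF m(1)])
    then have "m x + m y \<le> m (x + y)" using neg[of x] neg[of y] neg[of "x + y"] by simp
    then show "m (x + y) = m x + m y" using sublinear_onD(1)[OF m(1), of x y] by simp
  next
    fix r :: real and x :: 'b
    show "m (r *\<^sub>R x) = r *\<^sub>R m x"
    proof (cases "r \<ge> 0")
      case True
      then show ?thesis by (simp add: sublinear_onD(2)[OF m(1)])
    next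
      case False
      then have "m ((- r) *\<^sub>R x) = (- r) * m x" by (intro sublinear_onD(2)[OF m(1)]) auto
      then show ?thesis using neg[of "r *\<^sub>R x"] by simp
    qed
  qed
  then show ?thesis using that m(2) by (auto simp: le_fun_def)
qed

text \<open>Hahn-Banach with the separating property built into the sublinear majorant: every linear
  \<open>h \<le> p\<close> is dominated by the norm (take \<open>t = 0\<close>) and satisfies
  \<open>h (- c) \<le> - d\<close> (take \<open>t = 1\<close> and \<open>y = - c\<close>). The
  assumption that \<open>C\<close> avoids the open ball of radius \<open>d\<close> keeps the infimum
  finite.\<close>

lemma convex_separation_from_ball:
  fixes C :: "'b::real_normed_vector set"
  assumes C: "convex C" "C \<noteq> {}" and d: "\<And>c. c \<in> C \<Longrightarrow> d \<le> norm c"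
  obtains \<phi> :: "'b \<Rightarrow>\<^sub>L real" where "norm \<phi> \<le> 1" "\<And>c. c \<in> C \<Longrightarrow> d \<le> \<phi> c"
proof -
  define S :: "(real \<times> 'b) set" where "S = {(t, c). 0 \<le> t \<and> c \<in> C}"
  define p where "p = (\<lambda>y. INF (t, c)\<in>S. norm (y + t *\<^sub>R c) - t * d)"
  obtain c0 where c0: "c0 \<in> C" using C by auto
  have lower: "- norm y \<le> norm (y + t *\<^sub>R c) - t * d" if "0 \<le> t" "c \<in> C" for y t c
  proof -
    have "t * d \<le> norm (t *\<^sub>R c)" using d[OF that(2)] that(1) by (simp add: mult_left_mono)
    also have "\<dots> \<le> norm (y + t *\<^sub>R c) + norm y"
      using norm_triangle_ineq4[of "y + t *\<^sub>R c" y] by simp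
    finally show ?thesis by simp
  qed
  have bdd: "bdd_below ((\<lambda>(t, c). norm (y + t *\<^sub>R c) - t * d) ` S)" for y
    using lower by (intro bdd_belowI[of _ "- norm y"]) (auto simp: S_def)
  have le: "p y \<le> norm (y + t *\<^sub>R c) - t * d" if "0 \<le> t" "c \<in> C" for y t c
    unfolding p_def using that cINF_lower[OF bdd, of "(t, c)" y] by (simp add: S_def)
  have ge: "a \<le> p y" if "\<And>t c. 0 \<le> t \<Longrightarrow> c \<in> C \<Longrightarrow> a \<le> norm (y + t *\<^sub>R c) - t * d" for a y
    unfolding p_def using that c0 by (intro cINF_greatest) (auto simp: S_def intro!: exI[of _ 0])
  \<comment> \<open>Convexity of \<open>C\<close> merges two terms of the cone over \<open>C\<close>
    into one; subadditivity of \<open>p\<close> rests on this.\<close>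
  have comb: "\<exists>c\<in>C. s *\<^sub>R a + t *\<^sub>R b = (s + t) *\<^sub>R c" if "0 \<le> s" "0 \<le> t" "a \<in> C" "b \<in> C" for s t a b
  proof (cases "s + t = 0")
    case True
    then have "s = 0" "t = 0" using that by linarith+
    then show ?thesis using c0 by auto
  next
    case False
    have "(s / (s + t)) *\<^sub>R a + (t / (s + t)) *\<^sub>R b \<in> C"
      using that False C(1) by (intro convexD) (auto simp: add_divide_distrib[symmetric])
    moreover have "s *\<^sub>R a + t *\<^sub>R b = (s + t) *\<^sub>R ((s / (s + t)) *\<^sub>R a + (t / (s + t)) *\<^sub>R b)"
      using False by (simp add: scaleR_add_right)
    ultimately show ?thesis by blast
  qed
  have add: "p (y + z) \<le> p y + p z" for y z
  proof -
    have "p (y + z) - (norm (z + t *\<^sub>R b) - t * d) \<le> p y" if t: "0 \<le> t" "b \<in> C" for t b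
    proof (rule ge)
      fix s :: real and a assume s: "0 \<le> s" "a \<in> C"
      obtain c where c: "c \<in> C" "s *\<^sub>R a + t *\<^sub>R b = (s + t) *\<^sub>R c"
        using comb[of s t a b] s t by auto
      have "p (y + z) \<le> norm (y + z + (s + t) *\<^sub>R c) - (s + t) * d"
        using s t c by (intro le) auto
      also have "y + z + (s + t) *\<^sub>R c = (y + s *\<^sub>R a) + (z + t *\<^sub>R b)"
        unfolding c(2)[symmetric] by simp
      also have "norm \<dots> \<le> norm (y + s *\<^sub>R a) + norm (z + t *\<^sub>R b)" by (rule norm_triangle_ineq)
      finally show "p (y + z) - (norm (z + t *\<^sub>R b) - t * d) \<le> norm (y + s *\<^sub>R a) - s * d"
        by (simp add: algebra_simps)
    qed
    then have "p (y + z) - p y \<le> p z"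
      by (intro ge) (simp add: algebra_simps)
    then show ?thesis by simp
  qed
  have hom_le: "p (c *\<^sub>R y) \<le> c * p y" if c: "c > 0" for c y
  proof -
    have "p (c *\<^sub>R y) / c \<le> p y"
    proof (rule ge)
      fix t :: real and a assume t: "0 \<le> t" "a \<in> C"
      have "p (c *\<^sub>R y) \<le> norm (c *\<^sub>R y + (c * t) *\<^sub>R a) - (c * t) * d"
        using c t by (intro le) auto
      also have "c *\<^sub>R y + (c * t) *\<^sub>R a = c *\<^sub>R (y + t *\<^sub>R a)" by (simp add: scaleR_add_right)
      also have "norm \<dots> - (c * t) * d = c * (norm (y + t *\<^sub>R a) - t * d)"
        using c by (simp add: right_diff_distrib)
      finally show "p (c *\<^sub>R y) / c \<le> norm (y + t *\<^sub>R a) - t * d"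
        using c by (simp add: field_simps)
    qed
    then show ?thesis using c by (simp add: field_simps)
  qed
  have zero: "p 0 = 0"
  proof (rule antisym)
    show "p 0 \<le> 0" using le[of 0 c0 0] c0 by simp
    show "0 \<le> p 0" using lower[of _ _ 0] by (intro ge) auto
  qed
  have "sublinear_on p" using add zero hom_le by (rule sublinear_onI)
  then obtain h where h: "linear h" "\<And>x. h x \<le> p x"
    by (rule sublinear_dominates_linear) blast
  have hn: "h y \<le> norm y" for y
    using h(2)[of y] le[of 0 c0 y] c0 by simp
  have hb: "\<bar>h y\<bar> \<le> norm y" for y
    using hn[of y] hn[of "- y"] linear_neg[OF h(1), of y] by simp
  have bl: "bounded_linear h"
    using h(1) hb by (intro bounded_linear_intro[of _ 1]) (auto simp: linear_add linear_cmul)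
  show ?thesis
  proof (rule that[of "Blinfun h"])
    show "norm (Blinfun h) \<le> 1"
      using hb by (intro norm_blinfun_bound) (auto simp: bounded_linear_Blinfun_apply[OF bl])
    fix c assume c: "c \<in> C"
    have "h (- c) \<le> - d" using h(2)[of "- c"] le[of 1 c "- c"] c by simp
    then show "d \<le> blinfun_apply (Blinfun h) c"
      using linear_neg[OF h(1), of c] by (simp add: bounded_linear_Blinfun_apply[OF bl])
  qed
qed

lemma norming_functional:
  fixes x :: "'b::real_normed_vector"
  obtains \<phi> :: "'b \<Rightarrow>\<^sub>L real" where "norm \<phi> \<le> 1" "\<phi> x = norm x"
proof -
  obtain \<phi> :: "'b \<Rightarrow>\<^sub>L real" where \<phi>: "norm \<phi> \<le> 1" "\<And>c. c \<in> {x} \<Longrightarrow> norm x \<le> \<phi> c"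
    by (rule convex_separation_from_ball[of "{x}" "norm x"]) auto
  have "\<phi> x \<le> norm \<phi> * norm x"
    using norm_blinfun[of \<phi> x] by simp
  also have "\<dots> \<le> norm x" using \<phi>(1) by (simp add: mult_left_le_one_le)
  finally show ?thesis using that \<phi> by force
qed

lemma blinfun_functional_separates:
  fixes x :: "'b::real_normed_vector"
  assumes "x \<noteq> 0"
  obtains \<phi> :: "'b \<Rightarrow>\<^sub>L real" where "\<phi> x \<noteq> 0"
  using assms norming_functional[of x] by (metis norm_eq_zero)

text \<open>Mazur's theorem: at positive distance from \<open>x\<close>, a functional separating
  \<open>C - x\<close> from a ball of that radius would exceed its value at \<open>x\<close> on all
  of \<open>C\<close> by this distance. One-sided approximation suffices since \<open>\<phi>\<close>
  runs through all functionals.\<close>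

lemma closure_convex_by_functionals:
  fixes C :: "'b::real_normed_vector set"
  assumes C: "convex C" "C \<noteq> {}"
    and approx: "\<And>(\<phi> :: 'b \<Rightarrow>\<^sub>L real) e. e > 0 \<Longrightarrow> \<exists>c\<in>C. \<phi> c < \<phi> x + e"
  shows "x \<in> closure C"
proof (rule ccontr)
  assume "x \<notin> closure C"
  then have pos: "infdist x C > 0" using C(2) in_closure_iff_infdist_zero infdist_nonneg
    by (metis less_eq_real_def)
  have cv: "convex ((\<lambda>c. c - x) ` C)"
    using C(1) convex_translation[of C "- x"] by (simp add: image_def algebra_simps)
  obtain \<phi> :: "'b \<Rightarrow>\<^sub>L real" where \<phi>: "\<And>c. c \<in> (\<lambda>c. c - x) ` C \<Longrightarrow> infdist x C \<le> \<phi> c"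
  proof (rule convex_separation_from_ball[OF cv, of "infdist x C"])
    show "(\<lambda>c. c - x) ` C \<noteq> {}" using C by auto
    show "infdist x C \<le> norm c" if "c \<in> (\<lambda>c. c - x) ` C" for c
      using that infdist_le[of _ C x] by (auto simp: dist_norm norm_minus_commute)
  qed blast
  obtain c where "c \<in> C" "\<phi> c < \<phi> x + infdist x C" using approx[OF pos] by blast
  then show False using \<phi>[of "c - x"] by (auto simp: blinfun.diff_right)
qed

section \<open>Finite-dimensional subspaces: Auerbach systems and packing\<close>

text \<open>Induction in the manner of Gram-Schmidt; the functionals may be taken from any subspace
  \<open>G\<close> that separates points. The pairing is abstract because three cases occur:
  functionals against vectors, predual vectors against elements of the dual, and elements of a dense
  subspace of the dual against predual vectors.\<close>

lemma biorthogonal_system: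
  fixes pair :: "'w::real_vector \<Rightarrow> 'b::real_vector \<Rightarrow> real"
  assumes lin: "\<And>w. linear (pair w)" "\<And>b. linear (\<lambda>w. pair w b)"
    and G: "subspace G" and sep: "\<And>b. b \<noteq> 0 \<Longrightarrow> \<exists>w\<in>G. pair w b \<noteq> 0"
    and B: "finite B" "independent B"
  shows "\<exists>r. \<forall>b\<in>B. r b \<in> G \<and> (\<forall>c\<in>B. pair (r b) c = (if b = c then 1 else 0))"
  using B
proof (induction B rule: finite_induct)
  case empty
  then show ?case by simp
next
  case (insert a B)
  then obtain r where r: "\<And>b. b \<in> B \<Longrightarrow> r b \<in> G"
    "\<And>b c. b \<in> B \<Longrightarrow> c \<in> B \<Longrightarrow> pair (r b) c = (if b = c then 1 else 0)"
    using independent_mono[of "insert a B" B] by blast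
  define a' where "a' = a - (\<Sum>c\<in>B. pair (r c) a *\<^sub>R c)"
  have "a \<notin> span B" using insert by (simp add: independent_insert)
  moreover have "(\<Sum>c\<in>B. pair (r c) a *\<^sub>R c) \<in> span B"
    by (intro span_sum span_scale span_base)
  ultimately have "a' \<noteq> 0" by (auto simp: a'_def)
  then obtain g where g: "g \<in> G" "pair g a' \<noteq> 0" using sep by blast
  define g' where "g' = g - (\<Sum>c\<in>B. pair g c *\<^sub>R r c)"
  have g'G: "g' \<in> G"
    unfolding g'_def using G g r(1) by (intro subspace_diff subspace_sum subspace_scale) auto
  have expand: "pair g' x = pair g x - (\<Sum>c\<in>B. pair g c * pair (r c) x)" for x
    unfolding g'_def by (simp add: linear_diff[OF lin(2)] linear_sum[OF lin(2)] linear_cmul[OF lin(2)])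
  have "pair g' x = 0" if "x \<in> B" for x
  proof -
    have "(\<Sum>c\<in>B. pair g c * pair (r c) x) = (\<Sum>c\<in>B. if c = x then pair g c else 0)"
      using r(2) that by (intro sum.cong) auto
    then show ?thesis using that insert(1) by (simp add: expand)
  qed
  moreover have "pair g' a = pair g a'"
    unfolding expand a'_def
    by (simp add: linear_diff[OF lin(1)] linear_sum[OF lin(1)] linear_cmul[OF lin(1)] mult.commute)
  ultimately have g': "pair g' a \<noteq> 0" "\<And>x. x \<in> B \<Longrightarrow> pair g' x = 0" using g by auto
  define ra where "ra = (1 / pair g' a) *\<^sub>R g'"
  have ra: "ra \<in> G" "pair ra a = 1" "\<And>x. x \<in> B \<Longrightarrow> pair ra x = 0"
    using g' g'G G by (auto simp: ra_def subspace_scale linear_cmul[OF lin(2)])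
  define r' where "r' = (\<lambda>b. if b = a then ra else r b - pair (r b) a *\<^sub>R ra)"
  have "r' b \<in> G \<and> (\<forall>c\<in>insert a B. pair (r' b) c = (if b = c then 1 else 0))" if "b \<in> insert a B" for b
  proof (cases "b = a")
    case True
    then show ?thesis using ra insert(2) by (auto simp: r'_def)
  next
    case False
    then have b: "b \<in> B" using that by simp
    have "r' b \<in> G" using False G ra r(1)[OF b] by (simp add: r'_def subspace_diff subspace_scale)
    moreover have "pair (r' b) c = pair (r b) c - pair (r b) a * pair ra c" for c
      using False by (simp add: r'_def linear_diff[OF lin(2)] linear_cmul[OF lin(2)])
    ultimately show ?thesis using ra r(2)[OF b] b False insert(2) by auto
  qed
  then show ?case by blast
qed

lemma blinfun_biorthogonal_system:
  fixes B :: "'b::real_normed_vector set"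
  assumes "finite B" "independent B"
  shows "\<exists>r :: 'b \<Rightarrow> ('b \<Rightarrow>\<^sub>L real). \<forall>b\<in>B. \<forall>c\<in>B. r b c = (if b = c then 1 else 0)"
proof -
  have "\<exists>r :: 'b \<Rightarrow> ('b \<Rightarrow>\<^sub>L real). \<forall>b\<in>B. r b \<in> (UNIV :: ('b \<Rightarrow>\<^sub>L real) set) \<and>
      (\<forall>c\<in>B. r b c = (if b = c then 1 else 0))"
  proof (rule biorthogonal_system[where pair = blinfun_apply and G = UNIV])
    show "linear (blinfun_apply w)" for w :: "'b \<Rightarrow>\<^sub>L real"
      by (simp add: blinfun.bounded_linear_right bounded_linear.linear)
    show "linear (\<lambda>w :: 'b \<Rightarrow>\<^sub>L real. w b)" for b
      by (simp add: blinfun.bounded_linear_left bounded_linear.linear)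
    show "\<exists>w\<in>UNIV :: ('b \<Rightarrow>\<^sub>L real) set. w b \<noteq> 0" if "b \<noteq> 0" for b
      using blinfun_functional_separates[OF that] by blast
  qed (use assms in auto)
  then show ?thesis by blast
qed

lemma span_coordinates:
  fixes B :: "'b::real_normed_vector set"
  assumes "finite B"
  obtains d :: nat and e :: "nat \<Rightarrow> 'b" and \<psi> :: "nat \<Rightarrow> ('b \<Rightarrow>\<^sub>L real)"
  where "d \<le> card B" "span (e ` {..<d}) = span B"
    "\<And>i j. i < d \<Longrightarrow> j < d \<Longrightarrow> \<psi> i (e j) = (if i = j then 1 else 0)"
    "\<And>x. x \<in> span B \<Longrightarrow> x = (\<Sum>i<d. \<psi> i x *\<^sub>R e i)"
proof -
  obtain C where C: "C \<subseteq> B" "independent C" "B \<subseteq> span C"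
    using maximal_independent_subset[of B] by metis
  have fin: "finite C" using C assms finite_subset by blast
  have sp: "span C = span B" using C by (metis span_mono span_span subset_antisym)
  obtain r :: "'b \<Rightarrow> ('b \<Rightarrow>\<^sub>L real)" where r: "\<And>b c. b \<in> C \<Longrightarrow> c \<in> C \<Longrightarrow> r b c = (if b = c then 1 else 0)"
    using blinfun_biorthogonal_system[OF fin C(2)] by blast
  obtain e where e: "bij_betw e {..<card C} C"
    using ex_bij_betw_nat_finite[OF fin] by (auto simp: atLeast0LessThan)
  show ?thesis
  proof (rule that[of "card C" e "\<lambda>i. r (e i)"])
    show "card C \<le> card B" using C assms by (simp add: card_mono)
    show "span (e ` {..<card C}) = span B" using e sp by (simp add: bij_betw_def)
    show "r (e i) (e j) = (if i = j then 1 else 0)" if "i < card C" "j < card C" for i j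
    proof -
      have "e i \<in> C" "e j \<in> C" "e i = e j \<longleftrightarrow> i = j"
        using e that by (auto simp: bij_betw_def inj_on_def)
      then show ?thesis using r by simp
    qed
    show "x = (\<Sum>i<card C. r (e i) x *\<^sub>R e i)" if "x \<in> span B" for x
    proof -
      have "x \<in> span C" using that sp by simp
      then obtain u where u: "x = (\<Sum>a\<in>C. u a *\<^sub>R a)"
        using span_finite[OF fin] by auto
      have "r b x = u b" if "b \<in> C" for b
      proof -
        have "r b x = (\<Sum>a\<in>C. u a * r b a)" unfolding u by (simp add: blinfun.sum_right blinfun.scaleR_right)
        also have "\<dots> = (\<Sum>a\<in>C. if a = b then u a else 0)" using r that by (intro sum.cong) auto
        finally show ?thesis using that fin by simp
      qed
      then have "x = (\<Sum>a\<in>C. r a x *\<^sub>R a)" by (subst u) (intro sum.cong, auto)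
      also have "\<dots> = (\<Sum>i<card C. r (e i) x *\<^sub>R e i)"
        using sum.reindex_bij_betw[OF e, of "\<lambda>a. r a x *\<^sub>R a"] by simp
      finally show ?thesis .
    qed
  qed
qed

text \<open>The coordinate functionals are defined on the whole space, so the span is the fixed
  point set of a continuous map.\<close>

lemma closed_span_finite:
  fixes B :: "'b::real_normed_vector set"
  assumes "finite B"
  shows "closed (span B)"
proof -
  obtain d :: nat and e :: "nat \<Rightarrow> 'b" and \<psi> :: "nat \<Rightarrow> ('b \<Rightarrow>\<^sub>L real)"
    where "d \<le> card B" and co: "span (e ` {..<d}) = span B"
    and "\<And>i j. i < d \<Longrightarrow> j < d \<Longrightarrow> \<psi> i (e j) = (if i = j then 1 else 0)"
    and co2: "\<And>x. x \<in> span B \<Longrightarrow> x = (\<Sum>i<d. \<psi> i x *\<^sub>R e i)"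
    by (rule span_coordinates[OF assms]) blast
  have "span B = {x. x = (\<Sum>i<d. \<psi> i x *\<^sub>R e i)}"
  proof (intro equalityI subsetI)
    fix x assume "x \<in> {x. x = (\<Sum>i<d. \<psi> i x *\<^sub>R e i)}"
    then have x: "x = (\<Sum>i<d. \<psi> i x *\<^sub>R e i)" by simp
    have "(\<Sum>i<d. \<psi> i x *\<^sub>R e i) \<in> span (e ` {..<d})"
      by (intro span_sum span_scale span_base) auto
    then show "x \<in> span B" using x co by simp
  qed (use co2 in auto)
  also have "closed \<dots>"
    by (intro closed_Collect_eq continuous_intros)
  finally show ?thesis .
qed

text \<open>Carries the determinant over to doubly indexed families, so that later arguments avoid
  matrix types. The five properties are a crude Leibniz bound, the value at scalar matrices,
  invertibility, Cramer's rule, and dependence on the \<open>d\<close> by \<open>d\<close> block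
  alone.\<close>

lemma determinant_function:
  fixes d :: nat
  obtains D :: "(nat \<Rightarrow> nat \<Rightarrow> real) \<Rightarrow> real" where
    "\<And>m K. (\<And>i j. i < d \<Longrightarrow> j < d \<Longrightarrow> \<bar>m i j\<bar> \<le> K) \<Longrightarrow> \<bar>D m\<bar> \<le> fact d * K ^ d"
    "\<And>c. D (\<lambda>i j. if i = j then c else 0) = c ^ d"
    "\<And>m. D m \<noteq> 0 \<Longrightarrow> \<exists>n. \<forall>i<d. \<forall>j<d. (\<Sum>k<d. m i k * n k j) = (if i = j then 1 else 0) \<and>
        (\<Sum>k<d. n i k * m k j) = (if i = j then 1 else 0)"
    "\<And>m y k. k < d \<Longrightarrow> D (\<lambda>i j. if j = k then (\<Sum>l<d. m i l * y l) else m i j) = y k * D m"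
    "\<And>m m'. (\<And>i j. i < d \<Longrightarrow> j < d \<Longrightarrow> m i j = m' i j) \<Longrightarrow> D m = D m'"
proof -
  define M where "M = (\<lambda>m :: nat \<Rightarrow> nat \<Rightarrow> real. Matrix.mat d d (\<lambda>(i, j). m i j))"
  have M: "M m \<in> carrier_mat d d" for m by (simp add: M_def)
  show ?thesis
  proof (rule that[of "\<lambda>m. Determinant.det (M m)"])
    fix m :: "nat \<Rightarrow> nat \<Rightarrow> real" and K :: real
    assume K: "\<And>i j. i < d \<Longrightarrow> j < d \<Longrightarrow> \<bar>m i j\<bar> \<le> K"
    have "\<bar>Determinant.det (M m)\<bar> \<le> (\<Sum>p | p permutes {0..<d}. \<bar>signof p * (\<Prod>i = 0..<d. M m $$ (i, p i))\<bar>)"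
      unfolding det_def'[OF M] by (rule sum_abs)
    also have "\<dots> \<le> (\<Sum>p | p permutes {0..<d}. K ^ d)"
    proof (rule sum_mono)
      fix p assume p: "p \<in> {p. p permutes {0..<d}}"
      have "\<bar>\<Prod>i = 0..<d. M m $$ (i, p i)\<bar> \<le> (\<Prod>i = 0..<d. K)"
        unfolding abs_prod
      proof (rule prod_mono)
        fix i assume i: "i \<in> {0..<d}"
        then have "p i < d" using p permutes_in_image[of p "{0..<d}" i] by auto
        then show "0 \<le> \<bar>M m $$ (i, p i)\<bar> \<and> \<bar>M m $$ (i, p i)\<bar> \<le> K"
          using i K by (auto simp: M_def)
      qed
      then show "\<bar>signof p * (\<Prod>i = 0..<d. M m $$ (i, p i))\<bar> \<le> K ^ d"
        by (simp add: abs_mult sign_def)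
    qed
    also have "\<dots> = fact d * K ^ d"
      by (simp add: card_permutations[of _ d])
    finally show "\<bar>Determinant.det (M m)\<bar> \<le> fact d * K ^ d" .
  next
    fix c :: real
    have "M (\<lambda>i j. if i = j then c else 0) = c \<cdot>\<^sub>m 1\<^sub>m d"
      by (rule eq_matI) (auto simp: M_def)
    then show "Determinant.det (M (\<lambda>i j. if i = j then c else 0)) = c ^ d" by simp
  next
    fix m :: "nat \<Rightarrow> nat \<Rightarrow> real"
    assume "Determinant.det (M m) \<noteq> 0"
    then have "M m \<in> Units (ring_mat TYPE(real) d ())"
      by (rule det_non_zero_imp_unit[OF M])
    then obtain N where Nc: "N \<in> carrier_mat d d" and NM: "M m * N = 1\<^sub>m d" "N * M m = 1\<^sub>m d"
      by (auto simp: Units_def ring_mat_def)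
    have "(\<Sum>k<d. m i k * N $$ (k, j)) = (if i = j then 1 else 0)" if "i < d" "j < d" for i j
    proof -
      have "(M m * N) $$ (i, j) = (\<Sum>k<d. m i k * N $$ (k, j))"
        using that Nc M[of m] by (simp add: scalar_prod_def M_def atLeast0LessThan)
      then show ?thesis using NM that by simp
    qed
    moreover have "(\<Sum>k<d. N $$ (i, k) * m k j) = (if i = j then 1 else 0)" if "i < d" "j < d" for i j
    proof -
      have "(N * M m) $$ (i, j) = (\<Sum>k<d. N $$ (i, k) * m k j)"
        using that Nc M[of m] by (simp add: scalar_prod_def M_def atLeast0LessThan)
      then show ?thesis using NM that by simp
    qed
    ultimately show "\<exists>n. \<forall>i<d. \<forall>j<d. (\<Sum>k<d. m i k * n k j) = (if i = j then 1 else 0) \<and>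
        (\<Sum>k<d. n i k * m k j) = (if i = j then 1 else 0)"
      by (intro exI[of _ "\<lambda>i j. N $$ (i, j)"]) auto
  next
    fix m :: "nat \<Rightarrow> nat \<Rightarrow> real" and y :: "nat \<Rightarrow> real" and k assume k: "k < d"
    have "replace_col (M m) (M m *\<^sub>v Matrix.vec d y) k
        = M (\<lambda>i j. if j = k then (\<Sum>l<d. m i l * y l) else m i j)"
      by (rule eq_matI) (auto simp: replace_col_def M_def scalar_prod_def atLeast0LessThan)
    then show "Determinant.det (M (\<lambda>i j. if j = k then (\<Sum>l<d. m i l * y l) else m i j)) = y k * Determinant.det (M m)"
      using cramer_lemma_mat[OF M, of "Matrix.vec d y" k m] k by simp
  next
    fix m m' :: "nat \<Rightarrow> nat \<Rightarrow> real"
    assume "\<And>i j. i < d \<Longrightarrow> j < d \<Longrightarrow> m i j = m' i j"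
    then have "M m = M m'" by (intro eq_matI) (auto simp: M_def)
    then show "Determinant.det (M m) = Determinant.det (M m')" by simp
  qed
qed

text \<open>An Auerbach system up to the factor \<open>2\<close>: the basis nearly maximises the determinant over the
  unit ball, and by Cramer's rule the coordinates are quotients of determinants.\<close>

lemma almost_auerbach_system:
  fixes B :: "'b::real_normed_vector set"
  assumes "finite B"
  obtains d :: nat and e :: "nat \<Rightarrow> 'b" and \<psi> :: "nat \<Rightarrow> ('b \<Rightarrow>\<^sub>L real)"
  where "d \<le> card B" "span (e ` {..<d}) = span B"
    "\<And>i j. i < d \<Longrightarrow> j < d \<Longrightarrow> \<psi> i (e j) = (if i = j then 1 else 0)"
    "\<And>x. x \<in> span B \<Longrightarrow> x = (\<Sum>i<d. \<psi> i x *\<^sub>R e i)"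
    "\<And>i. i < d \<Longrightarrow> norm (e i) \<le> 1"
    "\<And>i x. i < d \<Longrightarrow> x \<in> span B \<Longrightarrow> \<bar>\<psi> i x\<bar> \<le> 2 * norm x"
proof -
  obtain d :: nat and e :: "nat \<Rightarrow> 'b" and \<psi> :: "nat \<Rightarrow> ('b \<Rightarrow>\<^sub>L real)"
    where co: "d \<le> card B" "span (e ` {..<d}) = span B"
    "\<And>i j. i < d \<Longrightarrow> j < d \<Longrightarrow> \<psi> i (e j) = (if i = j then 1 else 0)"
    "\<And>x. x \<in> span B \<Longrightarrow> x = (\<Sum>i<d. \<psi> i x *\<^sub>R e i)"
    by (rule span_coordinates[OF assms]) blast
  have eB: "e i \<in> span B" if "i < d" for i using that co(2) by (metis imageI lessThan_iff span_base)
  obtain D :: "(nat \<Rightarrow> nat \<Rightarrow> real) \<Rightarrow> real" where D: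
    "\<And>m K. (\<And>i j. i < d \<Longrightarrow> j < d \<Longrightarrow> \<bar>m i j\<bar> \<le> K) \<Longrightarrow> \<bar>D m\<bar> \<le> fact d * K ^ d"
    "\<And>c. D (\<lambda>i j. if i = j then c else 0) = c ^ d"
    "\<And>m. D m \<noteq> 0 \<Longrightarrow> \<exists>n. \<forall>i<d. \<forall>j<d. (\<Sum>k<d. m i k * n k j) = (if i = j then 1 else 0) \<and>
        (\<Sum>k<d. n i k * m k j) = (if i = j then 1 else 0)"
    "\<And>m y k. k < d \<Longrightarrow> D (\<lambda>i j. if j = k then (\<Sum>l<d. m i l * y l) else m i j) = y k * D m"
    and Dcong: "\<And>m m'. (\<And>i j. i < d \<Longrightarrow> j < d \<Longrightarrow> m i j = m' i j) \<Longrightarrow> D m = D m'"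
    by (rule determinant_function[of d]) blast
  define U :: "(nat \<Rightarrow> 'b) set" where "U = {u. \<forall>i. u i \<in> span B \<and> norm (u i) \<le> 1}"
  define V where "V = (\<lambda>u. \<bar>D (\<lambda>i j. \<psi> i (u j))\<bar>)"
  define K where "K = (\<Sum>i<d. norm (\<psi> i))"
  have "\<bar>\<psi> i x\<bar> \<le> K" if "i < d" "norm x \<le> 1" for i x
  proof -
    have "\<bar>\<psi> i x\<bar> \<le> norm (\<psi> i) * norm x" using norm_blinfun[of "\<psi> i" x] by simp
    also have "\<dots> \<le> norm (\<psi> i)" using that by (simp add: mult_left_le)
    also have "\<dots> \<le> K" unfolding K_def using that by (intro member_le_sum) auto
    finally show ?thesis .
  qed
  then have bdd: "bdd_above (V ` U)"
  proof (intro bdd_aboveI[of _ "fact d * K ^ d"])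
    fix r assume "r \<in> V ` U"
    then obtain u where "u \<in> U" "r = V u" by blast
    then show "r \<le> fact d * K ^ d"
      using \<open>\<And>x i. i < d \<Longrightarrow> norm x \<le> 1 \<Longrightarrow> \<bar>\<psi> i x\<bar> \<le> K\<close> unfolding V_def by (auto simp: U_def intro: D(1))
  qed
  define \<beta> where "\<beta> = 1 + (\<Sum>i<d. norm (e i))"
  have \<beta>: "\<beta> > 0" "\<And>i. i < d \<Longrightarrow> norm (e i) \<le> \<beta>"
    using member_le_sum[of _ "{..<d}" "\<lambda>i. norm (e i)"]
    by (auto simp: \<beta>_def intro!: add_pos_nonneg sum_nonneg add_increasing)
  define u0 where "u0 = (\<lambda>i. if i < d then (1 / \<beta>) *\<^sub>R e i else 0)"
  have u0: "u0 \<in> U" using \<beta> eB by (auto simp: U_def u0_def span_scale span_zero)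
  have "D (\<lambda>i j. \<psi> i (u0 j)) = D (\<lambda>i j. if i = j then 1 / \<beta> else 0)"
    using co(3) by (intro Dcong) (auto simp: u0_def blinfun.scaleR_right)
  then have V0: "V u0 > 0" using \<beta> D(2) by (simp add: V_def)
  have "Sup (V ` U) / 2 < Sup (V ` U)"
    using V0 cSup_upper[OF imageI[OF u0, of V] bdd] by simp
  then obtain u where u: "u \<in> U" "Sup (V ` U) / 2 < V u"
    using less_cSup_iff[OF _ bdd] u0 by blast
  have max: "V v \<le> 2 * V u" if "v \<in> U" for v
    using cSup_upper[OF imageI[OF that, of V] bdd] u(2) by simp
  have Vu: "V u > 0" using max[OF u0] V0 by simp
  then obtain n where n: "\<And>i j. i < d \<Longrightarrow> j < d \<Longrightarrow> (\<Sum>k<d. \<psi> i (u k) * n k j) = (if i = j then 1 else 0)"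
    "\<And>i j. i < d \<Longrightarrow> j < d \<Longrightarrow> (\<Sum>k<d. n i k * \<psi> k (u j)) = (if i = j then 1 else 0)"
    using D(3)[of "\<lambda>i j. \<psi> i (u j)"] by (auto simp: V_def)
  define \<theta> where "\<theta> = (\<lambda>k. \<Sum>i<d. n k i *\<^sub>R \<psi> i)"
  have \<theta>: "\<theta> k x = (\<Sum>i<d. n k i * \<psi> i x)" for k x
    by (simp add: \<theta>_def blinfun.sum_left blinfun.scaleR_left)
  have coord: "(\<Sum>k<d. \<psi> i (u k) * \<theta> k x) = \<psi> i x" if "i < d" for i x
  proof -
    have "(\<Sum>k<d. \<psi> i (u k) * \<theta> k x) = (\<Sum>j<d. (\<Sum>k<d. \<psi> i (u k) * n k j) * \<psi> j x)"
      unfolding \<theta> sum_distrib_left sum_distrib_right by (subst sum.swap) (simp add: mult.assoc)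
    also have "\<dots> = (\<Sum>j<d. if j = i then \<psi> j x else 0)"
      using n(1) that by (intro sum.cong) auto
    finally show ?thesis using that by simp
  qed
  have exp: "x = (\<Sum>k<d. \<theta> k x *\<^sub>R u k)" if "x \<in> span B" for x
  proof -
    have "(\<Sum>k<d. \<theta> k x *\<^sub>R u k) \<in> span B"
      using u by (intro span_sum span_scale) (auto simp: U_def)
    then have "(\<Sum>k<d. \<theta> k x *\<^sub>R u k) = (\<Sum>i<d. \<psi> i (\<Sum>k<d. \<theta> k x *\<^sub>R u k) *\<^sub>R e i)"
      by (rule co(4))
    also have "\<dots> = (\<Sum>i<d. \<psi> i x *\<^sub>R e i)"
      using coord by (intro sum.cong) (auto simp: blinfun.sum_right blinfun.scaleR_right mult.commute)
    finally show ?thesis using co(4)[OF that] by simp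
  qed
  show ?thesis
  proof (rule that[of d u \<theta>])
    show "d \<le> card B" by (rule co(1))
    show "span (u ` {..<d}) = span B"
    proof (intro equalityI)
      show "span (u ` {..<d}) \<subseteq> span B" using u by (intro span_minimal) (auto simp: U_def)
      show "span B \<subseteq> span (u ` {..<d})"
      proof
        fix x assume "x \<in> span B"
        moreover have "(\<Sum>k<d. \<theta> k x *\<^sub>R u k) \<in> span (u ` {..<d})"
          by (intro span_sum span_scale span_base) auto
        ultimately show "x \<in> span (u ` {..<d})" using exp by simp
      qed
    qed
    show "\<theta> i (u j) = (if i = j then 1 else 0)" if "i < d" "j < d" for i j
      using n(2) that by (simp add: \<theta>)
    show "x = (\<Sum>i<d. \<theta> i x *\<^sub>R u i)" if "x \<in> span B" for x by (rule exp[OF that])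
    show "norm (u i) \<le> 1" for i using u by (simp add: U_def)
    show "\<bar>\<theta> i x\<bar> \<le> 2 * norm x" if i: "i < d" and x: "x \<in> span B" for i x
    proof (cases "x = 0")
      case False
      define y where "y = (1 / norm x) *\<^sub>R x"
      \<comment> \<open>Replacing the \<open>i\<close>-th vector by a unit vector \<open>y\<close>
        multiplies the determinant by the coordinate \<open>\<theta> i y\<close>, so near-maximality
        bounds that coordinate by 2.\<close>
      have "u(i := y) \<in> U" using u x False by (auto simp: U_def y_def span_scale)
      then have le: "V (u(i := y)) \<le> 2 * V u" by (rule max)
      have "D (\<lambda>k j. if j = i then (\<Sum>l<d. \<psi> k (u l) * \<theta> l y) else \<psi> k (u j)) = \<theta> i y * D (\<lambda>k j. \<psi> k (u j))"
        by (rule D(4)[OF i])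
      moreover have "D (\<lambda>k j. if j = i then (\<Sum>l<d. \<psi> k (u l) * \<theta> l y) else \<psi> k (u j)) = D (\<lambda>k j. \<psi> k ((u(i := y)) j))"
        by (rule Dcong) (auto simp: coord)
      ultimately have "V (u(i := y)) = \<bar>\<theta> i y\<bar> * V u" by (simp add: V_def abs_mult)
      then have "\<bar>\<theta> i y\<bar> \<le> 2" using le Vu by simp
      then show ?thesis using False by (simp add: y_def blinfun.scaleR_right field_simps abs_mult)
    qed (simp)
  qed
qed

section \<open>Cardinality of separated sets and nets in finite dimensional spaces\<close>

lemma maximal_separated_net:
  fixes S :: "'b::metric_space set"
  assumes bound: "\<And>W. finite W \<Longrightarrow> W \<subseteq> S \<Longrightarrow> (\<forall>x\<in>W. \<forall>y\<in>W. x \<noteq> y \<longrightarrow> \<epsilon> \<le> dist x y) \<Longrightarrow> real (card W) \<le> N"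
    and e: "\<epsilon> > 0"
  obtains W where "finite W" "W \<subseteq> S" "real (card W) \<le> N" "\<And>x. x \<in> S \<Longrightarrow> \<exists>w\<in>W. dist x w < \<epsilon>"
proof -
  define P where "P = (\<lambda>W. finite W \<and> W \<subseteq> S \<and> (\<forall>x\<in>W. \<forall>y\<in>W. x \<noteq> y \<longrightarrow> \<epsilon> \<le> dist x y))"
  have "P {}" by (simp add: P_def)
  moreover have "\<forall>W. P W \<longrightarrow> card W < Suc (nat \<lceil>N\<rceil>)"
  proof (intro allI impI)
    fix W assume "P W"
    then have "real (card W) \<le> N" using bound by (simp add: P_def)
    also have "N \<le> real (nat \<lceil>N\<rceil>)" by (rule real_nat_ceiling_ge)
    finally show "card W < Suc (nat \<lceil>N\<rceil>)" by simp
  qed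
  ultimately obtain W where W: "P W" and max: "\<And>V. P V \<Longrightarrow> card V \<le> card W"
    using ex_has_greatest_nat[of P "{}" card] by blast
  show ?thesis
  proof (rule that[of W])
    show "finite W" "W \<subseteq> S" "real (card W) \<le> N" using W bound by (auto simp: P_def)
    fix x assume x: "x \<in> S"
    show "\<exists>w\<in>W. dist x w < \<epsilon>"
    proof (rule ccontr)
      assume "\<not> ?thesis"
      then have far: "\<And>w. w \<in> W \<Longrightarrow> \<epsilon> \<le> dist x w" by force
      then have "P (insert x W)" using W x by (auto simp: P_def dist_commute)
      moreover have "x \<notin> W" using far e by force
      ultimately show False using max[of "insert x W"] W by (simp add: P_def)
    qed
  qed
qed

text \<open>Pigeonhole principle for the grid of width \<epsilon>/\<open>d\<close> in the
  coordinates: as the basis vectors have norm at most 1, two points in one cell are closer than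
  \<epsilon>. The estimate is crude in \<open>d\<close>, but only polynomial in \<open>R\<close>,
  which is all that the amplification requires.\<close>

lemma separated_card_bound:
  fixes E :: "'b::real_normed_vector set" and \<psi> :: "nat \<Rightarrow> ('b \<Rightarrow>\<^sub>L real)"
  assumes E: "subspace E"
    and exp: "\<And>x. x \<in> E \<Longrightarrow> x = (\<Sum>i<d. \<psi> i x *\<^sub>R e i)"
    and e: "\<And>i. i < d \<Longrightarrow> norm (e i) \<le> 1"
    and \<psi>: "\<And>i x. i < d \<Longrightarrow> x \<in> E \<Longrightarrow> \<bar>\<psi> i x\<bar> \<le> 2 * norm x"
    and eps: "\<epsilon> > 0" and R: "R \<ge> 0"
    and W: "finite W" "W \<subseteq> E" "\<And>w. w \<in> W \<Longrightarrow> norm w \<le> R"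
    and sep: "\<And>x y. x \<in> W \<Longrightarrow> y \<in> W \<Longrightarrow> x \<noteq> y \<Longrightarrow> \<epsilon> \<le> dist x y"
  shows "real (card W) \<le> (4 * R * d / \<epsilon> + 3) ^ d"
proof -
  define q where "q = real d / \<epsilon>"
  define c where "c = \<lceil>2 * R * q\<rceil>"
  have q0: "q \<ge> 0" using eps by (simp add: q_def)
  have c0: "c \<ge> 0"
    unfolding c_def using mult_nonneg_nonneg[of "2 * R" q] R q0 by linarith
  define F where "F = (\<lambda>x. \<lambda>i\<in>{..<d}. \<lfloor>q * \<psi> i x\<rfloor>)"
  have "inj_on F W"
  proof (rule inj_onI, rule ccontr)
    fix x y assume xy: "x \<in> W" "y \<in> W" "F x = F y" "x \<noteq> y"
    have d: "d > 0"
    proof (rule ccontr)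
      assume "\<not> d > 0"
      then have "x = 0" "y = 0" using exp[of x] exp[of y] xy W by auto
      then show False using xy by simp
    qed
    have q: "q > 0" using d eps by (simp add: q_def)
    have lt: "\<bar>\<psi> i (x - y)\<bar> < 1 / q" if "i < d" for i
    proof -
      have "\<lfloor>q * \<psi> i x\<rfloor> = \<lfloor>q * \<psi> i y\<rfloor>" using fun_cong[OF xy(3), of i] that by (simp add: F_def)
      then have "\<bar>q * \<psi> i x - q * \<psi> i y\<bar> < 1" by linarith
      then have "q * \<bar>\<psi> i (x - y)\<bar> < 1"
        using q by (simp add: blinfun.diff_right right_diff_distrib[symmetric] abs_mult)
      then show ?thesis using q by (simp add: field_simps)
    qed
    have "x - y \<in> E" using xy W E by (auto intro: subspace_diff)
    then have "norm (x - y) = norm (\<Sum>i<d. \<psi> i (x - y) *\<^sub>R e i)" using exp by metis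
    also have "\<dots> \<le> (\<Sum>i<d. \<bar>\<psi> i (x - y)\<bar> * norm (e i))"
      by (rule order_trans[OF norm_sum]) simp
    also have "\<dots> \<le> (\<Sum>i<d. \<bar>\<psi> i (x - y)\<bar>)"
      using e by (intro sum_mono) (simp add: mult_left_le)
    also have "\<dots> < (\<Sum>i<d. 1 / q)"
      using lt d by (intro sum_strict_mono) auto
    also have "\<dots> = \<epsilon>" using d eps by (simp add: q_def)
    finally show False using sep[OF xy(1,2,4)] by (simp add: dist_norm)
  qed
  moreover have "F ` W \<subseteq> (\<Pi>\<^sub>E i\<in>{..<d}. {-c..c})"
  proof
    fix f assume "f \<in> F ` W"
    then obtain x where x: "x \<in> W" "f = F x" by auto
    have "-c \<le> \<lfloor>q * \<psi> i x\<rfloor> \<and> \<lfloor>q * \<psi> i x\<rfloor> \<le> c" if "i < d" for i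
    proof -
      have "\<bar>q * \<psi> i x\<bar> \<le> q * (2 * R)"
        using \<psi>[OF that, of x] W(3)[OF x(1)] W(2) x(1) q0 unfolding abs_mult
        by (intro mult_mono) auto
      then have "\<bar>q * \<psi> i x\<bar> \<le> of_int c" unfolding c_def by (simp add: mult.commute) linarith
      then show ?thesis by linarith
    qed
    then show "f \<in> (\<Pi>\<^sub>E i\<in>{..<d}. {-c..c})" using x by (auto simp: F_def)
  qed
  ultimately have "card W \<le> card (\<Pi>\<^sub>E i\<in>{..<d}. {-c..c})"
    by (intro card_inj_on_le) (auto intro: finite_PiE)
  also have "\<dots> = (nat (2 * c + 1)) ^ d"
    by (simp add: card_PiE)
  finally have "real (card W) \<le> real (nat (2 * c + 1)) ^ d" by (metis of_nat_le_iff of_nat_power)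
  also have "\<dots> \<le> (4 * R * d / \<epsilon> + 3) ^ d"
  proof (rule power_mono)
    have "of_int c \<le> 2 * R * q + 1" unfolding c_def by linarith
    then show "real (nat (2 * c + 1)) \<le> 4 * R * d / \<epsilon> + 3" using c0 by (simp add: q_def)
  qed simp
  finally show ?thesis .
qed

text \<open>Iterating \<open>W \<mapsto> (1 + 2/\<epsilon>) W + A\<close> amplifies the cardinality of a separated set \<open>A\<close> while the
  radius grows by \<open>1 + 2/\<epsilon>\<close>; this replaces the usual comparison of volumes.\<close>

lemma separated_amplification:
  fixes A :: "'b::real_normed_vector set"
  assumes E: "subspace E" and A: "finite A" "A \<subseteq> E" "\<And>a. a \<in> A \<Longrightarrow> norm a \<le> 1"
    and eps: "\<epsilon> > 0"
    and sep: "\<And>x y. x \<in> A \<Longrightarrow> y \<in> A \<Longrightarrow> x \<noteq> y \<Longrightarrow> \<epsilon> \<le> dist x y"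
  shows "\<exists>W. finite W \<and> W \<subseteq> E \<and> card W = card A ^ k \<and> (\<forall>w\<in>W. norm w \<le> \<epsilon> / 2 * ((1 + 2 / \<epsilon>) ^ k - 1))
    \<and> (\<forall>x\<in>W. \<forall>y\<in>W. x \<noteq> y \<longrightarrow> \<epsilon> \<le> dist x y)"
proof (induction k)
  case 0
  show ?case using subspace_0[OF E] by (intro exI[of _ "{0}"]) auto
next
  case (Suc k)
  obtain W where W': "finite W" "W \<subseteq> E" "card W = card A ^ k"
    "\<forall>w\<in>W. norm w \<le> \<epsilon> / 2 * ((1 + 2 / \<epsilon>) ^ k - 1)"
    "\<forall>x\<in>W. \<forall>y\<in>W. x \<noteq> y \<longrightarrow> \<epsilon> \<le> dist x y"
    using Suc.IH by (elim exE conjE) (rule that)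
  note W = W'(1-3) W'(4)[rule_format] W'(5)[rule_format]
  \<comment> \<open>This dilation gives \<open>l * \<epsilon> = \<epsilon> + 2\<close>: distinct
    centres move at least \<open>\<epsilon> + 2\<close> apart, and adding points of
    \<open>A\<close>, whose mutual distances are at most 2, costs no more than 2.\<close>
  define l where "l = 1 + 2 / \<epsilon>"
  have l: "l > 0" "l * \<epsilon> = \<epsilon> + 2" using eps by (auto simp: l_def field_simps add_pos_pos)
  define f :: "'b \<times> 'b \<Rightarrow> 'b" where "f = (\<lambda>(w, a). l *\<^sub>R w + a)"
  have far: "\<epsilon> \<le> dist (f p) (f q)" if pq: "p \<in> W \<times> A" "q \<in> W \<times> A" "p \<noteq> q" for p q
  proof -
    obtain w a v b where p: "p = (w, a)" "q = (v, b)" by (cases p, cases q)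
    show ?thesis
    proof (cases "w = v")
      case True
      then show ?thesis using pq p sep[of a b] by (auto simp: f_def dist_norm)
    next
      case False
      have "\<epsilon> + 2 \<le> l * norm (w - v)"
        using W(5)[of w v] False pq p l by (metis dist_norm SigmaD1 mult_left_mono less_imp_le)
      also have "\<dots> = norm (l *\<^sub>R (w - v))" using l by simp
      also have "\<dots> = norm ((f p - f q) - (a - b))" by (simp add: f_def p algebra_simps)
      also have "\<dots> \<le> norm (f p - f q) + norm (a - b)" by (rule norm_triangle_ineq4)
      also have "norm (a - b) \<le> 2"
        using norm_triangle_ineq4[of a b] A(3)[of a] A(3)[of b] pq p by force
      finally show ?thesis by (simp add: dist_norm)
    qed
  qed
  have inj: "inj_on f (W \<times> A)"
    using far eps by (intro inj_onI) (metis dist_self not_le)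
  show ?case
  proof (intro exI[of _ "f ` (W \<times> A)"] conjI ballI impI)
    show "finite (f ` (W \<times> A))" using W A by auto
    show "f ` (W \<times> A) \<subseteq> E"
      using W A E by (auto simp: f_def intro!: subspace_add subspace_scale)
    show "card (f ` (W \<times> A)) = card A ^ Suc k"
      using inj W(3) by (simp add: card_image card_cartesian_product)
    show "norm x \<le> \<epsilon> / 2 * ((1 + 2 / \<epsilon>) ^ Suc k - 1)" if "x \<in> f ` (W \<times> A)" for x
    proof -
      obtain w a where wa: "w \<in> W" "a \<in> A" "x = l *\<^sub>R w + a" using \<open>x \<in> f ` (W \<times> A)\<close> by (auto simp: f_def)
      have "norm x \<le> l * norm w + norm a" using norm_triangle_ineq[of "l *\<^sub>R w" a] l wa by simp
      also have "\<dots> \<le> l * (\<epsilon> / 2 * (l ^ k - 1)) + 1"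
        using W(4)[OF wa(1)] A(3)[OF wa(2)] l by (intro add_mono mult_left_mono) (auto simp: l_def)
      also have "\<dots> = \<epsilon> / 2 * (l * l ^ k) - (l * \<epsilon>) / 2 + 1"
        by (simp add: field_simps)
      also have "\<dots> = \<epsilon> / 2 * (l * l ^ k - 1)"
        unfolding l(2) by (simp add: field_simps)
      finally show ?thesis by (simp add: l_def)
    qed
    show "\<epsilon> \<le> dist x y" if "x \<in> f ` (W \<times> A)" "y \<in> f ` (W \<times> A)" "x \<noteq> y" for x y
      using far that by auto
  qed
qed

text \<open>The power trick: a constant independent of the exponent disappears after taking
  \<open>k\<close>-th roots.\<close>

lemma power_bound_from_growth:
  fixes a b :: real
  assumes "b > 0" and "\<And>k. a ^ k \<le> c * b ^ k"
  shows "a \<le> b"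
proof (rule ccontr)
  assume "\<not> a \<le> b"
  then have "a / b > 1" using assms(1) by simp
  then obtain k where "c < (a / b) ^ k" using real_arch_pow by blast
  moreover have "(a / b) ^ k \<le> c"
    using assms(2)[of k] assms(1) by (simp add: power_divide field_simps)
  ultimately show False by simp
qed

text \<open>The amplified set has \<open>card A ^ k\<close> points within a radius of order
  \<open>(1 + 2 / \<epsilon>) ^ k\<close>. The grid bound then reads \<open>card A ^ k \<le> (2 * d
  + 3) ^ d * ((1 + 2 / \<epsilon>) ^ d) ^ k\<close>, and the power trick removes the first factor.
  What remains is the usual volumetric bound.\<close>

lemma sphere_separated_card:
  fixes E :: "'b::real_normed_vector set" and \<psi> :: "nat \<Rightarrow> ('b \<Rightarrow>\<^sub>L real)"
  assumes E: "subspace E"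
    and exp: "\<And>x. x \<in> E \<Longrightarrow> x = (\<Sum>i<d. \<psi> i x *\<^sub>R e i)"
    and e: "\<And>i. i < d \<Longrightarrow> norm (e i) \<le> 1"
    and \<psi>: "\<And>i x. i < d \<Longrightarrow> x \<in> E \<Longrightarrow> \<bar>\<psi> i x\<bar> \<le> 2 * norm x"
    and eps: "\<epsilon> > 0"
    and A: "finite A" "A \<subseteq> E" "\<And>a. a \<in> A \<Longrightarrow> norm a \<le> 1"
    and sep: "\<And>x y. x \<in> A \<Longrightarrow> y \<in> A \<Longrightarrow> x \<noteq> y \<Longrightarrow> \<epsilon> \<le> dist x y"
  shows "real (card A) \<le> (1 + 2 / \<epsilon>) ^ d"
proof (rule power_bound_from_growth[where c = "(2 * d + 3) ^ d"])
  define l where "l = 1 + 2 / \<epsilon>"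
  have l: "l \<ge> 1" using eps by (simp add: l_def)
  then show "(1 + 2 / \<epsilon>) ^ d > 0" by (simp add: l_def[symmetric])
  fix k
  have lk: "l ^ k \<ge> 1" using l by simp
  obtain W where W': "finite W" "W \<subseteq> E" "card W = card A ^ k"
    "\<forall>w\<in>W. norm w \<le> \<epsilon> / 2 * (l ^ k - 1)"
    "\<forall>x\<in>W. \<forall>y\<in>W. x \<noteq> y \<longrightarrow> \<epsilon> \<le> dist x y"
    using separated_amplification[of E A \<epsilon> k] E A eps sep unfolding l_def by metis
  note W = W'(1-3) W'(4)[rule_format] W'(5)[rule_format]
  have "real (card A) ^ k = real (card W)" by (simp add: W(3))
  also have "\<dots> \<le> (4 * (\<epsilon> / 2 * (l ^ k - 1)) * d / \<epsilon> + 3) ^ d"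
    by (rule separated_card_bound[OF E exp e \<psi> eps _ W(1,2,4,5)]) (use lk eps in auto)
  also have "\<dots> \<le> ((2 * d + 3) * l ^ k) ^ d"
  proof (rule power_mono)
    have "4 * (\<epsilon> / 2 * (l ^ k - 1)) * d / \<epsilon> + 3 = 2 * d * (l ^ k - 1) + 3" using eps by simp
    also have "\<dots> \<le> 2 * d * l ^ k + 3 * l ^ k" using lk by (simp add: right_diff_distrib)
    finally show "4 * (\<epsilon> / 2 * (l ^ k - 1)) * d / \<epsilon> + 3 \<le> (2 * d + 3) * l ^ k"
      by (simp add: algebra_simps)
    show "0 \<le> 4 * (\<epsilon> / 2 * (l ^ k - 1)) * d / \<epsilon> + 3" using lk eps by simp
  qed
  also have "\<dots> = real ((2 * d + 3) ^ d) * (l ^ d) ^ k"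
    by (simp add: power_mult_distrib power_mult[symmetric] mult.commute)
  finally show "real (card A) ^ k \<le> real ((2 * d + 3) ^ d) * ((1 + 2 / \<epsilon>) ^ d) ^ k"
    by (simp add: l_def)
qed

lemma finite_dim_ball_net:
  fixes B :: "'b::real_normed_vector set"
  assumes B: "finite B" and eps: "\<epsilon> > 0"
  obtains W where "finite W" "W \<subseteq> span B" "\<And>x. x \<in> span B \<Longrightarrow> norm x \<le> R \<Longrightarrow> \<exists>w\<in>W. dist x w < \<epsilon>"
proof -
  obtain d :: nat and e :: "nat \<Rightarrow> 'b" and \<psi> :: "nat \<Rightarrow> ('b \<Rightarrow>\<^sub>L real)"
    where co: "\<And>x. x \<in> span B \<Longrightarrow> x = (\<Sum>i<d. \<psi> i x *\<^sub>R e i)"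
    "\<And>i. i < d \<Longrightarrow> norm (e i) \<le> 1"
    "\<And>i x. i < d \<Longrightarrow> x \<in> span B \<Longrightarrow> \<bar>\<psi> i x\<bar> \<le> 2 * norm x"
    by (rule almost_auerbach_system[OF B]) blast
  obtain W where "finite W" "W \<subseteq> {x \<in> span B. norm x \<le> \<bar>R\<bar>}"
    "\<And>x. x \<in> {x \<in> span B. norm x \<le> \<bar>R\<bar>} \<Longrightarrow> \<exists>w\<in>W. dist x w < \<epsilon>"
    by (rule maximal_separated_net[OF _ eps, where N = "(4 * \<bar>R\<bar> * d / \<epsilon> + 3) ^ d" and S = "{x \<in> span B. norm x \<le> \<bar>R\<bar>}"])
      (rule separated_card_bound[OF subspace_span co eps], auto)
  then show ?thesis by (intro that[of W]) auto
qed

section \<open>Averages over boxes and the trace inequality\<close>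

definition segment_average :: "'b::real_normed_vector \<Rightarrow> ('b \<Rightarrow> real) \<Rightarrow> 'b \<Rightarrow> real" where
  "segment_average u h x = integral {0..1} (\<lambda>t. h (x + t *\<^sub>R u))"

text \<open>The mean over \<open>x + zonotope us\<close> of the image of the uniform measure on the
  unit cube. Iterated integrals in one variable make sense in any normed space, and the edges may be
  linearly dependent.\<close>

fun box_average :: "'b::real_normed_vector list \<Rightarrow> ('b \<Rightarrow> real) \<Rightarrow> 'b \<Rightarrow> real" where
  "box_average [] h = h"
| "box_average (u # us) h = segment_average u (box_average us h)"

fun zonotope :: "'b::real_normed_vector list \<Rightarrow> 'b set" where
  "zonotope [] = {0}"
| "zonotope (u # us) = {t *\<^sub>R u + y | t y. 0 \<le> t \<and> t \<le> 1 \<and> y \<in> zonotope us}"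

lemma segment_integrable:
  fixes h :: "'b::real_normed_vector \<Rightarrow> real"
  assumes "continuous_on UNIV h"
  shows "(\<lambda>t. h (x + t *\<^sub>R u)) integrable_on {0..1}"
  by (intro integrable_continuous_real continuous_on_compose2[OF assms] continuous_intros) auto

lemma continuous_segment_average:
  fixes h :: "'b::real_normed_vector \<Rightarrow> real"
  assumes "continuous_on UNIV h"
  shows "continuous_on UNIV (segment_average u h)"
proof -
  have "continuous_on (UNIV \<times> cbox 0 1) (\<lambda>(x, t). h (x + t *\<^sub>R u))"
    unfolding case_prod_beta
    by (intro continuous_on_compose2[OF assms] continuous_intros) auto
  then have "continuous_on UNIV (\<lambda>x. integral (cbox 0 1) (\<lambda>t. h (x + t *\<^sub>R u)))"
    by (rule integral_continuous_on_param)
  then show ?thesis by (simp add: segment_average_def[abs_def])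
qed

lemma continuous_box_average:
  fixes h :: "'b::real_normed_vector \<Rightarrow> real"
  assumes "continuous_on UNIV h"
  shows "continuous_on UNIV (box_average us h)"
  using assms by (induction us) (auto intro: continuous_segment_average)

lemma box_average_sum:
  fixes h :: "'i \<Rightarrow> 'b::real_normed_vector \<Rightarrow> real"
  assumes "finite I" "\<And>i. i \<in> I \<Longrightarrow> continuous_on UNIV (h i)"
  shows "box_average us (\<lambda>y. \<Sum>i\<in>I. c i * h i y) = (\<lambda>x. \<Sum>i\<in>I. c i * box_average us (h i) x)"
proof (induction us)
  case (Cons u us)
  show ?case
  proof
    fix x
    have "integral {0..1} (\<lambda>t. \<Sum>i\<in>I. c i * box_average us (h i) (x + t *\<^sub>R u))
        = (\<Sum>i\<in>I. c i * integral {0..1} (\<lambda>t. box_average us (h i) (x + t *\<^sub>R u)))"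
      using assms
      by (subst integral_sum) (auto intro!: segment_integrable continuous_intros continuous_box_average)
    then show "box_average (u # us) (\<lambda>y. \<Sum>i\<in>I. c i * h i y) x = (\<Sum>i\<in>I. c i * box_average (u # us) (h i) x)"
      by (simp add: Cons.IH segment_average_def)
  qed
qed simp

lemma box_average_shift_diff:
  fixes h :: "'b::real_normed_vector \<Rightarrow> real"
  assumes h: "continuous_on UNIV h"
  shows "box_average us (\<lambda>y. h (y + w) - h y) x = box_average us h (x + w) - box_average us h x"
proof (induction us arbitrary: x)
  case (Cons u us)
  have "box_average (u # us) (\<lambda>y. h (y + w) - h y) x
      = integral {0..1} (\<lambda>t. box_average us h ((x + w) + t *\<^sub>R u) - box_average us h (x + t *\<^sub>R u))"
    by (simp add: segment_average_def Cons.IH algebra_simps)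
  also have "\<dots> = box_average (u # us) h (x + w) - box_average (u # us) h x"
    using h by (subst integral_diff) (auto simp: segment_average_def intro!: segment_integrable continuous_box_average)
  finally show ?case .
qed simp

lemma segment_average_commute:
  fixes h :: "'b::real_normed_vector \<Rightarrow> real"
  assumes h: "continuous_on UNIV h"
  shows "segment_average u (segment_average v h) = segment_average v (segment_average u h)"
proof
  fix x
  have "continuous_on (cbox (0, 0) (1, 1)) (\<lambda>(s, t). h (x + s *\<^sub>R u + t *\<^sub>R v))"
    unfolding case_prod_beta
    by (intro continuous_on_compose2[OF h] continuous_intros) auto
  then have "integral (cbox 0 1) (\<lambda>s. integral (cbox 0 1) (\<lambda>t. h (x + s *\<^sub>R u + t *\<^sub>R v)))
      = integral (cbox 0 1) (\<lambda>t. integral (cbox 0 1) (\<lambda>s. h (x + s *\<^sub>R u + t *\<^sub>R v)))"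
    by (rule integral_swap_continuous)
  then show "segment_average u (segment_average v h) x = segment_average v (segment_average u h) x"
    by (simp add: segment_average_def algebra_simps)
qed

text \<open>Since the averages commute, any chosen edge can be made the outermost one, where the
  fundamental theorem of calculus applies to it.\<close>

lemma box_average_move:
  fixes h :: "'b::real_normed_vector \<Rightarrow> real"
  assumes h: "continuous_on UNIV h"
  shows "box_average (us @ u # vs) h = segment_average u (box_average (us @ vs) h)"
proof (induction us)
  case (Cons v us)
  then show ?case
    using segment_average_commute[OF continuous_box_average[OF h]] by simp
qed simp

lemma box_average_le:
  fixes h :: "'b::real_normed_vector \<Rightarrow> real"
  assumes h: "continuous_on UNIV h" and "\<And>y. y \<in> zonotope us \<Longrightarrow> h (x + y) \<le> c"
  shows "box_average us h x \<le> c"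
  using assms(2)
proof (induction us arbitrary: x)
  case (Cons u us)
  have "box_average us h (x + t *\<^sub>R u) \<le> c" if "t \<in> {0..1}" for t
  proof (rule Cons.IH)
    fix y assume "y \<in> zonotope us"
    then have "t *\<^sub>R u + y \<in> zonotope (u # us)" using that by auto
    then show "h (x + t *\<^sub>R u + y) \<le> c" using Cons.prems by (simp add: add.assoc)
  qed
  then have "integral {0..1} (\<lambda>t. box_average us h (x + t *\<^sub>R u)) \<le> integral {0..1::real} (\<lambda>t. c)"
    by (intro integral_le segment_integrable[OF continuous_box_average[OF h]]) auto
  then show ?case by (simp add: segment_average_def)
qed auto

lemma box_average_ge:
  fixes h :: "'b::real_normed_vector \<Rightarrow> real"
  assumes h: "continuous_on UNIV h" and ge: "\<And>y. y \<in> zonotope us \<Longrightarrow> c \<le> h (x + y)"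
  shows "c \<le> box_average us h x"
proof -
  have "box_average us (\<lambda>y. - h y) x \<le> - c"
    using ge h by (intro box_average_le continuous_intros) auto
  moreover have "box_average us (\<lambda>y. \<Sum>i\<in>{()}. (- 1) * h y) = (\<lambda>x. \<Sum>i\<in>{()}. (- 1) * box_average us h x)"
    by (rule box_average_sum) (use h in auto)
  ultimately show ?thesis by (simp add: fun_eq_iff)
qed

lemma zonotope_map:
  assumes "y \<in> zonotope (map w is)" "distinct is"
  shows "\<exists>t. (\<forall>i. 0 \<le> t i \<and> t i \<le> 1) \<and> y = (\<Sum>i\<in>set is. t i *\<^sub>R w i)"
  using assms
proof (induction "is" arbitrary: y)
  case Nil
  then show ?case by (auto intro: exI[of _ "\<lambda>_. 0"])
next
  case (Cons i "is")
  then obtain s z where sz: "0 \<le> s" "s \<le> 1" "z \<in> zonotope (map w is)" "y = s *\<^sub>R w i + z" by auto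
  then obtain t where t: "\<forall>i. 0 \<le> t i \<and> t i \<le> 1" "z = (\<Sum>i\<in>set is. t i *\<^sub>R w i)"
    using Cons.IH Cons.prems(2) by (metis distinct.simps(2))
  have "(\<Sum>j\<in>set is. (t(i := s)) j *\<^sub>R w j) = z"
    unfolding t(2) using Cons.prems(2) by (intro sum.cong) auto
  then have "y = (\<Sum>j\<in>set (i # is). (t(i := s)) j *\<^sub>R w j)"
    using Cons.prems(2) sz by simp
  then show ?case using t sz by (intro exI[of _ "t(i := s)"]) auto
qed

text \<open>The edges left over after differentiation: the derivative of a box average along its
  edge \<open>w k\<close> is the mean of \<open>h (y + w k) - h y\<close> over the box spanned by
  the other edges.\<close>

definition omit_index :: "(nat \<Rightarrow> 'b) \<Rightarrow> nat \<Rightarrow> nat \<Rightarrow> 'b list" where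
  "omit_index w p k = map w ([0..<k] @ [Suc k..<p])"

lemma zonotope_omit_index:
  assumes "y \<in> zonotope (omit_index w p k)" "k < p"
  obtains t where "\<And>i. 0 \<le> t i" "\<And>i. t i \<le> 1" "t k = 0" "y = (\<Sum>i<p. t i *\<^sub>R w i)"
proof -
  obtain t where t: "\<forall>i. 0 \<le> t i \<and> t i \<le> 1" "y = (\<Sum>i\<in>set ([0..<k] @ [Suc k..<p]). t i *\<^sub>R w i)"
    using zonotope_map[OF assms(1)[unfolded omit_index_def]] by auto
  have "set ([0..<k] @ [Suc k..<p]) = {..<p} - {k}" using assms(2) by auto
  then have "y = (\<Sum>i\<in>{..<p} - {k}. (t(k := 0)) i *\<^sub>R w i)" unfolding t(2) by (intro sum.cong) auto
  also have "\<dots> = (\<Sum>i<p. (t(k := 0)) i *\<^sub>R w i)"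
    by (rule sum.mono_neutral_left) auto
  finally show ?thesis using t by (intro that[of "t(k := 0)"]) auto
qed

lemma segment_average_derivative:
  fixes h :: "'b::real_normed_vector \<Rightarrow> real"
  assumes h: "continuous_on UNIV h"
  shows "((\<lambda>\<tau>. segment_average u h (x + \<tau> *\<^sub>R u)) has_real_derivative h (x + \<tau> *\<^sub>R u + u) - h (x + \<tau> *\<^sub>R u)) (at \<tau>)"
proof -
  have "\<exists>F. \<forall>s. -\<infinity> < ereal s \<longrightarrow> ereal s < \<infinity> \<longrightarrow> (F has_vector_derivative h (x + s *\<^sub>R u)) (at s)"
  proof (rule einterval_antiderivative)
    have "continuous_on UNIV (\<lambda>s. h (x + s *\<^sub>R u))"
      by (intro continuous_on_compose2[OF h] continuous_intros) auto
    then show "isCont (\<lambda>s. h (x + s *\<^sub>R u)) s" for s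
      by (simp add: continuous_on_eq_continuous_at)
  qed simp
  then obtain F where F: "\<And>s. (F has_real_derivative h (x + s *\<^sub>R u)) (at s)"
    by (auto simp: has_real_derivative_iff_has_vector_derivative)
  have "segment_average u h (x + \<tau> *\<^sub>R u) = F (\<tau> + 1) - F \<tau>" for \<tau>
  proof -
    have "((\<lambda>t. h (x + (\<tau> + t) *\<^sub>R u)) has_integral F (\<tau> + 1) - F (\<tau> + 0)) {0..1}"
    proof (rule fundamental_theorem_of_calculus)
      fix t :: real
      have "((\<lambda>t. F (\<tau> + t)) has_real_derivative h (x + (\<tau> + t) *\<^sub>R u) * 1) (at t)"
        by (rule DERIV_chain2[OF F]) (auto intro!: derivative_eq_intros)
      then show "((\<lambda>t. F (\<tau> + t)) has_vector_derivative h (x + (\<tau> + t) *\<^sub>R u)) (at t within {0..1})"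
        by (simp add: has_real_derivative_iff_has_vector_derivative has_vector_derivative_at_within)
    qed simp
    then show ?thesis
      by (simp add: segment_average_def integral_unique scaleR_add_left add.assoc)
  qed
  moreover have "((\<lambda>\<tau>. F (\<tau> + 1) - F \<tau>) has_real_derivative h (x + (\<tau> + 1) *\<^sub>R u) * 1 - h (x + \<tau> *\<^sub>R u)) (at \<tau>)"
    by (intro DERIV_diff F DERIV_chain2[OF F]) (auto intro!: derivative_eq_intros)
  ultimately have "((\<lambda>\<tau>. segment_average u h (x + \<tau> *\<^sub>R u)) has_real_derivative
      h (x + (\<tau> + 1) *\<^sub>R u) - h (x + \<tau> *\<^sub>R u)) (at \<tau>)" by simp
  then show ?thesis by (simp add: scaleR_add_left add.assoc)
qed

text \<open>The classical argument that continuous partial derivatives give linear directional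
  derivatives: one direction is added at a time, its increment being evaluated by the mean value
  theorem. The directions \<open>w k\<close> need not be independent; the application is to a linear
  relation between them.\<close>

lemma directional_derivative_sum:
  fixes F :: "'b::real_normed_vector \<Rightarrow> real" and p :: nat
  assumes D: "\<And>k x \<tau>. k < p \<Longrightarrow> ((\<lambda>\<tau>. F (x + \<tau> *\<^sub>R w k)) has_real_derivative D k (x + \<tau> *\<^sub>R w k)) (at \<tau>)"
    and cont: "\<And>k. k < p \<Longrightarrow> continuous_on UNIV (D k)"
  shows "((\<lambda>\<tau>. F (x + \<tau> *\<^sub>R (\<Sum>k<p. \<alpha> k *\<^sub>R w k))) has_real_derivative (\<Sum>k<p. \<alpha> k * D k x)) (at 0)"
  using assms
proof (induction p)
  case (Suc p)
  define v where "v = (\<Sum>k<p. \<alpha> k *\<^sub>R w k)"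
  define u where "u = w p"
  define a where "a = \<alpha> p"
  have IH: "((\<lambda>\<tau>. F (x + \<tau> *\<^sub>R v)) has_real_derivative (\<Sum>k<p. \<alpha> k * D k x)) (at 0)"
    unfolding v_def using Suc by auto
  have "\<exists>z. 0 < z \<and> z < 1 \<and> F (x + \<tau> *\<^sub>R v + (\<tau> * a) *\<^sub>R u) - F (x + \<tau> *\<^sub>R v) = \<tau> * a * D p (x + \<tau> *\<^sub>R v + (z * (\<tau> * a)) *\<^sub>R u)" for \<tau>
  proof -
    have "((\<lambda>s. F (x + \<tau> *\<^sub>R v + (s * (\<tau> * a)) *\<^sub>R u)) has_real_derivative D p (x + \<tau> *\<^sub>R v + (s * (\<tau> * a)) *\<^sub>R u) * (\<tau> * a)) (at s)" for s
      unfolding u_def by (rule DERIV_chain2[OF Suc.prems(1)]) (auto intro!: derivative_eq_intros)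
    then have "\<exists>z>0. z < 1 \<and> F (x + \<tau> *\<^sub>R v + (1 * (\<tau> * a)) *\<^sub>R u) - F (x + \<tau> *\<^sub>R v + (0 * (\<tau> * a)) *\<^sub>R u)
        = (1 - 0) * (D p (x + \<tau> *\<^sub>R v + (z * (\<tau> * a)) *\<^sub>R u) * (\<tau> * a))"
      by (intro MVT2) auto
    then show ?thesis by (auto simp: mult.commute mult.left_commute)
  qed
  then obtain z where z: "\<And>\<tau>. 0 < z \<tau>" "\<And>\<tau>. z \<tau> < 1"
    "\<And>\<tau>. F (x + \<tau> *\<^sub>R v + (\<tau> * a) *\<^sub>R u) - F (x + \<tau> *\<^sub>R v) = \<tau> * a * D p (x + \<tau> *\<^sub>R v + (z \<tau> * (\<tau> * a)) *\<^sub>R u)"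
    by metis
  have zlim: "((\<lambda>\<tau>. z \<tau> * (\<tau> * a)) \<longlongrightarrow> 0) (at 0)"
  proof (rule Lim_null_comparison)
    have "norm (z \<tau> * (\<tau> * a)) \<le> \<bar>\<tau> * a\<bar>" for \<tau>
      using z(1,2)[of \<tau>] by (simp add: abs_mult mult_left_le_one_le)
    then show "\<forall>\<^sub>F \<tau> in at 0. norm (z \<tau> * (\<tau> * a)) \<le> \<bar>\<tau> * a\<bar>" by simp
    show "((\<lambda>\<tau>. \<bar>\<tau> * a\<bar>) \<longlongrightarrow> 0) (at 0)" by (auto intro!: tendsto_eq_intros)
  qed
  have "((\<lambda>\<tau>. x + \<tau> *\<^sub>R v + (z \<tau> * (\<tau> * a)) *\<^sub>R u) \<longlongrightarrow> x + 0 *\<^sub>R v + 0 *\<^sub>R u) (at 0)"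
    by (intro tendsto_intros zlim)
  moreover have "isCont (D p) x"
    using Suc.prems(2)[of p] by (simp add: continuous_on_eq_continuous_at)
  ultimately have "((\<lambda>\<tau>. a * D p (x + \<tau> *\<^sub>R v + (z \<tau> * (\<tau> * a)) *\<^sub>R u)) \<longlongrightarrow> a * D p x) (at 0)"
    by (intro tendsto_mult_left isCont_tendsto_compose[of x "D p"]) auto
  moreover have "((\<lambda>\<tau>. (F (x + \<tau> *\<^sub>R v) - F x) / \<tau>) \<longlongrightarrow> (\<Sum>k<p. \<alpha> k * D k x)) (at 0)"
    using IH by (simp add: DERIV_def)
  ultimately have "((\<lambda>\<tau>. (F (x + \<tau> *\<^sub>R v) - F x) / \<tau> + a * D p (x + \<tau> *\<^sub>R v + (z \<tau> * (\<tau> * a)) *\<^sub>R u))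
      \<longlongrightarrow> (\<Sum>k<p. \<alpha> k * D k x) + a * D p x) (at 0)"
    by (intro tendsto_add)
  moreover have "\<forall>\<^sub>F \<tau> in at 0. (F (x + \<tau> *\<^sub>R v) - F x) / \<tau> + a * D p (x + \<tau> *\<^sub>R v + (z \<tau> * (\<tau> * a)) *\<^sub>R u)
      = (F (x + \<tau> *\<^sub>R (v + a *\<^sub>R u)) - F x) / \<tau>"
  proof (rule eventually_mono[OF eventually_neq_at_within[of 0]])
    fix \<tau> :: real assume "\<tau> \<noteq> 0"
    have "F (x + \<tau> *\<^sub>R (v + a *\<^sub>R u)) = F (x + \<tau> *\<^sub>R v + (\<tau> * a) *\<^sub>R u)"
      by (simp add: algebra_simps)
    then have "F (x + \<tau> *\<^sub>R (v + a *\<^sub>R u)) = F (x + \<tau> *\<^sub>R v) + \<tau> * a * D p (x + \<tau> *\<^sub>R v + (z \<tau> * (\<tau> * a)) *\<^sub>R u)"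
      using z(3)[of \<tau>] by linarith
    then show "(F (x + \<tau> *\<^sub>R v) - F x) / \<tau> + a * D p (x + \<tau> *\<^sub>R v + (z \<tau> * (\<tau> * a)) *\<^sub>R u)
      = (F (x + \<tau> *\<^sub>R (v + a *\<^sub>R u)) - F x) / \<tau>"
      using \<open>\<tau> \<noteq> 0\<close> by (simp add: field_simps)
  qed
  ultimately have "((\<lambda>\<tau>. (F (x + \<tau> *\<^sub>R (v + a *\<^sub>R u)) - F x) / \<tau>) \<longlongrightarrow> (\<Sum>k<p. \<alpha> k * D k x) + a * D p x) (at 0)"
    by (rule Lim_transform_eventually)
  then show ?case by (simp add: DERIV_def v_def u_def a_def)
qed simp

text \<open>The averages over boxes make a continuous function differentiable in the directions of the
  edges, and directional derivatives depend linearly on the direction.\<close>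

lemma averaged_difference_relation:
  fixes h :: "'b::real_normed_vector \<Rightarrow> real" and p :: nat
  assumes h: "continuous_on UNIV h" and rel: "(\<Sum>k<p. \<alpha> k *\<^sub>R w k) = 0"
  shows "(\<Sum>k<p. \<alpha> k * box_average (omit_index w p k) (\<lambda>y. h (y + w k) - h y) 0) = 0"
proof -
  define F where "F = box_average (map w [0..<p]) h"
  define D where "D = (\<lambda>k. box_average (omit_index w p k) (\<lambda>y. h (y + w k) - h y))"
  have "((\<lambda>\<tau>. F (0 + \<tau> *\<^sub>R (\<Sum>k<p. \<alpha> k *\<^sub>R w k))) has_real_derivative (\<Sum>k<p. \<alpha> k * D k 0)) (at 0)"
  proof (rule directional_derivative_sum)
    fix k assume k: "k < p"
    have "[0..<p] = [0..<k] @ k # [Suc k..<p]"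
      using k by (metis less_imp_le upt_add_eq_append upt_conv_Cons le_add_diff_inverse zero_le)
    then have F: "F = segment_average (w k) (box_average (omit_index w p k) h)"
      unfolding F_def omit_index_def using box_average_move[OF h, of "map w [0..<k]" "w k" "map w [Suc k..<p]"]
      by simp
    show "((\<lambda>\<tau>. F (x + \<tau> *\<^sub>R w k)) has_real_derivative D k (x + \<tau> *\<^sub>R w k)) (at \<tau>)" for x \<tau>
      unfolding F D_def box_average_shift_diff[OF h]
      by (rule segment_average_derivative[OF continuous_box_average[OF h]])
    show "continuous_on UNIV (D k)"
      unfolding D_def
      by (intro continuous_box_average continuous_intros continuous_on_compose2[OF h]) auto
  qed
  \<comment> \<open>In the direction 0 the averaged function is constant, so the combination of
    partial derivatives given by the relation must vanish.\<close>
  then have "((\<lambda>\<tau>::real. F 0) has_real_derivative (\<Sum>k<p. \<alpha> k * D k 0)) (at 0)"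
    by (simp add: rel)
  then have "(\<Sum>k<p. \<alpha> k * D k 0) = 0"
    using DERIV_unique DERIV_const by blast
  then show ?thesis by (simp add: D_def)
qed

text \<open>The operator \<open>T = (\<Sum>k<M. \<phi> k \<otimes> v k)\<close> has
  \<open>A i = T (e i)\<close>, and the sum on the left is its trace on \<open>E\<close>. The
  derivative of the averaged \<open>g\<close> in the direction \<open>A i\<close> is computed twice:
  along the short edges, parallel to the \<open>v k\<close>, it is bounded by the Lipschitz
  constant; along the long edges \<open>g\<close> is nearly the identity and the trace appears. The
  map \<open>g\<close> with values in \<open>E\<close> replaces \<open>f\<close> so that coordinates
  apply. The constant is \<open>(L + 6) + (4 * L + 12)\<close>, one bracket for each
  computation.\<close>

lemma trace_inequality:
  fixes E :: "'b::real_normed_vector set" and \<psi> :: "nat \<Rightarrow> ('b \<Rightarrow>\<^sub>L real)" and f g :: "'b \<Rightarrow> 'b"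
    and \<phi> :: "nat \<Rightarrow> ('b \<Rightarrow>\<^sub>L real)" and e v :: "nat \<Rightarrow> 'b" and L \<eta> :: real and d M :: nat
  defines "A \<equiv> \<lambda>i. \<Sum>k<M. \<phi> k (e i) *\<^sub>R v k"
  assumes E: "subspace E" and eE: "\<And>i. i < d \<Longrightarrow> e i \<in> E"
    and bi: "\<And>i j. i < d \<Longrightarrow> j < d \<Longrightarrow> \<psi> i (e j) = (if i = j then 1 else 0)"
    and exp: "\<And>x. x \<in> E \<Longrightarrow> x = (\<Sum>i<d. \<psi> i x *\<^sub>R e i)"
    and e: "\<And>i. i < d \<Longrightarrow> norm (e i) \<le> 1"
    and \<psi>: "\<And>i x. i < d \<Longrightarrow> x \<in> E \<Longrightarrow> \<bar>\<psi> i x\<bar> \<le> 2 * norm x"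
    and f: "\<And>x y. norm (f x - f y) \<le> L * norm (x - y)" "\<And>x. x \<in> E \<Longrightarrow> norm x \<le> 1 \<Longrightarrow> f x = x"
    and g: "continuous_on UNIV g" "\<And>x. g x \<in> E" "\<And>x. norm (g x - f x) \<le> 3 * \<eta>"
    and \<phi>: "\<And>k. k < M \<Longrightarrow> norm (\<phi> k) \<le> 1"
    and A: "\<And>i. i < d \<Longrightarrow> A i \<in> E"
    and d: "d > 0" and M: "M > 0" and \<eta>: "\<eta> \<ge> 0" "\<eta> * real d ^ 2 * M \<le> 1" and L: "L \<ge> 0"
  shows "(\<Sum>i<d. \<psi> i (A i)) \<le> (5 * L + 18) * (\<Sum>k<M. norm (v k))"
proof -
  \<comment> \<open>Two competing requirements fix this length. The hypothesis on \<eta> gives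
    \<open>\<eta> / s \<le> 1\<close>, so the error of \<open>g\<close> does not dominate a
    difference along a short edge; and \<open>M * s = 1 / d^2\<close>, so all short edges together
    move a point so little that the error survives multiplication by \<open>d^2\<close>.\<close>
  define s where "s = 1 / (real d ^ 2 * M)"
  \<comment> \<open>The \<open>d\<close> long edges have length at most \<open>1 / d\<close> each,
    hence every combination with coefficients in [0, 1] stays in the unit ball of \<open>E\<close>,
    where \<open>f\<close> is the identity.\<close>
  define w where "w = (\<lambda>k. if k < M then s *\<^sub>R sgn (v k) else (1 / d) *\<^sub>R e (k - M))"
  define p where "p = M + d"
  define S where "S = (\<Sum>k<M. norm (v k))"
  define \<delta> where "\<delta> = L * M * s + 3 * \<eta>"
  define Q where "Q = (\<lambda>k h. box_average (omit_index w p k) (\<lambda>y. h (y + w k) - h y) 0)"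
  have s: "s > 0" using d M by (simp add: s_def)
  have S0: "S \<ge> 0" by (simp add: S_def sum_nonneg)
  have split: "(\<Sum>k<p. F k) = (\<Sum>k<M. F k) + (\<Sum>j<d. F (M + j))" for F :: "nat \<Rightarrow> 'c::comm_monoid_add"
    unfolding p_def by (simp add: sum.nat_group[symmetric] lessThan_atLeast0 sum.atLeastLessThan_concat[symmetric, of 0 M "M + d"] sum.shift_bounds_nat_ivl[of _ 0 M d, simplified, symmetric] add.commute)
  have gc: "continuous_on UNIV (\<lambda>x. \<psi> i (g x))" for i
    by (intro continuous_intros g(1))
  have wn: "norm (w k) \<le> s" if "k < M" for k
    using that s by (simp add: w_def norm_sgn)
  have rel: "(\<Sum>k<M. \<phi> k (e i) * (norm (v k) / s) * Q k (\<lambda>x. \<psi> i (g x)))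
      = (\<Sum>j<d. real d * \<psi> j (A i) * Q (M + j) (\<lambda>x. \<psi> i (g x)))" if i: "i < d" for i
  proof -
    define \<alpha> where "\<alpha> = (\<lambda>k. if k < M then \<phi> k (e i) * (norm (v k) / s) else - (real d * \<psi> (k - M) (A i)))"
    have "\<alpha> k *\<^sub>R w k = \<phi> k (e i) *\<^sub>R v k" if "k < M" for k
      using that s by (cases "v k = 0") (auto simp: \<alpha>_def w_def sgn_div_norm)
    then have "(\<Sum>k<M. \<alpha> k *\<^sub>R w k) = (\<Sum>k<M. \<phi> k (e i) *\<^sub>R v k)" by simp
    moreover have "(\<Sum>j<d. \<alpha> (M + j) *\<^sub>R w (M + j)) = - (\<Sum>j<d. \<psi> j (A i) *\<^sub>R e j)"
      using d by (simp add: \<alpha>_def w_def sum_negf)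
    ultimately have "(\<Sum>k<p. \<alpha> k *\<^sub>R w k) = (\<Sum>k<M. \<phi> k (e i) *\<^sub>R v k) - (\<Sum>j<d. \<psi> j (A i) *\<^sub>R e j)"
      unfolding split by simp
    also have "\<dots> = 0" using exp[OF A[OF i]] by (simp add: A_def)
    finally have "(\<Sum>k<p. \<alpha> k * Q k (\<lambda>x. \<psi> i (g x))) = 0"
      unfolding Q_def by (rule averaged_difference_relation[OF gc])
    then show ?thesis unfolding split by (simp add: \<alpha>_def sum_negf)
  qed
  have Qsum: "(\<Sum>i<d. c i * Q k (\<lambda>x. \<psi> i (g x)))
      = box_average (omit_index w p k) (\<lambda>y. \<Sum>i<d. c i * (\<psi> i (g (y + w k)) - \<psi> i (g y))) 0" for c k
    unfolding Q_def
    by (subst box_average_sum) (auto intro!: continuous_intros continuous_on_compose2[OF g(1)])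
  have cont: "continuous_on UNIV (\<lambda>y. \<Sum>i<d. c i * (\<psi> i (g (y + w k)) - \<psi> i (g y)))" for c k
    by (auto intro!: continuous_intros continuous_on_compose2[OF g(1)])
  have upper: "(\<Sum>i<d. \<phi> k (e i) * Q k (\<lambda>x. \<psi> i (g x))) \<le> L * s + 6 * \<eta>" if k: "k < M" for k
    unfolding Qsum
  proof (rule box_average_le[OF cont])
    fix y
    define z where "z = g (0 + y + w k) - g (0 + y)"
    have z: "z \<in> E" using g(2) E by (auto simp: z_def intro: subspace_diff)
    have "(\<Sum>i<d. \<phi> k (e i) * (\<psi> i (g (0 + y + w k)) - \<psi> i (g (0 + y)))) = \<phi> k (\<Sum>i<d. \<psi> i z *\<^sub>R e i)"
      by (simp add: z_def blinfun.sum_right blinfun.scaleR_right blinfun.diff_right mult.commute)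
    also have "\<dots> = \<phi> k z" using exp[OF z] by simp
    also have "\<dots> \<le> norm z"
      using norm_blinfun[of "\<phi> k" z] \<phi>[OF k] mult_right_mono[of "norm (\<phi> k)" 1 "norm z"] by simp
    also have "z = (g (0 + y + w k) - f (0 + y + w k)) + (f (0 + y + w k) - f (0 + y)) - (g (0 + y) - f (0 + y))"
      by (simp add: z_def)
    also have "norm \<dots> \<le> norm (g (0 + y + w k) - f (0 + y + w k)) + norm (f (0 + y + w k) - f (0 + y)) + norm (g (0 + y) - f (0 + y))"
      by (meson add_right_mono norm_triangle_ineq norm_triangle_ineq4 order_trans)
    also have "\<dots> \<le> 3 * \<eta> + L * norm (w k) + 3 * \<eta>"
      using g(3) f(1)[of "0 + y + w k" "0 + y"] by (intro add_mono) auto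
    also have "\<dots> \<le> L * s + 6 * \<eta>" using wn[OF k] L by (simp add: mult_left_mono)
    finally show "(\<Sum>i<d. \<phi> k (e i) * (\<psi> i (g (0 + y + w k)) - \<psi> i (g (0 + y)))) \<le> L * s + 6 * \<eta>" .
  qed
  \<comment> \<open>A point of the box differs from its long-edge part by at most
    \<open>M * s\<close>, and \<open>f\<close> fixes that part; \<delta> adds to the Lipschitz error
    the distance between \<open>g\<close> and \<open>f\<close>.\<close>
  have near: "norm (g (\<Sum>i<p. t i *\<^sub>R w i) - (\<Sum>l<d. (t (M + l) / d) *\<^sub>R e l)) \<le> \<delta>"
    if t: "\<And>i. 0 \<le> t i" "\<And>i. t i \<le> 1" for t
  proof -
    define y where "y = (\<Sum>l<d. (t (M + l) / d) *\<^sub>R e l)"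
    define x where "x = (\<Sum>i<p. t i *\<^sub>R w i)"
    have x: "x = (\<Sum>k<M. t k *\<^sub>R w k) + y" unfolding x_def split by (simp add: y_def w_def)
    have "y \<in> E" unfolding y_def using E eE by (intro subspace_sum subspace_scale) auto
    moreover have "norm y \<le> 1"
    proof -
      have "norm y \<le> (\<Sum>l<d. norm ((t (M + l) / d) *\<^sub>R e l))" unfolding y_def by (rule norm_sum)
      also have "\<dots> \<le> (\<Sum>l<d. 1 / d)"
      proof (rule sum_mono)
        fix l assume "l \<in> {..<d}"
        then have "t (M + l) / d * norm (e l) \<le> 1 / d * 1"
          using t e by (intro mult_mono divide_right_mono) auto
        then show "norm ((t (M + l) / d) *\<^sub>R e l) \<le> 1 / d" using t by simp
      qed
      also have "\<dots> = 1" using d by simp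
      finally show ?thesis .
    qed
    ultimately have "f y = y" by (rule f(2))
    have "norm (\<Sum>k<M. t k *\<^sub>R w k) \<le> (\<Sum>k<M. norm (t k *\<^sub>R w k))" by (rule norm_sum)
    also have "\<dots> \<le> (\<Sum>k<M. s)"
      using t wn mult_mono[of "t _" 1 "norm (w _)" s] s by (intro sum_mono) auto
    finally have "norm (x - y) \<le> M * s" by (simp add: x)
    then have "norm (f x - y) \<le> L * (M * s)"
      using f(1)[of x y] \<open>f y = y\<close> L mult_left_mono[of "norm (x - y)" "M * s" L] by simp
    then have "norm (g x - y) \<le> \<delta>"
      using norm_triangle_ineq[of "g x - f x" "f x - y"] g(3)[of x] by (simp add: \<delta>_def)
    then show ?thesis by (simp add: x_def y_def)
  qed
  have lower: "\<psi> j (A j) / d - 4 * S * \<delta> \<le> (\<Sum>i<d. \<psi> j (A i) * Q (M + j) (\<lambda>x. \<psi> i (g x)))" if j: "j < d" for j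
    unfolding Qsum
  proof (rule box_average_ge[OF cont])
    fix y assume "y \<in> zonotope (omit_index w p (M + j))"
    then obtain t where t: "\<And>i. 0 \<le> t i" "\<And>i. t i \<le> 1" "t (M + j) = 0" "y = (\<Sum>i<p. t i *\<^sub>R w i)"
      by (rule zonotope_omit_index) (use j in \<open>auto simp: p_def\<close>)
    \<comment> \<open>The omitted edge has coefficient 0 in \<open>y\<close>; setting it to 1 gives
      the opposite point \<open>y + w (M + j)\<close> of the full box, so \<open>near\<close>
      applies at both ends.\<close>
    define t' where "t' = t(M + j := 1)"
    have t': "\<And>i. 0 \<le> t' i" "\<And>i. t' i \<le> 1" using t by (auto simp: t'_def)
    have upd: "(\<Sum>i<p. t' i *\<^sub>R w i) = y + w (M + j)"
    proof -
      have "(\<Sum>i<p. t' i *\<^sub>R w i) = (\<Sum>i<p. t i *\<^sub>R w i + (if i = M + j then w (M + j) else 0))"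
        using t(3) by (intro sum.cong) (auto simp: t'_def)
      also have "\<dots> = y + w (M + j)" using j by (simp add: sum.distrib t(4) p_def)
      finally show ?thesis .
    qed
    have upd': "(\<Sum>l<d. (t' (M + l) / d) *\<^sub>R e l) = (\<Sum>l<d. (t (M + l) / d) *\<^sub>R e l) + (1 / d) *\<^sub>R e j"
    proof -
      have "(\<Sum>l<d. (t' (M + l) / d) *\<^sub>R e l) = (\<Sum>l<d. (t (M + l) / d) *\<^sub>R e l + (if l = j then (1 / d) *\<^sub>R e j else 0))"
        using t(3) by (intro sum.cong) (auto simp: t'_def)
      also have "\<dots> = (\<Sum>l<d. (t (M + l) / d) *\<^sub>R e l) + (1 / d) *\<^sub>R e j" using j by (simp add: sum.distrib)
      finally show ?thesis .
    qed
    define z where "z = g (y + w (M + j)) - g y"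
    define r where "r = z - (1 / d) *\<^sub>R e j"
    have r: "r \<in> E" unfolding r_def z_def using E eE[OF j] g(2) by (intro subspace_diff subspace_scale) auto
    have "norm r \<le> \<delta> + \<delta>"
    proof -
      have n1: "norm (g (y + w (M + j)) - ((\<Sum>l<d. (t (M + l) / d) *\<^sub>R e l) + (1 / d) *\<^sub>R e j)) \<le> \<delta>"
        using near[of t'] t' unfolding upd upd' by blast
      have n2: "norm (g y - (\<Sum>l<d. (t (M + l) / d) *\<^sub>R e l)) \<le> \<delta>"
        using near[of t] t by simp
      have "r = (g (y + w (M + j)) - ((\<Sum>l<d. (t (M + l) / d) *\<^sub>R e l) + (1 / d) *\<^sub>R e j)) - (g y - (\<Sum>l<d. (t (M + l) / d) *\<^sub>R e l))"
        by (simp add: r_def z_def)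
      also have "norm \<dots> \<le> \<delta> + \<delta>"
        by (rule order_trans[OF norm_triangle_ineq4 add_mono[OF n1 n2]])
      finally show ?thesis .
    qed
    \<comment> \<open>Two descriptions of the operator on \<open>E\<close> are combined: through the
      \<open>A i\<close> its values lie in \<open>E\<close>, where \<open>\<psi> j\<close> is
      bounded by 2, and through the \<open>\<phi> k\<close> and \<open>v k\<close> it has norm at
      most \<open>S\<close>. With \<open>norm r \<le> 2 * \<delta>\<close> this produces the factor
      4.\<close>
    define T where "T = (\<lambda>x. \<Sum>i<d. \<psi> i x *\<^sub>R A i)"
    have T_add: "T (x + y) = T x + T y" for x y
      by (simp add: T_def blinfun.add_right scaleR_add_left sum.distrib)
    have TE: "T x \<in> E" for x
      unfolding T_def using E A by (intro subspace_sum subspace_scale) auto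
    have "T r = (\<Sum>k<M. \<phi> k r *\<^sub>R v k)"
    proof -
      have "T r = (\<Sum>k<M. (\<Sum>i<d. \<psi> i r * \<phi> k (e i)) *\<^sub>R v k)"
        unfolding T_def A_def scaleR_sum_right scaleR_sum_left by (subst sum.swap) simp
      also have "\<dots> = (\<Sum>k<M. \<phi> k (\<Sum>i<d. \<psi> i r *\<^sub>R e i) *\<^sub>R v k)"
        by (simp add: blinfun.sum_right blinfun.scaleR_right)
      finally show ?thesis using exp[OF r] by simp
    qed
    then have "norm (T r) \<le> (\<Sum>k<M. norm (\<phi> k r *\<^sub>R v k))" using norm_sum by metis
    also have "\<dots> \<le> (\<Sum>k<M. norm r * norm (v k))"
    proof (rule sum_mono)
      fix k assume "k \<in> {..<M}"
      then have "\<bar>\<phi> k r\<bar> \<le> norm r"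
        using norm_blinfun[of "\<phi> k" r] \<phi>[of k] mult_right_mono[of "norm (\<phi> k)" 1 "norm r"] by simp
      then show "norm (\<phi> k r *\<^sub>R v k) \<le> norm r * norm (v k)" by (simp add: mult_right_mono)
    qed
    also have "\<dots> = norm r * S" by (simp add: S_def sum_distrib_left)
    also have "\<dots> \<le> (\<delta> + \<delta>) * S" using \<open>norm r \<le> \<delta> + \<delta>\<close> S0 by (rule mult_right_mono)
    finally have Tr: "\<bar>\<psi> j (T r)\<bar> \<le> 4 * S * \<delta>"
      using \<psi>[OF j TE[of r]] by (simp add: algebra_simps)
    have "T ((1 / d) *\<^sub>R e j) = (\<Sum>i<d. if i = j then (1 / d) *\<^sub>R A j else 0)"
      unfolding T_def using bi j by (intro sum.cong) (auto simp: blinfun.scaleR_right)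
    then have Te: "T ((1 / d) *\<^sub>R e j) = (1 / d) *\<^sub>R A j" using j by simp
    have "(\<Sum>i<d. \<psi> j (A i) * (\<psi> i (g (y + w (M + j))) - \<psi> i (g y))) = \<psi> j (T z)"
      by (simp add: z_def T_def blinfun.sum_right blinfun.scaleR_right blinfun.diff_right mult.commute)
    also have "z = (1 / d) *\<^sub>R e j + r" by (simp add: r_def)
    also have "\<psi> j (T ((1 / real d) *\<^sub>R e j + r)) = \<psi> j (A j) / real d + \<psi> j (T r)"
      unfolding T_add Te by (simp add: blinfun.add_right blinfun.scaleR_right)
    finally show "\<psi> j (A j) / d - 4 * S * \<delta> \<le> (\<Sum>i<d. \<psi> j (A i) * (\<psi> i (g (0 + y + w (M + j))) - \<psi> i (g (0 + y))))"
      using Tr by simp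
  qed
  \<comment> \<open>The lower bounds concern a fixed \<open>j\<close> and sum over \<open>i\<close>,
    whereas the relation between short and long edges concerns a fixed \<open>i\<close> and sums
    over \<open>j\<close>; hence the interchanges of sums.\<close>
  have "(\<Sum>i<d. \<psi> i (A i)) - 4 * real d ^ 2 * S * \<delta> = (\<Sum>j<d. real d * (\<psi> j (A j) / d - 4 * S * \<delta>))"
    using d by (simp add: right_diff_distrib sum_subtractf power2_eq_square)
  also have "\<dots> \<le> (\<Sum>j<d. real d * (\<Sum>i<d. \<psi> j (A i) * Q (M + j) (\<lambda>x. \<psi> i (g x))))"
    using lower by (intro sum_mono mult_left_mono) auto
  also have "\<dots> = (\<Sum>i<d. \<Sum>j<d. real d * \<psi> j (A i) * Q (M + j) (\<lambda>x. \<psi> i (g x)))"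
    unfolding sum_distrib_left by (subst sum.swap) (simp add: mult.assoc)
  also have "\<dots> = (\<Sum>i<d. \<Sum>k<M. \<phi> k (e i) * (norm (v k) / s) * Q k (\<lambda>x. \<psi> i (g x)))"
    using rel by simp
  also have "\<dots> = (\<Sum>k<M. norm (v k) / s * (\<Sum>i<d. \<phi> k (e i) * Q k (\<lambda>x. \<psi> i (g x))))"
    unfolding sum_distrib_left by (subst sum.swap) (simp add: mult_ac)
  also have "\<dots> \<le> (\<Sum>k<M. norm (v k) / s * (L * s + 6 * \<eta>))"
    using upper s by (intro sum_mono mult_left_mono) auto
  also have "\<dots> = S * (L + 6 * (\<eta> / s))"
  proof -
    have "norm (v k) / s * (L * s + 6 * \<eta>) = norm (v k) * (L + 6 * (\<eta> / s))" for k
      using s by (simp add: field_simps)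
    then show ?thesis by (simp add: S_def sum_distrib_right)
  qed
  finally have main: "(\<Sum>i<d. \<psi> i (A i)) \<le> S * (L + 6 * (\<eta> / s)) + S * (4 * real d ^ 2 * \<delta>)"
    by (simp add: algebra_simps)
  have "\<eta> / s \<le> 1" using \<eta> by (simp add: s_def mult.assoc)
  moreover have "4 * real d ^ 2 * \<delta> \<le> 4 * L + 12"
  proof -
    have "real d ^ 2 * (L * M * s) = L" using d M by (simp add: s_def)
    moreover have "\<eta> * real d ^ 2 \<le> \<eta> * real d ^ 2 * M"
      using M \<eta>(1) mult_left_mono[of 1 "real M" "\<eta> * real d ^ 2"] by simp
    moreover have "4 * real d ^ 2 * \<delta> = 4 * (real d ^ 2 * (L * M * s)) + 12 * (\<eta> * real d ^ 2)"
      by (simp add: \<delta>_def algebra_simps)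
    ultimately show ?thesis using \<eta>(2) by linarith
  qed
  ultimately have "S * (L + 6 * (\<eta> / s)) + S * (4 * real d ^ 2 * \<delta>) \<le> S * (L + 6) + S * (4 * L + 12)"
    using S0 by (intro add_mono mult_left_mono) auto
  then show ?thesis using main by (simp add: S_def algebra_simps)
qed

section \<open>Weak-star continuous projections\<close>

text \<open>The space of \<open>M\<close>-tuples with the maximum norm. Its dimension is a variable,
  while a normed space has to be a type, so tuples are extended by 0 to bounded functions on the
  naturals.\<close>

definition finite_tuple :: "nat \<Rightarrow> (nat \<Rightarrow> 'z::real_normed_vector) \<Rightarrow> (nat \<Rightarrow>\<^sub>C 'z)" where
  "finite_tuple M w = Bcontfun (\<lambda>k. if k < M then w k else 0)"

lemma apply_finite_tuple:
  "apply_bcontfun (finite_tuple M w) k = (if k < M then w k else 0)"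
proof -
  have "(\<lambda>k. if k < M then w k else 0) \<in> bcontfun"
  proof (rule bcontfun_normI[where b = "\<Sum>i<M. norm (w i)"])
    show "norm (if k < M then w k else 0) \<le> (\<Sum>i<M. norm (w i))" for k
      using member_le_sum[of k "{..<M}" "\<lambda>i. norm (w i)"] by (auto simp: sum_nonneg)
  qed (simp add: continuous_on_discrete)
  then show ?thesis by (simp add: finite_tuple_def Bcontfun_inverse)
qed

lemma finite_tuple_linear:
  "finite_tuple M (\<lambda>k. v k + w k) = finite_tuple M v + finite_tuple M w"
  "finite_tuple M (\<lambda>k. c *\<^sub>R w k) = c *\<^sub>R finite_tuple M w"
  by (rule bcontfun_eqI, simp add: apply_finite_tuple)+

lemma norm_finite_tuple_le:
  assumes "\<And>k. k < M \<Longrightarrow> norm (w k) \<le> b" "0 \<le> b"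
  shows "norm (finite_tuple M w) \<le> b"
  using assms by (intro norm_bound) (auto simp: apply_finite_tuple)

lemma norm_finite_tuple_ge:
  assumes "k < M"
  shows "norm (w k) \<le> norm (finite_tuple M w)"
  using norm_bounded[of "finite_tuple M w" k] assms by (simp add: apply_finite_tuple)

lemma functional_near_norm:
  fixes \<phi> :: "'z::real_normed_vector \<Rightarrow>\<^sub>L real"
  assumes "\<delta> > 0"
  shows "\<exists>z. norm z \<le> 1 \<and> norm \<phi> - \<delta> \<le> \<phi> z"
proof (rule ccontr)
  assume "\<not> ?thesis"
  then have lt: "\<phi> z < norm \<phi> - \<delta>" if "norm z \<le> 1" for z using that by force
  have pos: "0 < norm \<phi> - \<delta>" using lt[of 0] by simp
  have "norm (\<phi> z) \<le> (norm \<phi> - \<delta>) * norm z" for z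
  proof (cases "z = 0")
    case False
    have "\<phi> ((1 / norm z) *\<^sub>R z) < norm \<phi> - \<delta>" "\<phi> (- ((1 / norm z) *\<^sub>R z)) < norm \<phi> - \<delta>"
      using False by (auto intro!: lt)
    then have "\<bar>\<phi> z\<bar> / norm z \<le> norm \<phi> - \<delta>"
      by (simp add: blinfun.scaleR_right blinfun.minus_right abs_real_def)
    then show ?thesis using False by (simp add: divide_le_eq)
  qed simp
  then have "norm \<phi> \<le> norm \<phi> - \<delta>" using pos by (intro norm_blinfun_bound) auto
  then show False using assms by simp
qed

lemma biorthogonal_independent:
  fixes e :: "nat \<Rightarrow> 'b::real_normed_vector" and \<psi> :: "nat \<Rightarrow> ('b \<Rightarrow>\<^sub>L real)"
  assumes bi: "\<And>i j. i < d \<Longrightarrow> j < d \<Longrightarrow> \<psi> i (e j) = (if i = j then 1 else 0)"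
  shows "independent (e ` {..<d})" "inj_on e {..<d}"
proof -
  show inj: "inj_on e {..<d}"
    using bi by (intro inj_onI) (metis lessThan_iff zero_neq_one)
  show "independent (e ` {..<d})"
  proof (rule independent_if_scalars_zero)
    fix u x assume sum0: "(\<Sum>x\<in>e ` {..<d}. u x *\<^sub>R x) = 0" and "x \<in> e ` {..<d}"
    then obtain i where i: "i < d" "x = e i" by auto
    have "0 = \<psi> i (\<Sum>j<d. u (e j) *\<^sub>R e j)"
      using sum0 by (simp add: sum.reindex[OF inj])
    also have "\<dots> = (\<Sum>j<d. u (e j) * \<psi> i (e j))"
      by (simp add: blinfun.sum_right blinfun.scaleR_right)
    also have "\<dots> = (\<Sum>j<d. if j = i then u (e i) else 0)"
      using bi i by (intro sum.cong) auto
    finally show "u x = 0" using i by simp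
  qed simp
qed

locale dual_space =
  fixes J :: "'a::real_normed_vector \<Rightarrow> ('z::real_normed_vector \<Rightarrow>\<^sub>L real)"
  assumes J_linear: "linear J" and J_norm: "norm (J x) = norm x" and J_surj: "surj J"
begin

lemma J_add: "J (x + y) = J x + J y" and J_scale: "J (c *\<^sub>R x) = c *\<^sub>R J x"
  and J_diff: "J (x - y) = J x - J y" and J_sum: "J (sum f I) = (\<Sum>i\<in>I. J (f i))" and J_zero: "J 0 = 0"
  using J_linear by (auto simp: linear_add linear_cmul linear_diff linear_sum linear_0)

lemma J_inj: "J x = J y \<Longrightarrow> x = y"
  using J_norm[of "x - y"] by (simp add: J_diff)

lemma predual_biorthogonal_system:
  fixes e :: "nat \<Rightarrow> 'a" and \<psi> :: "nat \<Rightarrow> ('a \<Rightarrow>\<^sub>L real)"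
  assumes "\<And>i j. i < d \<Longrightarrow> j < d \<Longrightarrow> \<psi> i (e j) = (if i = j then 1 else 0)"
  obtains y where "\<And>i j. i < d \<Longrightarrow> j < d \<Longrightarrow> J (e j) (y i) = (if i = j then 1 else 0)"
proof -
  note ind = biorthogonal_independent[of d \<psi> e, OF assms]
  have "\<exists>r. \<forall>b\<in>e ` {..<d}. r b \<in> (UNIV :: 'z set) \<and> (\<forall>c\<in>e ` {..<d}. J c (r b) = (if b = c then 1 else 0))"
  proof (rule biorthogonal_system[where pair = "\<lambda>w b. J b w"])
    show "linear (\<lambda>b. J b w)" for w by (rule linearI) (auto simp: J_add J_scale blinfun.add_left blinfun.scaleR_left)
    show "linear (blinfun_apply (J b))" for b by (simp add: blinfun.bounded_linear_right bounded_linear.linear)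
    show "\<exists>w\<in>UNIV. J b w \<noteq> 0" if "b \<noteq> 0" for b
      using that J_norm[of b] by (metis UNIV_I blinfun_eqI norm_eq_zero zero_blinfun.rep_eq)
  qed (use ind in auto)
  then obtain r where r: "\<And>b c. b \<in> e ` {..<d} \<Longrightarrow> c \<in> e ` {..<d} \<Longrightarrow> J c (r b) = (if b = c then 1 else 0)"
    by blast
  define y where "y = (\<lambda>i. r (e i))"
  have "J (e j) (y i) = (if i = j then 1 else 0)" if "i < d" "j < d" for i j
    using r[of "e i" "e j"] that ind(2) by (auto simp: y_def inj_on_def)
  then show ?thesis by (rule that)
qed

text \<open>Helly's theorem in \<open>Z\<^sup>d\<close>: a solution of small norm of the biorthogonality equations exists
  unless a functional on the space of \<open>M\<close>-tuples separates; by duality the latter contradicts the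
  trace inequality.\<close>

lemma small_biorthogonal_predual_vectors:
  fixes E :: "'a set" and \<psi> \<phi> :: "nat \<Rightarrow> ('a \<Rightarrow>\<^sub>L real)" and e :: "nat \<Rightarrow> 'a" and C :: real
  assumes E: "subspace E" and eE: "\<And>i. i < d \<Longrightarrow> e i \<in> E"
    and bi: "\<And>i j. i < d \<Longrightarrow> j < d \<Longrightarrow> \<psi> i (e j) = (if i = j then 1 else 0)"
    and C: "C \<ge> 0"
    and trace: "\<And>v. (\<And>i. i < d \<Longrightarrow> (\<Sum>k<M. \<phi> k (e i) *\<^sub>R v k) \<in> E) \<Longrightarrow>
      (\<Sum>i<d. \<psi> i (\<Sum>k<M. \<phi> k (e i) *\<^sub>R v k)) \<le> C * (\<Sum>k<M. norm (v k))"
  obtains z where "\<And>i j. i < d \<Longrightarrow> j < d \<Longrightarrow> J (e j) (z i) = (if i = j then 1 else 0)"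
    "\<And>k. k < M \<Longrightarrow> norm (\<Sum>i<d. \<phi> k (e i) *\<^sub>R z i) \<le> C + 1"
proof -
  obtain y where y: "\<And>i j. i < d \<Longrightarrow> j < d \<Longrightarrow> J (e j) (y i) = (if i = j then 1 else 0)"
    using predual_biorthogonal_system[of d \<psi> e] bi by blast
  \<comment> \<open>An affine set of tuples in the predual. Each member defines a projection onto
    the span of the \<open>e j\<close>, and the norm of its image under \<open>T\<close> controls
    the norm of that projection through the functionals \<open>\<phi> k\<close>.\<close>
  define P where "P = {z. \<forall>i<d. \<forall>j<d. J (e j) (z i) = (if i = j then 1 else 0 :: real)}"
  define T where "T = (\<lambda>z. finite_tuple M (\<lambda>k. \<Sum>i<d. \<phi> k (e i) *\<^sub>R (z i :: 'z)))"
  have T_add: "T (\<lambda>i. a i + b i) = T a + T b" for a b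
    unfolding T_def finite_tuple_linear(1)[symmetric] by (simp add: scaleR_add_right sum.distrib)
  have T_scale: "T (\<lambda>i. c *\<^sub>R a i) = c *\<^sub>R T a" for a c
    unfolding T_def finite_tuple_linear(2)[symmetric] by (simp add: scaleR_sum_right mult.commute)
  have "\<exists>z\<in>P. norm (T z) < C + 1"
  proof (rule ccontr)
    assume "\<not> ?thesis"
    then have big: "C + 1 \<le> norm (T z)" if "z \<in> P" for z using that by force
    have "convex (T ` P)"
    proof (rule convexI)
      fix p q and u v :: real assume "p \<in> T ` P" "q \<in> T ` P" and uv: "0 \<le> u" "0 \<le> v" "u + v = 1"
      then obtain a b where ab: "a \<in> P" "b \<in> P" "p = T a" "q = T b" by auto
      have m: "(\<lambda>i. u *\<^sub>R a i + v *\<^sub>R b i) \<in> P"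
        using ab uv by (auto simp: P_def blinfun.add_right blinfun.scaleR_right)
      have t: "T (\<lambda>i. u *\<^sub>R a i + v *\<^sub>R b i) = u *\<^sub>R p + v *\<^sub>R q"
        by (simp add: T_add T_scale ab)
      show "u *\<^sub>R p + v *\<^sub>R q \<in> T ` P" unfolding t[symmetric] by (rule imageI[OF m])
    qed
    moreover have yP: "y \<in> P" using y by (simp add: P_def)
    moreover have "C + 1 \<le> norm c" if "c \<in> T ` P" for c using that big by auto
    ultimately obtain \<Phi> :: "(nat \<Rightarrow>\<^sub>C 'z) \<Rightarrow>\<^sub>L real" where \<Phi>: "norm \<Phi> \<le> 1" "\<And>c. c \<in> T ` P \<Longrightarrow> C + 1 \<le> \<Phi> c"
      using convex_separation_from_ball[of "T ` P" "C + 1"] by blast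
    define v' where "v' = (\<lambda>k z. \<Phi> (finite_tuple M (\<lambda>l. if l = k then z else 0)))"
    have v'_le: "\<bar>v' k z\<bar> \<le> norm z" for k z
    proof -
      have "\<bar>v' k z\<bar> \<le> norm \<Phi> * norm (finite_tuple M (\<lambda>l. if l = k then z else 0))"
        unfolding v'_def using norm_blinfun[of \<Phi>] by simp
      also have "\<dots> \<le> 1 * norm z"
        using \<Phi>(1) by (intro mult_mono norm_finite_tuple_le) auto
      finally show ?thesis by simp
    qed
    have v'_bl: "bounded_linear (v' k)" for k
    proof (rule bounded_linear_intro[where K = 1])
      show "v' k (x + y) = v' k x + v' k y" for x y
      proof -
        have "(\<lambda>l. if l = k then x + y else 0) = (\<lambda>l. (if l = k then x else 0) + (if l = k then y else 0))"
          by auto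
        then show ?thesis by (simp add: v'_def finite_tuple_linear blinfun.add_right)
      qed
      show "v' k (c *\<^sub>R x) = c *\<^sub>R v' k x" for c x
      proof -
        have "(\<lambda>l. if l = k then c *\<^sub>R x else 0) = (\<lambda>l. c *\<^sub>R (if l = k then x else 0))"
          by auto
        then show ?thesis by (simp add: v'_def finite_tuple_linear blinfun.scaleR_right)
      qed
    qed (use v'_le in simp)
    \<comment> \<open>Each component of the separating functional is a functional on the predual,
      hence represented by an element of \<open>X\<close>; these elements are the vectors to which
      the trace inequality is applied.\<close>
    have "\<exists>x. J x = Blinfun (v' k)" for k using J_surj by (metis surjD)
    then obtain v where v: "\<And>k. J (v k) = Blinfun (v' k)" by metis
    have Jv: "J (v k) z = v' k z" for k z by (simp add: v bounded_linear_Blinfun_apply[OF v'_bl])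
    have \<Phi>_tuple: "\<Phi> (finite_tuple M w) = (\<Sum>k<M. J (v k) (w k))" for w
    proof -
      have "finite_tuple M w = (\<Sum>k<M. finite_tuple M (\<lambda>l. if l = k then w k else 0))"
      proof (rule bcontfun_eqI)
        fix l
        have "apply_bcontfun (\<Sum>k<n. finite_tuple M (\<lambda>l. if l = k then w k else 0)) l
            = (\<Sum>k<n. apply_bcontfun (finite_tuple M (\<lambda>l. if l = k then w k else 0)) l)" for n
          by (induction n) auto
        then show "apply_bcontfun (finite_tuple M w) l = apply_bcontfun (\<Sum>k<M. finite_tuple M (\<lambda>l. if l = k then w k else 0)) l"
          by (auto simp: apply_finite_tuple)
      qed
      then show ?thesis by (simp add: blinfun.sum_right Jv v'_def)
    qed
    \<comment> \<open>The dual of the maximum norm is the sum of the norms: the functional is tested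
      on a tuple whose entries norm its components up to \<delta>.\<close>
    have sum_v: "(\<Sum>k<M. norm (v k)) \<le> 1"
    proof (rule field_le_epsilon)
      fix \<epsilon> :: real assume \<epsilon>: "\<epsilon> > 0"
      define \<delta> where "\<delta> = \<epsilon> / (M + 1)"
      have \<delta>: "\<delta> > 0" "M * \<delta> \<le> \<epsilon>" using \<epsilon> by (auto simp: \<delta>_def field_simps)
      obtain z where z: "\<And>k. norm (z k) \<le> 1" "\<And>k. norm (J (v k)) - \<delta> \<le> J (v k) (z k)"
        using choice[of "\<lambda>k z. norm z \<le> 1 \<and> norm (J (v k)) - \<delta> \<le> J (v k) z"]
          functional_near_norm[OF \<delta>(1)] by blast
      have "(\<Sum>k<M. norm (v k)) - M * \<delta> = (\<Sum>k<M. norm (J (v k)) - \<delta>)"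
        by (simp add: sum_subtractf J_norm)
      also have "\<dots> \<le> (\<Sum>k<M. J (v k) (z k))" using z(2) by (intro sum_mono)
      also have "\<dots> = \<Phi> (finite_tuple M z)" by (simp add: \<Phi>_tuple)
      also have "\<dots> \<le> norm \<Phi> * norm (finite_tuple M z)" using norm_blinfun[of \<Phi> "finite_tuple M z"] by simp
      also have "\<dots> \<le> 1 * 1" using \<Phi>(1) z(1) by (intro mult_mono norm_finite_tuple_le) auto
      finally show "(\<Sum>k<M. norm (v k)) \<le> 1 + \<epsilon>" using \<delta>(2) by simp
    qed
    define A where "A = (\<lambda>i. \<Sum>k<M. \<phi> k (e i) *\<^sub>R v k)"
    have \<Phi>T: "\<Phi> (T z) = (\<Sum>i<d. J (A i) (z i))" for z
    proof -
      have "\<Phi> (T z) = (\<Sum>k<M. \<Sum>i<d. \<phi> k (e i) * J (v k) (z i))"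
        by (simp add: T_def \<Phi>_tuple blinfun.sum_right blinfun.scaleR_right)
      also have "\<dots> = (\<Sum>i<d. J (A i) (z i))"
        by (subst sum.swap) (simp add: A_def J_sum J_scale blinfun.sum_left blinfun.scaleR_left)
      finally show ?thesis .
    qed
    \<comment> \<open>The separating functional is bounded below along every line in the affine set,
      so it is constant there. Hence \<open>A i\<close> vanishes on the common kernel of the
      \<open>e j\<close> and is a combination of them, which is the range condition demanded by
      \<open>trace\<close>. The trace bound by \<open>C\<close> then contradicts the separation at
      \<open>C + 1\<close>.\<close>
    have JA0: "J (A i) m = 0" if i: "i < d" and m: "\<And>j. j < d \<Longrightarrow> J (e j) m = 0" for i m
    proof -
      define n where "n = (\<lambda>l. if l = i then m else 0)"
      have \<Phi>n: "\<Phi> (T n) = J (A i) m"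
      proof -
        have "(\<Sum>l<d. J (A l) (n l)) = (\<Sum>l<d. if l = i then J (A i) m else 0)"
          by (intro sum.cong) (auto simp: n_def)
        then show ?thesis using i by (simp add: \<Phi>T)
      qed
      have "C + 1 \<le> \<Phi> (T y) + t * J (A i) m" for t
      proof -
        have "(\<lambda>l. y l + t *\<^sub>R n l) \<in> P"
          using yP m by (auto simp: P_def n_def blinfun.add_right blinfun.scaleR_right)
        then have "C + 1 \<le> \<Phi> (T (\<lambda>l. y l + t *\<^sub>R n l))" using \<Phi>(2) by blast
        then show ?thesis by (simp add: T_add T_scale blinfun.add_right blinfun.scaleR_right \<Phi>n)
      qed
      note line = this
      show ?thesis
      proof (rule ccontr)
        assume nz: "J (A i) m \<noteq> 0"
        show False using line[of "(C - \<Phi> (T y)) / J (A i) m"] nz by simp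
      qed
    qed
    have A_exp: "A i = (\<Sum>j<d. J (A i) (y j) *\<^sub>R e j)" if i: "i < d" for i
    proof (rule J_inj, rule blinfun_eqI)
      fix z
      have "J (A i) (z - (\<Sum>j<d. J (e j) z *\<^sub>R y j)) = 0"
      proof (rule JA0[OF i])
        fix l assume l: "l < d"
        have "(\<Sum>j<d. J (e j) z * J (e l) (y j)) = (\<Sum>j<d. if j = l then J (e j) z else 0)"
          using y l by (intro sum.cong) auto
        then show "J (e l) (z - (\<Sum>j<d. J (e j) z *\<^sub>R y j)) = 0"
          using l by (simp add: blinfun.diff_right blinfun.sum_right blinfun.scaleR_right)
      qed
      then show "J (A i) z = J (\<Sum>j<d. J (A i) (y j) *\<^sub>R e j) z"
        by (simp add: blinfun.diff_right blinfun.sum_right blinfun.scaleR_right J_sum J_scale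
            blinfun.sum_left blinfun.scaleR_left mult.commute)
    qed
    have AE: "A i \<in> E" if "i < d" for i
    proof -
      have "(\<Sum>j<d. J (A i) (y j) *\<^sub>R e j) \<in> E"
        using E eE by (intro subspace_sum subspace_scale) auto
      then show ?thesis using A_exp[OF that] by simp
    qed
    have "\<psi> i (A i) = J (A i) (y i)" if i: "i < d" for i
    proof -
      have "\<psi> i (A i) = \<psi> i (\<Sum>j<d. J (A i) (y j) *\<^sub>R e j)" using A_exp[OF i] by simp
      also have "\<dots> = (\<Sum>j<d. J (A i) (y j) * \<psi> i (e j))"
        by (simp add: blinfun.sum_right blinfun.scaleR_right)
      also have "\<dots> = (\<Sum>j<d. if j = i then J (A i) (y j) else 0)"
        using bi i by (intro sum.cong) auto
      finally show ?thesis using i by simp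
    qed
    then have "\<Phi> (T y) = (\<Sum>i<d. \<psi> i (A i))" by (simp add: \<Phi>T)
    also have "\<dots> \<le> C * (\<Sum>k<M. norm (v k))" unfolding A_def by (rule trace) (use AE in \<open>simp add: A_def\<close>)
    also have "\<dots> \<le> C" using sum_v C by (simp add: mult_left_le)
    finally show False using \<Phi>(2)[of "T y"] yP by force
  qed
  then obtain z where z: "z \<in> P" "norm (T z) < C + 1" by blast
  show ?thesis
  proof (rule that[of z])
    show "J (e j) (z i) = (if i = j then 1 else 0)" if "i < d" "j < d" for i j
      using z(1) that by (simp add: P_def)
    show "norm (\<Sum>i<d. \<phi> k (e i) *\<^sub>R z i) \<le> C + 1" if "k < M" for k
      using norm_finite_tuple_ge[OF that, of "\<lambda>k. \<Sum>i<d. \<phi> k (e i) *\<^sub>R z i"] z(2) by (simp add: T_def)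
  qed
qed

lemma norm_predual_le:
  fixes z :: 'z
  assumes "\<And>x. norm x \<le> 1 \<Longrightarrow> \<bar>J x z\<bar> \<le> c"
  shows "norm z \<le> c"
proof -
  obtain \<phi> :: "'z \<Rightarrow>\<^sub>L real" where \<phi>: "norm \<phi> \<le> 1" "\<phi> z = norm z" by (rule norming_functional)
  obtain x where "\<phi> = J x" using J_surj by (metis surjD)
  then show ?thesis using assms[of x] \<phi> J_norm[of x] by simp
qed

text \<open>With the vectors \<open>z i\<close> found in the predual, the projection
  \<open>P\<close> is the adjoint of \<open>S\<close>. Its norm needs checking only against the
  \<open>\<phi> k\<close>, since these norm \<open>E\<close> up to \<open>1 - \<epsilon>\<close>,
  and \<open>\<phi> k (P x)\<close> is the value of \<open>J x\<close> at the vector whose norm was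
  bounded by \<open>C + 1\<close>.\<close>

lemma weak_star_projection:
  fixes E :: "'a set" and \<psi> \<phi> :: "nat \<Rightarrow> ('a \<Rightarrow>\<^sub>L real)" and e :: "nat \<Rightarrow> 'a" and C :: real
  assumes E: "subspace E" and eE: "\<And>i. i < d \<Longrightarrow> e i \<in> E"
    and bi: "\<And>i j. i < d \<Longrightarrow> j < d \<Longrightarrow> \<psi> i (e j) = (if i = j then 1 else 0)"
    and exp: "\<And>x. x \<in> E \<Longrightarrow> x = (\<Sum>i<d. \<psi> i x *\<^sub>R e i)"
    and C: "C \<ge> 0"
    and trace: "\<And>v. (\<And>i. i < d \<Longrightarrow> (\<Sum>k<M. \<phi> k (e i) *\<^sub>R v k) \<in> E) \<Longrightarrow>
      (\<Sum>i<d. \<psi> i (\<Sum>k<M. \<phi> k (e i) *\<^sub>R v k)) \<le> C * (\<Sum>k<M. norm (v k))"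
    and \<epsilon>: "\<epsilon> < 1" and norming: "\<And>x. x \<in> E \<Longrightarrow> \<exists>k<M. (1 - \<epsilon>) * norm x \<le> \<phi> k x"
  obtains S :: "'z \<Rightarrow>\<^sub>L 'z" where "norm S \<le> (C + 1) / (1 - \<epsilon>)"
    "\<And>x. \<exists>a\<in>E. J x o\<^sub>L S = J a" "\<And>x. x \<in> E \<Longrightarrow> J x o\<^sub>L S = J x"
proof -
  obtain z where z: "\<And>i j. i < d \<Longrightarrow> j < d \<Longrightarrow> J (e j) (z i) = (if i = j then 1 else 0)"
    "\<And>k. k < M \<Longrightarrow> norm (\<Sum>i<d. \<phi> k (e i) *\<^sub>R z i) \<le> C + 1"
    by (rule small_biorthogonal_predual_vectors[OF E eE bi C trace]) (blast+)
  define S where "S = Blinfun (\<lambda>x. \<Sum>i<d. J (e i) x *\<^sub>R z i)"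
  have "bounded_linear (\<lambda>x. \<Sum>i<d. J (e i) x *\<^sub>R z i)"
    by (intro bounded_linear_sum bounded_linear_scaleR_const blinfun.bounded_linear_right)
  then have S: "S x = (\<Sum>i<d. J (e i) x *\<^sub>R z i)" for x
    by (simp add: S_def bounded_linear_Blinfun_apply)
  define P where "P = (\<lambda>x. \<Sum>i<d. J x (z i) *\<^sub>R e i)"
  have PE: "P x \<in> E" for x unfolding P_def using E eE by (intro subspace_sum subspace_scale) auto
  have JS: "J x o\<^sub>L S = J (P x)" for x
    by (rule blinfun_eqI) (simp add: S P_def J_sum J_scale blinfun.sum_left blinfun.sum_right
        blinfun.scaleR_left blinfun.scaleR_right mult.commute)
  have Pe: "P (e j) = e j" if "j < d" for j
  proof -
    have "P (e j) = (\<Sum>i<d. if i = j then e j else 0)"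
      unfolding P_def using z(1) that by (intro sum.cong) auto
    then show ?thesis using that by simp
  qed
  have P_id: "P x = x" if "x \<in> E" for x
  proof -
    have "P (\<Sum>i<d. \<psi> i x *\<^sub>R e i) = (\<Sum>i<d. \<psi> i x *\<^sub>R P (e i))"
      unfolding P_def J_sum J_scale blinfun.sum_left blinfun.scaleR_left scaleR_sum_left scaleR_sum_right
      by (subst sum.swap) simp
    also have "\<dots> = (\<Sum>i<d. \<psi> i x *\<^sub>R e i)" using Pe by simp
    finally show ?thesis using exp[OF that] by simp
  qed
  have Pn: "norm (P x) \<le> (C + 1) / (1 - \<epsilon>) * norm x" for x
  proof -
    obtain k where k: "k < M" "(1 - \<epsilon>) * norm (P x) \<le> \<phi> k (P x)" using norming[OF PE] by blast
    have "\<phi> k (P x) = J x (\<Sum>i<d. \<phi> k (e i) *\<^sub>R z i)"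
      by (simp add: P_def blinfun.sum_right blinfun.scaleR_right mult.commute)
    also have "\<dots> \<le> norm (J x) * norm (\<Sum>i<d. \<phi> k (e i) *\<^sub>R z i)"
      using norm_blinfun[of "J x"] by (metis abs_le_D1 real_norm_def)
    also have "\<dots> \<le> norm x * (C + 1)" using z(2)[OF k(1)] by (simp add: J_norm mult_left_mono)
    finally show ?thesis using k(2) \<epsilon> by (simp add: field_simps)
  qed
  show ?thesis
  proof (rule that[of S])
    show "norm S \<le> (C + 1) / (1 - \<epsilon>)"
    proof (rule norm_blinfun_bound)
      show "0 \<le> (C + 1) / (1 - \<epsilon>)" using C \<epsilon> by simp
      show "norm (S x) \<le> (C + 1) / (1 - \<epsilon>) * norm x" for x
      proof (rule norm_predual_le)
        fix a :: 'a assume a: "norm a \<le> 1"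
        have "\<bar>J a (S x)\<bar> = \<bar>J (P a) x\<bar>" using JS[of a] by (metis blinfun_apply_blinfun_compose)
        also have "\<dots> \<le> norm (P a) * norm x" using norm_blinfun[of "J (P a)" x] by (simp add: J_norm)
        also have "\<dots> \<le> (C + 1) / (1 - \<epsilon>) * 1 * norm x"
          using Pn[of a] a C \<epsilon> by (intro mult_right_mono order_trans[OF Pn] mult_left_mono) auto
        finally show "\<bar>J a (S x)\<bar> \<le> (C + 1) / (1 - \<epsilon>) * norm x" by simp
      qed
    qed
    show "\<exists>a\<in>E. J x o\<^sub>L S = J a" for x using JS PE by blast
    show "J x o\<^sub>L S = J x" if "x \<in> E" for x using JS P_id[OF that] by simp
  qed
qed

end

text \<open>A partition of unity subordinate to a finite net of a ball in the span:
  \<open>g x\<close> is a convex combination of net points at distance less than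
  \<open>3 * \<eta>\<close> from \<open>f x\<close>. This moves the values into the span without
  using any projection onto it.\<close>

lemma continuous_selection_near_span:
  fixes f :: "'t::topological_space \<Rightarrow> 'b::real_normed_vector"
  assumes B: "finite B" and f: "continuous_on UNIV f" and \<eta>: "\<eta> > 0"
    and near: "\<And>x. \<exists>a\<in>span B. norm (f x - a) \<le> \<eta>" and bound: "\<And>x. norm (f x) \<le> R"
  obtains g where "continuous_on UNIV g" "\<And>x. g x \<in> span B" "\<And>x. norm (g x - f x) \<le> 3 * \<eta>"
proof -
  obtain W where W: "finite W" "W \<subseteq> span B"
    "\<And>x. x \<in> span B \<Longrightarrow> norm x \<le> R + \<eta> \<Longrightarrow> \<exists>w\<in>W. dist x w < \<eta>"
    by (rule finite_dim_ball_net[OF B \<eta>]) blast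
  \<comment> \<open>Some net point is at distance less than \<open>\<eta> + \<eta>\<close> from
    \<open>f x\<close>; the larger cut-off \<open>3 * \<eta>\<close> makes the denominator positive
    everywhere.\<close>
  define l where "l = (\<lambda>w x. max 0 (3 * \<eta> - norm (f x - w)))"
  define s where "s = (\<lambda>x. \<Sum>w\<in>W. l w x)"
  define g where "g = (\<lambda>x. (1 / s x) *\<^sub>R (\<Sum>w\<in>W. l w x *\<^sub>R w))"
  have l0: "l w x \<ge> 0" for w x by (simp add: l_def)
  have s: "s x > 0" for x
  proof -
    obtain a where a: "a \<in> span B" "norm (f x - a) \<le> \<eta>" using near by blast
    have "norm a \<le> R + \<eta>" using norm_triangle_sub[of a "f x"] a(2) bound[of x] by (simp add: norm_minus_commute)
    then obtain w where w: "w \<in> W" "dist a w < \<eta>" using W(3) a(1) by blast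
    have "norm (f x - w) \<le> norm (f x - a) + norm (a - w)" using norm_triangle_ineq[of "f x - a" "a - w"] by simp
    then have "l w x > 0" using a(2) w(2) \<eta> by (simp add: l_def dist_norm)
    then show ?thesis unfolding s_def using W(1) w(1) l0 by (intro sum_pos2) auto
  qed
  have lc: "continuous_on UNIV (l w)" for w
    unfolding l_def by (intro continuous_intros f)
  show ?thesis
  proof (rule that[of g])
    have "s x \<noteq> 0" for x using s[of x] by simp
    then show "continuous_on UNIV g"
      unfolding g_def using lc by (intro continuous_intros) (auto simp: s_def intro!: continuous_intros)
    show "g x \<in> span B" for x
      unfolding g_def using W(2) by (intro span_scale span_sum) auto
    fix x
    have "g x - f x = (1 / s x) *\<^sub>R (\<Sum>w\<in>W. l w x *\<^sub>R (w - f x))"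
    proof -
      have "(\<Sum>w\<in>W. l w x *\<^sub>R (w - f x)) = (\<Sum>w\<in>W. l w x *\<^sub>R w) - s x *\<^sub>R f x"
        by (simp add: s_def scaleR_diff_right sum_subtractf scaleR_sum_left)
      then show ?thesis using s[of x] by (simp add: g_def scaleR_diff_right)
    qed
    also have "norm \<dots> \<le> (1 / s x) * (\<Sum>w\<in>W. l w x * (3 * \<eta>))"
    proof -
      have "norm (l w x *\<^sub>R (w - f x)) \<le> l w x * (3 * \<eta>)" for w
      proof (cases "l w x = 0")
        case False
        then have "norm (w - f x) \<le> 3 * \<eta>" by (auto simp: l_def norm_minus_commute max_def split: if_splits)
        then show ?thesis using l0[of w x] by (simp add: mult_left_mono)
      qed simp
      then have "norm (\<Sum>w\<in>W. l w x *\<^sub>R (w - f x)) \<le> (\<Sum>w\<in>W. l w x * (3 * \<eta>))"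
        by (intro sum_norm_le)
      then show ?thesis using s[of x] by (simp add: divide_right_mono)
    qed
    also have "\<dots> = 3 * \<eta>" using s[of x] by (simp add: s_def sum_distrib_right[symmetric])
    finally show "norm (g x - f x) \<le> 3 * \<eta>" .
  qed
qed

text \<open>The condition on \<eta> is the one of the trace inequality, with the number of
  functionals estimated by the packing bound for the sphere. In the constant, 18 belongs to the
  trace inequality, one more unit to the strict separation in Helly's theorem, and
  \<open>1 - \<epsilon>\<close> to norming by a net.\<close>

lemma (in dual_space) local_retraction_projection:
  fixes f :: "'a \<Rightarrow> 'a" and \<epsilon> \<eta> L R :: real
  assumes B: "finite B" "card B \<le> m"
    and f: "\<And>x y. norm (f x - f y) \<le> L * norm (x - y)" "\<And>x. x \<in> span B \<Longrightarrow> norm x \<le> 1 \<Longrightarrow> f x = x"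
    and near: "\<And>x. \<exists>a\<in>span B. norm (f x - a) \<le> \<eta>" and bound: "\<And>x. norm (f x) \<le> R"
    and \<epsilon>: "0 < \<epsilon>" "\<epsilon> < 1" and L: "L \<ge> 0"
    and \<eta>: "\<eta> > 0" "\<eta> * (real m ^ 2 * (1 + 2 / \<epsilon>) ^ m) \<le> 1"
  obtains S :: "'z \<Rightarrow>\<^sub>L 'z" where "norm S \<le> (5 * L + 19) / (1 - \<epsilon>)"
    "\<And>x. \<exists>a\<in>span B. J x o\<^sub>L S = J a" "\<And>x. x \<in> span B \<Longrightarrow> J x o\<^sub>L S = J x"
proof -
  obtain d :: nat and e :: "nat \<Rightarrow> 'a" and \<psi> :: "nat \<Rightarrow> ('a \<Rightarrow>\<^sub>L real)"
    where dB: "d \<le> card B" and sp: "span (e ` {..<d}) = span B"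
    and bi: "\<And>i j. i < d \<Longrightarrow> j < d \<Longrightarrow> \<psi> i (e j) = (if i = j then 1 else 0)"
    and exp: "\<And>x. x \<in> span B \<Longrightarrow> x = (\<Sum>i<d. \<psi> i x *\<^sub>R e i)"
    and e: "\<And>i. i < d \<Longrightarrow> norm (e i) \<le> 1"
    and \<psi>: "\<And>i x. i < d \<Longrightarrow> x \<in> span B \<Longrightarrow> \<bar>\<psi> i x\<bar> \<le> 2 * norm x"
    by (rule almost_auerbach_system[OF B(1)]) blast
  have eE: "e i \<in> span B" if "i < d" for i using that sp by (metis imageI lessThan_iff span_base)
  show ?thesis
  proof (cases "d = 0")
    case True
    then have zero: "x = 0" if "x \<in> span B" for x using exp[OF that] by simp
    show ?thesis
    proof (rule that[of 0])
      show "norm (0 :: 'z \<Rightarrow>\<^sub>L 'z) \<le> (5 * L + 19) / (1 - \<epsilon>)" using L \<epsilon> by simp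
      show "\<exists>a\<in>span B. J x o\<^sub>L 0 = J a" for x
        by (intro bexI[of _ 0]) (auto simp: J_zero span_zero)
      show "J x o\<^sub>L 0 = J x" if "x \<in> span B" for x using zero[OF that] by (simp add: J_zero)
    qed
  next
    case False
    then have d: "d > 0" by simp
    obtain g where g: "continuous_on UNIV g" "\<And>x. g x \<in> span B" "\<And>x. norm (g x - f x) \<le> 3 * \<eta>"
    proof (rule continuous_selection_near_span[OF B(1) _ \<eta>(1) near bound])
      have "L-lipschitz_on UNIV f" using f(1) L by (auto simp: lipschitz_on_def dist_norm)
      then show "continuous_on UNIV f" by (rule lipschitz_on_continuous_on)
    qed blast
    obtain Z where Z: "finite Z" "Z \<subseteq> {x \<in> span B. norm x = 1}" "real (card Z) \<le> (1 + 2 / \<epsilon>) ^ d"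
      "\<And>x. x \<in> {x \<in> span B. norm x = 1} \<Longrightarrow> \<exists>z\<in>Z. dist x z < \<epsilon>"
    proof (rule maximal_separated_net[OF _ \<epsilon>(1), where N = "(1 + 2 / \<epsilon>) ^ d" and S = "{x \<in> span B. norm x = 1}"])
      fix W assume "finite W" "W \<subseteq> {x \<in> span B. norm x = 1}" "\<forall>x\<in>W. \<forall>y\<in>W. x \<noteq> y \<longrightarrow> \<epsilon> \<le> dist x y"
      then show "real (card W) \<le> (1 + 2 / \<epsilon>) ^ d"
        by (intro sphere_separated_card[OF subspace_span exp e \<psi> \<epsilon>(1)]) auto
    qed blast
    define M where "M = card Z"
    obtain z where z: "bij_betw z {..<M} Z"
      using ex_bij_betw_nat_finite[OF Z(1)] by (auto simp: atLeast0LessThan M_def)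
    have "\<forall>k. \<exists>\<phi> :: 'a \<Rightarrow>\<^sub>L real. norm \<phi> \<le> 1 \<and> blinfun_apply \<phi> (z k) = norm (z k)"
      using norming_functional by blast
    then obtain \<phi> :: "nat \<Rightarrow> ('a \<Rightarrow>\<^sub>L real)" where \<phi>: "\<And>k. norm (\<phi> k) \<le> 1" "\<And>k. blinfun_apply (\<phi> k) (z k) = norm (z k)" by metis
    have unit: "\<exists>k<M. 1 - \<epsilon> \<le> \<phi> k x" if "x \<in> span B" "norm x = 1" for x
    proof -
      obtain w where w: "w \<in> Z" "dist x w < \<epsilon>" using Z(4) \<open>x \<in> span B\<close> \<open>norm x = 1\<close> by blast
      then obtain k where k: "k < M" "w = z k" using z by (auto simp: bij_betw_def)
      have "\<bar>\<phi> k (w - x)\<bar> \<le> norm (\<phi> k) * norm (w - x)" using norm_blinfun[of "\<phi> k" "w - x"] by simp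
      also have "\<dots> \<le> 1 * norm (w - x)" using \<phi>(1) by (intro mult_right_mono) auto
      finally have "\<phi> k w - \<phi> k x < \<epsilon>" using w(2) by (simp add: blinfun.diff_right dist_norm norm_minus_commute)
      moreover have "\<phi> k w = 1" using \<phi>(2)[of k] k w Z(2) by auto
      ultimately show ?thesis using k by (intro exI[of _ k]) auto
    qed
    have "e 0 \<noteq> 0" using bi[of 0 0] d by auto
    then have "\<exists>k<M. 1 - \<epsilon> \<le> \<phi> k ((1 / norm (e 0)) *\<^sub>R e 0)"
      using eE[OF d] by (intro unit) (auto intro: span_scale)
    then have M: "M > 0" by auto
    have norming: "\<exists>k<M. (1 - \<epsilon>) * norm x \<le> \<phi> k x" if x: "x \<in> span B" for x
    proof (cases "x = 0")
      case True
      then show ?thesis using M by auto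
    next
      case False
      then obtain k where "k < M" "1 - \<epsilon> \<le> \<phi> k ((1 / norm x) *\<^sub>R x)"
        using unit[of "(1 / norm x) *\<^sub>R x"] x by (auto intro: span_scale)
      then show ?thesis using False by (intro exI[of _ k]) (auto simp: blinfun.scaleR_right field_simps)
    qed
    \<comment> \<open>The spanning vectors may be dependent, so the dimension \<open>d\<close> is
      only bounded by their number; both factors of the bound increase with the dimension.\<close>
    have dm: "d \<le> m" using dB B(2) by simp
    have "\<eta> * real d ^ 2 * M \<le> \<eta> * (real m ^ 2 * (1 + 2 / \<epsilon>) ^ m)"
    proof -
      have "real M \<le> (1 + 2 / \<epsilon>) ^ m"
        using Z(3) order_trans[OF _ power_increasing[OF dm, of "1 + 2 / \<epsilon>"]] \<epsilon>(1) unfolding M_def by force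
      then have "real d ^ 2 * M \<le> real m ^ 2 * (1 + 2 / \<epsilon>) ^ m"
        using dm by (intro mult_mono power_mono) auto
      then show ?thesis using \<eta>(1) by (simp add: mult.assoc)
    qed
    then have small: "\<eta> * real d ^ 2 * M \<le> 1" using \<eta>(2) by simp
    have trace: "(\<Sum>i<d. \<psi> i (\<Sum>k<M. \<phi> k (e i) *\<^sub>R v k)) \<le> (5 * L + 18) * (\<Sum>k<M. norm (v k))"
      if "\<And>i. i < d \<Longrightarrow> (\<Sum>k<M. \<phi> k (e i) *\<^sub>R v k) \<in> span B" for v
      by (rule trace_inequality[OF subspace_span eE bi exp e \<psi> f g \<phi>(1) that d M less_imp_le[OF \<eta>(1)] small L])
    obtain S :: "'z \<Rightarrow>\<^sub>L 'z" where "norm S \<le> ((5 * L + 18) + 1) / (1 - \<epsilon>)"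
      "\<And>x. \<exists>a\<in>span B. J x o\<^sub>L S = J a" "\<And>x. x \<in> span B \<Longrightarrow> J x o\<^sub>L S = J x"
      by (rule weak_star_projection[OF subspace_span eE bi exp _ trace \<epsilon>(2) norming]) (use L in auto)
    then show ?thesis by (intro that[of S]) (auto simp: add.commute)
  qed
qed

section \<open>From the \<open>\<pi>\<close>-property to an FDD in dual spaces\<close>

text \<open>The blocks are the ranges of successive differences, which annihilate each other by the
  \<open>min\<close> rule. Applying \<open>V j\<close> to an expansion cuts it off after the block
  \<open>j\<close>, which gives uniqueness; strict growth of the ranges makes the blocks
  nonzero.\<close>

lemma FDD_of_commuting_projections:
  fixes V :: "nat \<Rightarrow> 'b::real_normed_vector \<Rightarrow> 'b"
  assumes lin: "\<And>k. bounded_linear (V k)"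
    and comm: "\<And>j k x. V j (V k x) = V (min j k) x"
    and fin: "\<And>k. \<exists>B. finite B \<and> range (V k) = span B"
    and lim: "\<And>x. (\<lambda>k. V k x) \<longlonglongrightarrow> x"
    and zero: "range (V 0) \<noteq> {0}" and grow: "\<And>k. range (V (Suc k)) \<noteq> range (V k)"
  shows "\<exists>W :: nat \<Rightarrow> 'b set. FDD W"
proof -
  define D where "D = (\<lambda>k x. case k of 0 \<Rightarrow> V 0 x | Suc l \<Rightarrow> V (Suc l) x - V l x)"
  define W where "W = (\<lambda>k. range (D k))"
  have lV: "linear (V k)" for k using lin by (rule bounded_linear.linear)
  have lD: "linear (D k)" for k
    using lV by (cases k) (auto simp: D_def intro: linear_compose_sub)
  have DV: "D k (V k x) = D k x" for k x
    by (cases k) (auto simp: D_def comm min_def)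
  have VD: "V j (D k x) = (if k \<le> j then D k x else 0)" for j k x
    by (cases k) (auto simp: D_def comm min_def linear_diff[OF lV] not_le less_Suc_eq_le)
  have part: "(\<Sum>n<Suc k. D n x) = V k x" for k x
    by (induction k) (auto simp: D_def)
  have sub: "subspace (W k)" for k
    unfolding W_def using linear_subspace_image[OF lD subspace_UNIV] by simp
  have finW: "\<exists>B. finite B \<and> span B = W k" for k
  proof -
    obtain B where B: "finite B" "range (V k) = span B" using fin by blast
    have "W k = D k ` range (V k)" unfolding W_def image_image DV ..
    also have "\<dots> = span (D k ` B)" unfolding B(2) using linear_span_image[OF lD] by simp
    finally show ?thesis using B(1) by blast
  qed
  have nz: "W k \<noteq> {0}" for k
  proof
    assume W0: "W k = {0}"
    show False
    proof (cases k)
      case 0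
      then show ?thesis using W0 zero by (simp add: W_def D_def)
    next
      case (Suc l)
      then have "V (Suc l) x - V l x = 0" for x
        using W0 unfolding W_def D_def by (metis (no_types, lifting) nat.simps(5) rangeI singletonD)
      then show False using grow[of l] by simp
    qed
  qed
  have "\<exists>!y. (\<forall>n. y n \<in> W n) \<and> y sums x" for x
  proof (rule ex1I[of _ "\<lambda>n. D n x"])
    have "(\<lambda>k. \<Sum>n<Suc k. D n x) \<longlonglongrightarrow> x" unfolding part by (rule lim)
    then have "(\<lambda>n. D n x) sums x" unfolding sums_def by (rule LIMSEQ_imp_Suc)
    then show "(\<forall>n. D n x \<in> W n) \<and> (\<lambda>n. D n x) sums x" by (auto simp: W_def)
    fix y assume y: "(\<forall>n. y n \<in> W n) \<and> y sums x"
    then have Vy: "V j (y n) = (if n \<le> j then y n else 0)" for j n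
      using VD by (metis (no_types, lifting) W_def imageE)
    have Vx: "V j x = (\<Sum>n\<le>j. y n)" for j
    proof -
      have "(\<lambda>n. V j (y n)) sums V j x"
        using bounded_linear.sums[OF lin] y by blast
      moreover have "(\<lambda>n. V j (y n)) sums (\<Sum>n\<le>j. V j (y n))"
        by (rule sums_finite) (auto simp: Vy)
      ultimately have "V j x = (\<Sum>n\<le>j. V j (y n))" by (rule sums_unique2)
      then show ?thesis by (simp add: Vy)
    qed
    show "y = (\<lambda>n. D n x)"
    proof
      fix n
      show "y n = D n x" by (cases n) (auto simp: D_def Vx)
    qed
  qed
  then have "FDD W" unfolding FDD_def by (intro conjI allI sub finW nz) simp
  then show ?thesis by blast
qed

lemma projections_tendsto_id:
  fixes V :: "nat \<Rightarrow> 'b::real_normed_vector \<Rightarrow> 'b"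
  assumes lin: "\<And>k. linear (V k)" and bound: "\<And>k x. norm (V k x) \<le> K * norm x"
    and mono: "incseq F" and id: "\<And>k x. x \<in> F k \<Longrightarrow> V k x = x"
    and dense: "closure (\<Union>k. F k) = UNIV"
  shows "(\<lambda>k. V k x) \<longlonglongrightarrow> x"
proof (rule LIMSEQ_I)
  fix e :: real assume e: "e > 0"
  define \<delta> where "\<delta> = e / (\<bar>K\<bar> + 2)"
  have \<delta>: "\<delta> > 0" "(\<bar>K\<bar> + 1) * \<delta> < e" using e by (auto simp: \<delta>_def field_simps)
  obtain y m where y: "y \<in> F m" "dist y x < \<delta>"
    using dense \<delta>(1) closure_approachable[of x "\<Union>k. F k"] by auto
  have "norm (V k x - x) < e" if "k \<ge> m" for k
  proof -
    have "y \<in> F k" using y(1) mono that by (auto simp: incseq_def)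
    then have "V k x - x = V k (x - y) - (x - y)" using id lin by (simp add: linear_diff)
    also have "norm \<dots> \<le> norm (V k (x - y)) + norm (x - y)" by (rule norm_triangle_ineq4)
    also have "\<dots> \<le> \<bar>K\<bar> * norm (x - y) + norm (x - y)"
      by (intro add_right_mono order_trans[OF bound] mult_right_mono) auto
    also have "\<dots> \<le> (\<bar>K\<bar> + 1) * \<delta>"
      using y(2) mult_left_mono[of "norm (x - y)" \<delta> "\<bar>K\<bar> + 1"] by (simp add: dist_norm norm_minus_commute algebra_simps)
    finally show ?thesis using \<delta>(2) by simp
  qed
  then show "\<exists>m. \<forall>k\<ge>m. norm (V k x - x) < e" by blast
qed

section \<open>Adjoints of operators on the predual\<close>

context dual_space
begin

text \<open>Weak-star continuous operators on \<open>X\<close> occur only as adjoints of operators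
  on the predual, so the weak-star topology itself need not be introduced.\<close>

definition adjoint_map :: "('z \<Rightarrow>\<^sub>L 'z) \<Rightarrow> 'a \<Rightarrow> 'a" where
  "adjoint_map S x = inv_into UNIV J (J x o\<^sub>L S)"

lemma J_adjoint: "J (adjoint_map S x) = J x o\<^sub>L S"
  unfolding adjoint_map_def by (rule surj_f_inv_f[OF J_surj])

lemma adjoint_map_eqI: "J x o\<^sub>L S = J y \<Longrightarrow> adjoint_map S x = y"
  by (rule J_inj) (simp add: J_adjoint)

lemma norm_adjoint_le: "norm (adjoint_map S x) \<le> norm S * norm x"
  using norm_blinfun_compose[of "J x" S] J_norm by (metis J_adjoint mult.commute)

lemma adjoint_bounded_linear: "bounded_linear (adjoint_map S)"
proof (rule bounded_linear_intro[where K = "norm S"])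
  show "adjoint_map S (x + y) = adjoint_map S x + adjoint_map S y" for x y
    by (rule adjoint_map_eqI, rule blinfun_eqI) (simp add: J_add J_adjoint blinfun.add_left)
  show "adjoint_map S (c *\<^sub>R x) = c *\<^sub>R adjoint_map S x" for c x
    by (rule adjoint_map_eqI, rule blinfun_eqI) (simp add: J_scale J_adjoint blinfun.scaleR_left)
  show "norm (adjoint_map S x) \<le> norm x * norm S" for x
    using norm_adjoint_le[of S x] by (simp add: mult.commute)
qed

lemma adjoint_operator_linear:
  "adjoint_map (S + T) x = adjoint_map S x + adjoint_map T x"
  "adjoint_map (S - T) x = adjoint_map S x - adjoint_map T x"
  "adjoint_map (c *\<^sub>R S) x = c *\<^sub>R adjoint_map S x"
  by (rule adjoint_map_eqI, rule blinfun_eqI,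
      simp add: J_add J_diff J_scale J_adjoint blinfun.add_left blinfun.add_right blinfun.diff_left
        blinfun.diff_right blinfun.scaleR_left blinfun.scaleR_right)+

lemma adjoint_compose: "adjoint_map (S o\<^sub>L T) x = adjoint_map T (adjoint_map S x)"
  by (rule adjoint_map_eqI, rule blinfun_eqI) (simp add: J_adjoint)

lemma predual_eq_zeroI:
  assumes "\<And>x. J x z = 0"
  shows "z = 0"
  using norm_predual_le[of z 0] assms by simp

lemma J_evaluation: "bounded_linear (\<lambda>x. J x z)"
  using norm_blinfun[of "J _" z]
  by (intro bounded_linear_intro[where K = "norm z"])
    (auto simp: J_add J_scale J_norm blinfun.add_left blinfun.scaleR_left)

text \<open>An operator vanishes on the annihilator of the range of its adjoint. That annihilator
  has finite codimension here, with the biorthogonal vectors \<open>y i\<close> as a complement, so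
  their images span the range.\<close>

lemma finite_rank_range:
  assumes B: "finite B" and U: "\<And>x. adjoint_map U x \<in> span B"
  obtains G where "finite G" "\<And>z. U z \<in> span G"
proof -
  obtain d :: nat and e :: "nat \<Rightarrow> 'a" and \<psi> :: "nat \<Rightarrow> ('a \<Rightarrow>\<^sub>L real)"
    where co: "d \<le> card B" "span (e ` {..<d}) = span B"
    "\<And>i j. i < d \<Longrightarrow> j < d \<Longrightarrow> \<psi> i (e j) = (if i = j then 1 else 0)"
    "\<And>x. x \<in> span B \<Longrightarrow> x = (\<Sum>i<d. \<psi> i x *\<^sub>R e i)"
    by (rule span_coordinates[OF B]) blast
  obtain y where y: "\<And>i j. i < d \<Longrightarrow> j < d \<Longrightarrow> J (e j) (y i) = (if i = j then 1 else 0)"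
    using predual_biorthogonal_system[of d \<psi> e] co(3) by blast
  have "U z \<in> span ((\<lambda>i. U (y i)) ` {..<d})" for z
  proof -
    define w where "w = z - (\<Sum>i<d. J (e i) z *\<^sub>R y i)"
    have ew: "J (e j) w = 0" if j: "j < d" for j
    proof -
      have "(\<Sum>i<d. J (e i) z * J (e j) (y i)) = (\<Sum>i<d. if i = j then J (e i) z else 0)"
        using y j by (intro sum.cong) auto
      then show ?thesis using j by (simp add: w_def blinfun.diff_right blinfun.sum_right blinfun.scaleR_right)
    qed
    have "U w = 0"
    proof (rule predual_eq_zeroI)
      fix x
      have "J x (U w) = J (adjoint_map U x) w" by (simp add: J_adjoint)
      also have "\<dots> = J (\<Sum>i<d. \<psi> i (adjoint_map U x) *\<^sub>R e i) w" using co(4)[OF U] by simp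
      also have "\<dots> = 0" by (simp add: J_sum J_scale blinfun.sum_left blinfun.scaleR_left ew)
      finally show "J x (U w) = 0" .
    qed
    then have "U z = (\<Sum>i<d. J (e i) z *\<^sub>R U (y i))"
      by (simp add: w_def blinfun.diff_right blinfun.sum_right blinfun.scaleR_right)
    also have "\<dots> \<in> span ((\<lambda>i. U (y i)) ` {..<d})"
      by (intro span_sum span_scale span_base) auto
    finally show ?thesis .
  qed
  then show ?thesis using that[of "(\<lambda>i. U (y i)) ` {..<d}"] by blast
qed

end

lemma convex_evaluation_vimage:
  fixes f :: "'z::real_normed_vector" and C :: "'y::real_normed_vector set"
  assumes "convex C"
  shows "convex {T :: 'z \<Rightarrow>\<^sub>L 'y. blinfun_apply T f \<in> C}"
proof (rule convexI)
  fix S T :: "'z \<Rightarrow>\<^sub>L 'y" and u v :: real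
  assume "S \<in> {T. blinfun_apply T f \<in> C}" "T \<in> {T. blinfun_apply T f \<in> C}" "0 \<le> u" "0 \<le> v" "u + v = 1"
  then show "u *\<^sub>R S + v *\<^sub>R T \<in> {T. blinfun_apply T f \<in> C}"
    using convexD[OF assms, of "S f" "T f" u v] by (simp add: blinfun.add_left blinfun.scaleR_left)
qed

text \<open>A \<open>\<pi>\<close>-property realised by weak-star continuous projections with increasing ranges \<open>F n\<close>.\<close>

locale weak_star_projections = dual_space J
  for J :: "'a::real_normed_vector \<Rightarrow> ('z::real_normed_vector \<Rightarrow>\<^sub>L real)" +
  fixes F :: "nat \<Rightarrow> 'a set" and S :: "nat \<Rightarrow> ('z \<Rightarrow>\<^sub>L 'z)" and \<Lambda> :: real
  assumes F_span: "\<exists>B. finite B \<and> F n = span B"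
    and F_mono: "incseq F"
    and F_dense: "closure (\<Union>n. F n) = UNIV"
    and F_grow: "\<exists>m>n. F m \<noteq> F n"
    and S_norm: "norm (S n) \<le> \<Lambda>"
    and S_range: "adjoint_map (S n) x \<in> F n"
    and S_id: "x \<in> F n \<Longrightarrow> adjoint_map (S n) x = x"
begin

lemma F_subspace: "subspace (F n)"
  using F_span[of n] by auto

lemma F_le: "m \<le> n \<Longrightarrow> F m \<subseteq> F n"
  using F_mono by (auto simp: incseq_def)

lemma \<Lambda>_nonneg: "\<Lambda> \<ge> 0"
  using S_norm[of 0] norm_ge_zero order_trans by blast

lemma subspace_Union_F: "subspace (\<Union>n. F n)"
proof (rule subspaceI)
  show "0 \<in> (\<Union>n. F n)" using subspace_0[OF F_subspace[of 0]] by blast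
  show "x + y \<in> (\<Union>n. F n)" if xy: "x \<in> (\<Union>n. F n)" "y \<in> (\<Union>n. F n)" for x y
  proof -
    obtain m n where "x \<in> F m" "y \<in> F n" using xy by auto
    then have "x \<in> F (max m n)" "y \<in> F (max m n)"
      using F_le[of m "max m n"] F_le[of n "max m n"] by auto
    then show ?thesis using subspace_add[OF F_subspace] by blast
  qed
  show "c *\<^sub>R x \<in> (\<Union>n. F n)" if "x \<in> (\<Union>n. F n)" for c x
    using that subspace_scale[OF F_subspace] by blast
qed

lemma adjoint_S_tendsto: "(\<lambda>n. adjoint_map (S n) x) \<longlonglongrightarrow> x"
proof (rule projections_tendsto_id[OF _ _ F_mono S_id F_dense])
  show "linear (adjoint_map (S k))" for k using adjoint_bounded_linear by (rule bounded_linear.linear)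
  show "norm (adjoint_map (S k) x) \<le> \<Lambda> * norm x" for k x
    using norm_adjoint_le[of "S k" x] mult_right_mono[OF S_norm[of k], of "norm x"] by simp
qed

text \<open>Mazur's theorem turns the weak convergence \<open>S n f \<longlonglongrightarrow> f\<close> into norm approximation by convex
  combinations.\<close>

lemma convex_combination_approximates:
  assumes "finite G" "\<epsilon> > 0"
  shows "\<exists>T\<in>convex hull (S ` {N..}). \<forall>f\<in>G. norm (T f - f) < \<epsilon>"
  using assms(1)
proof (induction G arbitrary: N rule: finite_induct)
  case empty
  show ?case by (auto intro!: hull_inc)
next
  case (insert g G)
  \<comment> \<open>A whole sequence is drawn from the induction hypothesis, one operator from the
    hull of each tail. Every convex combination of these still approximates on \<open>G\<close>, and
    membership in late tails keeps the weak estimate at the new vector \<open>g\<close>.\<close>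
  obtain T where T: "\<And>n. T n \<in> convex hull (S ` {n..})" "\<And>n f. f \<in> G \<Longrightarrow> norm (T n f - f) < \<epsilon>"
    using insert.IH by metis
  define C where "C = (\<lambda>T. blinfun_apply T g) ` (convex hull (T ` {N..}))"
  have "g \<in> closure C"
  proof (rule closure_convex_by_functionals)
    show "convex C"
      unfolding C_def
      by (intro convex_linear_image convex_convex_hull bounded_linear.linear blinfun.bounded_linear_left)
    show "C \<noteq> {}" by (simp add: C_def)
    fix \<phi> :: "'z \<Rightarrow>\<^sub>L real" and e :: real assume e: "e > 0"
    obtain x where x: "\<phi> = J x" using J_surj by (metis surjD)
    have "(\<lambda>n. J (adjoint_map (S n) x) g) \<longlonglongrightarrow> J x g"
    by (rule bounded_linear.tendsto[OF J_evaluation adjoint_S_tendsto])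
    then obtain n0 where n0: "\<And>n. n \<ge> n0 \<Longrightarrow> J x (S n g) < J x g + e"
      using order_tendstoD(2)[of _ "J x g" sequentially "J x g + e"] e
      by (auto simp: J_adjoint eventually_sequentially)
    define n where "n = max n0 N"
    have "convex {T :: 'z \<Rightarrow>\<^sub>L 'z. blinfun_apply T g \<in> {z. J x z < J x g + e}}"
    proof (rule convex_evaluation_vimage)
      have "{z. J x z < J x g + e} = J x -` {..<J x g + e}" by auto
      then show "convex {z. J x z < J x g + e}"
        by (simp add: convex_linear_vimage bounded_linear.linear blinfun.bounded_linear_right)
    qed
    then have "convex hull (S ` {n..}) \<subseteq> {T. blinfun_apply T g \<in> {z. J x z < J x g + e}}"
      using n0 by (intro hull_minimal) (auto simp: n_def)
    then have "J x (T n g) < J x g + e" using T(1)[of n] by auto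
    moreover have "T n g \<in> C" unfolding C_def by (intro imageI hull_inc) (simp add: n_def)
    ultimately show "\<exists>c\<in>C. \<phi> c < \<phi> g + e" using x by blast
  qed
  then obtain c where "c \<in> C" "dist c g < \<epsilon>" using assms(2) closure_approachable by blast
  then obtain T0 where T0: "T0 \<in> convex hull (T ` {N..})" "norm (T0 g - g) < \<epsilon>"
    by (auto simp: C_def dist_norm)
  have "T ` {N..} \<subseteq> convex hull (S ` {N..})"
  proof
    fix R assume "R \<in> T ` {N..}"
    then obtain n where n: "n \<ge> N" "R = T n" by auto
    then have "S ` {n..} \<subseteq> S ` {N..}" by auto
    then show "R \<in> convex hull (S ` {N..})" using T(1)[of n] hull_mono n by blast
  qed
  then have "convex hull (T ` {N..}) \<subseteq> convex hull (S ` {N..})"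
    by (intro hull_minimal) (auto simp: convex_convex_hull)
  moreover have "norm (T0 f - f) < \<epsilon>" if f: "f \<in> G" for f
  proof -
    have "convex hull (T ` {N..}) \<subseteq> {T. blinfun_apply T f \<in> ball f \<epsilon>}"
      using T(2)[OF f] by (intro hull_minimal convex_evaluation_vimage) (auto simp: dist_norm norm_minus_commute)
    then show ?thesis using T0(1) by (auto simp: dist_norm norm_minus_commute)
  qed
  ultimately show ?case using T0 by auto
qed

lemma convex_hull_S_properties:
  assumes "T \<in> convex hull (range S)"
  shows "norm T \<le> \<Lambda>" "\<exists>m. \<forall>x. adjoint_map T x \<in> F m"
proof -
  have "convex hull (range S) \<subseteq> cball 0 \<Lambda>"
    using S_norm by (intro hull_minimal) auto
  then show "norm T \<le> \<Lambda>" using assms by auto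
  have "convex {T. \<exists>m. \<forall>x. adjoint_map T x \<in> F m}"
  proof (rule convexI)
    fix P Q and u v :: real
    assume "P \<in> {T. \<exists>m. \<forall>x. adjoint_map T x \<in> F m}" "Q \<in> {T. \<exists>m. \<forall>x. adjoint_map T x \<in> F m}"
    then obtain m n where mn: "\<And>x. adjoint_map P x \<in> F m" "\<And>x. adjoint_map Q x \<in> F n" by auto
    have "adjoint_map (u *\<^sub>R P + v *\<^sub>R Q) x \<in> F (max m n)" for x
      unfolding adjoint_operator_linear
      using mn F_le[of m "max m n"] F_le[of n "max m n"]
      by (intro subspace_add[OF F_subspace] subspace_scale[OF F_subspace]) auto
    then show "u *\<^sub>R P + v *\<^sub>R Q \<in> {T. \<exists>m. \<forall>x. adjoint_map T x \<in> F m}" by blast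
  qed
  then have "convex hull (range S) \<subseteq> {T. \<exists>m. \<forall>x. adjoint_map T x \<in> F m}"
    using S_range by (intro hull_minimal) auto
  then show "\<exists>m. \<forall>x. adjoint_map T x \<in> F m" using assms by auto
qed

text \<open>A convex combination \<open>T0\<close> that almost fixes a basis \<open>B\<close> of the
  span of \<open>G\<close> is corrected by \<open>C\<close>, which sends each basis vector
  \<open>b\<close> to \<open>b - T0 b\<close>. The biorthogonal functionals are taken from the union
  of the \<open>F n\<close>, so that the adjoint of the corrected operator still has its range in a
  single \<open>F m\<close>.\<close>

lemma finite_rank_operator_fixing:
  assumes G: "finite G"
  obtains T m where "norm T \<le> \<Lambda> + 1" "\<And>f. f \<in> G \<Longrightarrow> blinfun_apply T f = f" "\<And>x. adjoint_map T x \<in> F m"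
proof -
  obtain B where B: "B \<subseteq> G" "independent B" "G \<subseteq> span B"
    using maximal_independent_subset[of G] by metis
  have finB: "finite B" using B(1) G finite_subset by blast
  have "\<exists>r. \<forall>b\<in>B. r b \<in> (\<Union>n. F n) \<and> (\<forall>c\<in>B. J (r b) c = (if b = c then 1 else 0))"
  proof (rule biorthogonal_system[where pair = "\<lambda>x. blinfun_apply (J x)"])
    show "linear (blinfun_apply (J w))" for w by (simp add: blinfun.bounded_linear_right bounded_linear.linear)
    show "linear (\<lambda>w. J w b)" for b by (rule linearI) (auto simp: J_add J_scale blinfun.add_left blinfun.scaleR_left)
    show "\<exists>w\<in>\<Union>n. F n. J w b \<noteq> 0" if "b \<noteq> 0" for b
    proof (rule ccontr)
      assume "\<not> ?thesis"
      then have 0: "J (adjoint_map (S n) x) b = 0" for n x using S_range by blast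
      have "J x b = 0" for x
      proof -
        have "(\<lambda>n. J (adjoint_map (S n) x) b) \<longlonglongrightarrow> J x b"
        by (rule bounded_linear.tendsto[OF J_evaluation adjoint_S_tendsto])
        then show ?thesis by (simp add: 0 LIMSEQ_const_iff)
      qed
      then show False using predual_eq_zeroI that by blast
    qed
  qed (use subspace_Union_F finB B in auto)
  then obtain r where r: "\<And>b. b \<in> B \<Longrightarrow> r b \<in> (\<Union>n. F n)"
    "\<And>b c. b \<in> B \<Longrightarrow> c \<in> B \<Longrightarrow> J (r b) c = (if b = c then 1 else 0)" by blast
  \<comment> \<open>The accuracy is measured against the norms of the biorthogonal functionals,
    which makes the correction have norm at most 1.\<close>
  define \<epsilon> where "\<epsilon> = 1 / (1 + (\<Sum>b\<in>B. norm (r b)))"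
  have s0: "(\<Sum>b\<in>B. norm (r b)) \<ge> 0" by (simp add: sum_nonneg)
  have \<epsilon>: "\<epsilon> > 0" "(\<Sum>b\<in>B. norm (r b)) * \<epsilon> \<le> 1" using s0 by (auto simp: \<epsilon>_def field_simps)
  obtain T0 where T0: "T0 \<in> convex hull (S ` {0..})" "\<And>f. f \<in> B \<Longrightarrow> norm (T0 f - f) < \<epsilon>"
    using convex_combination_approximates[OF finB \<epsilon>(1), of 0] by blast
  have "T0 \<in> convex hull (range S)" using T0(1) by (simp add: atLeast_0)
  then obtain m0 where T0': "norm T0 \<le> \<Lambda>" "\<And>x. adjoint_map T0 x \<in> F m0"
    using convex_hull_S_properties by blast
  have bl: "bounded_linear (\<lambda>z. \<Sum>b\<in>B. J (r b) z *\<^sub>R (b - T0 b))"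
    by (intro bounded_linear_sum bounded_linear_scaleR_const blinfun.bounded_linear_right)
  define C where "C = Blinfun (\<lambda>z. \<Sum>b\<in>B. J (r b) z *\<^sub>R (b - T0 b))"
  have C: "C z = (\<Sum>b\<in>B. J (r b) z *\<^sub>R (b - T0 b))" for z
    by (simp add: C_def bounded_linear_Blinfun_apply[OF bl])
  have Cn: "norm C \<le> 1"
  proof (rule norm_blinfun_bound)
    fix z
    have "norm (C z) \<le> (\<Sum>b\<in>B. norm (J (r b) z *\<^sub>R (b - T0 b)))" unfolding C by (rule norm_sum)
    also have "\<dots> \<le> (\<Sum>b\<in>B. norm (r b) * norm z * \<epsilon>)"
    proof (rule sum_mono)
      fix b assume "b \<in> B"
      then have "norm (b - T0 b) \<le> \<epsilon>" using T0(2)[of b] by (simp add: norm_minus_commute)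
      then show "norm (J (r b) z *\<^sub>R (b - T0 b)) \<le> norm (r b) * norm z * \<epsilon>"
        using norm_blinfun[of "J (r b)" z] by (auto simp: J_norm intro!: mult_mono)
    qed
    also have "\<dots> = ((\<Sum>b\<in>B. norm (r b)) * \<epsilon>) * norm z"
      by (simp add: sum_distrib_left sum_distrib_right mult_ac)
    also have "\<dots> \<le> 1 * norm z" using \<epsilon>(2) by (intro mult_right_mono) auto
    finally show "norm (C z) \<le> 1 * norm z" .
  qed simp
  have adjC: "adjoint_map C x = (\<Sum>b\<in>B. J x (b - T0 b) *\<^sub>R r b)" for x
    by (rule adjoint_map_eqI, rule blinfun_eqI)
      (simp add: C J_sum J_scale blinfun.sum_left blinfun.sum_right blinfun.scaleR_left blinfun.scaleR_right mult.commute)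
  have "\<forall>b\<in>B. \<exists>n. r b \<in> F n" using r(1) by blast
  then obtain \<mu> where \<mu>: "\<And>b. b \<in> B \<Longrightarrow> r b \<in> F (\<mu> b)" by (auto dest!: bchoice)
  define m where "m = m0 + sum \<mu> B"
  have rm: "r b \<in> F m" if "b \<in> B" for b
    using \<mu>[OF that] F_le[of "\<mu> b" m] member_le_sum[of b B \<mu>] that finB by (auto simp: m_def)
  show ?thesis
  proof (rule that[of "T0 + C" m])
    show "norm (T0 + C) \<le> \<Lambda> + 1" using norm_triangle_ineq[of T0 C] T0' Cn by simp
    show "blinfun_apply (T0 + C) f = f" if "f \<in> G" for f
    proof -
      have "f \<in> span B" using that B(3) by blast
      then show ?thesis
      proof (rule span_induct[where P = "\<lambda>f. blinfun_apply (T0 + C) f = f"])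
        show "subspace {f. blinfun_apply (T0 + C) f = f}"
          by (rule subspaceI) (auto simp: blinfun.add_right blinfun.scaleR_right)
        fix b assume b: "b \<in> B"
        have "(\<Sum>c\<in>B. J (r c) b *\<^sub>R (c - T0 c)) = (\<Sum>c\<in>B. if c = b then b - T0 b else 0)"
          using r(2) b by (intro sum.cong) auto
        then show "blinfun_apply (T0 + C) b = b"
          using b finB by (simp add: blinfun.add_left C)
      qed
    qed
    show "adjoint_map (T0 + C) x \<in> F m" for x
      unfolding adjoint_operator_linear adjC
      using T0'(2)[of x] F_le[of m0 m] rm
      by (intro subspace_add[OF F_subspace] subspace_sum[OF F_subspace] subspace_scale[OF F_subspace])
        (auto simp: m_def)
  qed
qed

text \<open>The operator \<open>S\<^sub>m + T - S\<^sub>m T\<close> inherits the range of the adjoint from \<open>S\<^sub>m\<close> and the fixed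
  vectors from \<open>T\<close> (Johnson, Rosenthal, Zippin).\<close>

lemma projection_fixing:
  assumes G: "finite G"
  obtains U m where "m0 \<le> m" "norm U \<le> 2 * \<Lambda> + 1 + \<Lambda> * (\<Lambda> + 1)" "\<And>f. f \<in> G \<Longrightarrow> blinfun_apply U f = f"
    "\<And>x. adjoint_map U x \<in> F m" "\<And>x. x \<in> F m \<Longrightarrow> adjoint_map U x = x"
proof -
  obtain T m1 where T: "norm T \<le> \<Lambda> + 1" "\<And>f. f \<in> G \<Longrightarrow> blinfun_apply T f = f" "\<And>x. adjoint_map T x \<in> F m1"
    using finite_rank_operator_fixing[OF G] by blast
  define m where "m = max m0 m1"
  define U where "U = S m + T - (S m o\<^sub>L T)"
  have Fm: "adjoint_map T x \<in> F m" for x using T(3)[of x] F_le[of m1 m] by (auto simp: m_def)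
  have adjU: "adjoint_map U x = adjoint_map (S m) x + adjoint_map T x - adjoint_map T (adjoint_map (S m) x)" for x
    by (simp add: U_def adjoint_operator_linear adjoint_compose)
  show ?thesis
  proof (rule that[of m U])
    show "m0 \<le> m" by (simp add: m_def)
    have "norm U \<le> norm (S m) + norm T + norm (S m o\<^sub>L T)"
      unfolding U_def by (meson add_right_mono norm_triangle_ineq norm_triangle_ineq4 order_trans)
    also have "norm (S m o\<^sub>L T) \<le> norm (S m) * norm T" by (rule norm_blinfun_compose)
    also have "norm (S m) * norm T \<le> \<Lambda> * (\<Lambda> + 1)" using S_norm T(1) \<Lambda>_nonneg by (intro mult_mono) auto
    finally show "norm U \<le> 2 * \<Lambda> + 1 + \<Lambda> * (\<Lambda> + 1)" using S_norm[of m] T(1) by simp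
    show "blinfun_apply U f = f" if "f \<in> G" for f
      using T(2)[OF that] by (simp add: U_def blinfun.add_left blinfun.diff_left)
    show "adjoint_map U x \<in> F m" for x
      unfolding adjU using S_range Fm by (intro subspace_add[OF F_subspace] subspace_diff[OF F_subspace])
    show "adjoint_map U x = x" if "x \<in> F m" for x
      unfolding adjU S_id[OF that] by simp
  qed
qed

text \<open>Each new operator \<open>V\<close> fixes the finite dimensional range of its predecessor
  \<open>U\<close>, and its adjoint has the larger range. The identity \<open>V U = U\<close>
  dualises to one order of composing the adjoints, the inclusion of ranges yields the other, and
  together they give the \<open>min\<close> rule.\<close>

theorem exists_FDD: "\<exists>W :: nat \<Rightarrow> 'a set. FDD W"
proof -
  define K where "K = 2 * \<Lambda> + 1 + \<Lambda> * (\<Lambda> + 1)"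
  define P where "P = (\<lambda>(m, U). norm U \<le> K \<and> (\<forall>x. adjoint_map U x \<in> F m) \<and> (\<forall>x\<in>F m. adjoint_map U x = x) \<and> F m \<noteq> {0})"
  define Q where "Q = (\<lambda>(m, U :: 'z \<Rightarrow>\<^sub>L 'z) (n, V :: 'z \<Rightarrow>\<^sub>L 'z). m \<le> n \<and> F m \<noteq> F n \<and> (\<forall>z. V (U z) = U z))"
  have step: "\<exists>q. P q \<and> Q p q" if p: "P p" for p
  proof -
    obtain m U where pU: "p = (m, U)" by (cases p)
    obtain B where B: "finite B" "F m = span B" using F_span by blast
    have "adjoint_map U x \<in> span B" for x using p unfolding pU P_def B(2)[symmetric] by simp
    then obtain G where G: "finite G" "\<And>z. U z \<in> span G"
      using finite_rank_range[OF B(1), of U] by blast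
    obtain m' where m': "m' > m" "F m' \<noteq> F m" using F_grow by blast
    obtain V n where V: "m' \<le> n" "norm V \<le> K" "\<And>f. f \<in> G \<Longrightarrow> blinfun_apply V f = f"
      "\<And>x. adjoint_map V x \<in> F n" "\<And>x. x \<in> F n \<Longrightarrow> adjoint_map V x = x"
      by (rule projection_fixing[OF G(1), of m', folded K_def]) blast
    have sub: "F m \<subseteq> F m'" "F m' \<subseteq> F n" using F_le m' V(1) by auto
    have "V (U z) = U z" for z
    proof (rule span_induct[OF G(2)])
      show "subspace {f. blinfun_apply V f = f}"
        by (rule subspaceI) (auto simp: blinfun.add_right blinfun.scaleR_right)
    qed (use V(3) in simp)
    moreover have "F n \<noteq> {0}" "F m \<noteq> F n"
      using p sub m' subspace_0[OF F_subspace] by (auto simp: pU P_def)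
    ultimately have "P (n, V) \<and> Q p (n, V)"
      using V m' by (auto simp: P_def Q_def pU)
    then show ?thesis by blast
  qed
  have start: "\<exists>p. P p"
  proof -
    obtain m' where m': "m' > 0" "F m' \<noteq> F 0" using F_grow by blast
    obtain U m where U: "m' \<le> m" "norm U \<le> K" "\<And>f. f \<in> {} \<Longrightarrow> blinfun_apply U f = f"
      "\<And>x. adjoint_map U x \<in> F m" "\<And>x. x \<in> F m \<Longrightarrow> adjoint_map U x = x"
      by (rule projection_fixing[of "{}" m', folded K_def]) auto
    have "F 0 \<subseteq> F m'" "F m' \<subseteq> F m" using F_le U(1) by auto
    then have "F m \<noteq> {0}" using m' subspace_0[OF F_subspace, of 0] subspace_0[OF F_subspace, of m'] by auto
    then show ?thesis using U by (intro exI[of _ "(m, U)"]) (auto simp: P_def)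
  qed
  obtain p where p: "\<And>n. P (p n)" "\<And>n. Q (p n) (p (Suc n))"
    using dependent_nat_choice[of "\<lambda>_. P" "\<lambda>_. Q"] start step by blast
  define m where "m = (\<lambda>k. fst (p k))"
  define U where "U = (\<lambda>k. snd (p k))"
  have pk: "p k = (m k, U k)" for k by (simp add: m_def U_def)
  have U: "norm (U k) \<le> K" "adjoint_map (U k) x \<in> F (m k)" "x \<in> F (m k) \<Longrightarrow> adjoint_map (U k) x = x" "F (m k) \<noteq> {0}" for k x
    using p(1)[of k] by (auto simp: P_def pk)
  have mm: "m k \<le> m (Suc k)" "F (m k) \<noteq> F (m (Suc k))" "U (Suc k) (U k z) = U k z" for k z
    using p(2)[of k] by (auto simp: Q_def pk)
  have m_mono: "incseq m" using mm(1) by (rule incseq_SucI)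
  have UU: "U k (U j z) = U j z" if "j < k" for j k z
    using that
  proof (induction k)
    case (Suc k)
    show ?case
    proof (cases "j = k")
      case True
      then show ?thesis using mm(3) by simp
    next
      case False
      then have "U k (U j z) = U j z" using Suc by simp
      then show ?thesis using mm(3)[of k "U j z"] by simp
    qed
  qed simp
  have range_V: "range (adjoint_map (U k)) = F (m k)" for k
    using U(2,3)[where k = k] by (metis UNIV_I image_eqI image_subsetI subsetI subset_antisym)
  show ?thesis
  proof (rule FDD_of_commuting_projections[of "\<lambda>k. adjoint_map (U k)"])
    show "bounded_linear (adjoint_map (U k))" for k by (rule adjoint_bounded_linear)
    show "adjoint_map (U j) (adjoint_map (U k) x) = adjoint_map (U (min j k)) x" for j k x
    proof (cases "k \<le> j")
      case True
      then have "F (m k) \<subseteq> F (m j)" using m_mono F_le by (auto simp: incseq_def)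
      then have "adjoint_map (U k) x \<in> F (m j)" using U(2)[of k x] by blast
      then have "adjoint_map (U j) (adjoint_map (U k) x) = adjoint_map (U k) x" by (rule U(3))
      then show ?thesis using True by (simp add: min_absorb2)
    next
      case False
      then have "U k o\<^sub>L U j = U j" by (intro blinfun_eqI) (simp add: UU)
      then show ?thesis using False adjoint_compose[of "U k" "U j" x] by (simp add: min_def)
    qed
    show "\<exists>B. finite B \<and> range (adjoint_map (U k)) = span B" for k
      unfolding range_V by (rule F_span)
    show "range (adjoint_map (U 0)) \<noteq> {0}" unfolding range_V by (rule U(4))
    show "range (adjoint_map (U (Suc k))) \<noteq> range (adjoint_map (U k))" for k
      unfolding range_V using mm(2)[of k] by simp
    show "(\<lambda>k. adjoint_map (U k) x) \<longlonglongrightarrow> x" for x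
    proof (rule projections_tendsto_id[where F = "\<lambda>k. F (m k)" and K = K])
      show "linear (adjoint_map (U k))" for k using adjoint_bounded_linear by (rule bounded_linear.linear)
      show "norm (adjoint_map (U k) x) \<le> K * norm x" for k x
        using norm_adjoint_le[of "U k" x] mult_right_mono[OF U(1)[of k], of "norm x"] by simp
      show "incseq (\<lambda>k. F (m k))" using m_mono F_mono by (auto simp: incseq_def)
      have "strict_mono m"
      proof (rule strict_monoI_Suc)
        show "m k < m (Suc k)" for k using mm(1,2)[of k] by (metis le_neq_implies_less)
      qed
      then have "\<exists>k. x \<in> F (m k)" if "x \<in> F n" for x n
        using F_le[OF seq_suble[of m n]] that by blast
      then have "(\<Union>k. F (m k)) = (\<Union>n. F n)" by blast
      then show "closure (\<Union>k. F (m k)) = UNIV" using F_dense by simp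
    qed (rule U(3))
  qed
qed

end

section \<open>Small Lipschitz retracts yield an FDD\<close>

text \<open>Translates the quotient in [0, \<infinity>] into real data. Neither the inner radius nor
  the distance to the span need be attained, so a radius above 3/4 of the supremum and distances
  below 3/2 of the height are used; together they cost the factor 2, which the 2 in the definition
  of \<open>small\<close> absorbs.\<close>

lemma small_radius_height:
  fixes K :: "'a::real_normed_vector set"
  assumes ratio: "0 < height \<beta> K n / inner_radius \<beta> K n" "height \<beta> K n / inner_radius \<beta> K n \<le> ennreal q"
  obtains x r \<eta> where "x \<in> Espan \<beta> n" "r > 0" "cball x r \<inter> Espan \<beta> n \<subseteq> K" "\<eta> > 0" "\<eta> \<le> 2 * q"
    "\<And>y. y \<in> K \<Longrightarrow> \<exists>a\<in>Espan \<beta> n. norm (y - a) \<le> \<eta> * r" "\<exists>y\<in>K. y \<notin> Espan \<beta> n"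
proof -
  define H where "H = height \<beta> K n"
  define I where "I = inner_radius \<beta> K n"
  have H0: "H > 0" and Itop: "I < top_class.top" using ratio(1) by (simp_all add: H_def I_def ennreal_zero_less_divide)
  have I0: "I > 0"
  proof (rule ccontr)
    assume "\<not> I > 0"
    then have "H / I = top_class.top" using H0 by (simp add: ennreal_divide_eq_top_iff)
    then show False using ratio(2) by (simp add: H_def I_def top_unique)
  qed
  obtain i where i: "I = ennreal i" "i > 0" using I0 Itop by (cases I) auto
  have HI: "H \<le> ennreal q * I"
  proof -
    have "H = (H / I) * I" using I0 Itop by (simp add: ennreal_divide_times)
    also have "\<dots> \<le> ennreal q * I" using ratio(2) by (intro mult_right_mono) (auto simp: H_def I_def)
    finally show ?thesis .
  qed
  have Htop: "H < top_class.top" using HI i by (simp add: ennreal_mult_less_top order.strict_trans1)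
  obtain h where h: "H = ennreal h" "h > 0" using H0 Htop by (cases H) auto
  have q: "q > 0"
  proof (rule ccontr)
    assume "\<not> q > 0"
    then have "ennreal q = 0" by (simp add: ennreal_eq_0_iff)
    then show False using HI H0 by simp
  qed
  have hq: "h \<le> q * i" using HI q i h by (simp add: ennreal_mult[symmetric])
  have "ennreal (3 / 4 * i) < I" unfolding i using i(2) by (simp add: ennreal_less_iff)
  then obtain r x where r: "0 \<le> r" "ennreal (3 / 4 * i) < ennreal r" "x \<in> Espan \<beta> n"
    "cball x r \<inter> Espan \<beta> n \<subseteq> K \<inter> Espan \<beta> n"
    unfolding I_def inner_radius_def less_Sup_iff by auto
  then have ri: "3 / 4 * i < r" using i(2) by (simp add: ennreal_less_iff)
  have rpos: "r > 0" using ri i(2) by simp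
  have inf: "infdist y (Espan \<beta> n) \<le> h" if "y \<in> K" for y
  proof -
    have "ennreal (infdist y (Espan \<beta> n)) \<le> H" unfolding H_def height_def using that by (rule SUP_upper)
    then show ?thesis using h by (simp add: ennreal_le_iff)
  qed
  have ne: "Espan \<beta> n \<noteq> {}" by (auto simp: Espan_def intro: span_zero)
  show ?thesis
  proof (rule that[of x r "3 / 2 * h / r"])
    show "x \<in> Espan \<beta> n" "r > 0" "cball x r \<inter> Espan \<beta> n \<subseteq> K" "3 / 2 * h / r > 0" using r rpos h by auto
    have "3 / 2 * h \<le> 3 / 2 * (q * i)" using hq by simp
    also have "\<dots> \<le> 2 * q * r" using ri q mult_left_mono[of "3 / 4 * i" r "2 * q"] by simp
    finally show "3 / 2 * h / r \<le> 2 * q" using rpos by (simp add: pos_divide_le_eq)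
    show "\<exists>a\<in>Espan \<beta> n. norm (y - a) \<le> 3 / 2 * h / r * r" if "y \<in> K" for y
    proof -
      have "infdist y (Espan \<beta> n) < 3 / 2 * h" using inf[OF that] h(2) by simp
      then have "(INF a\<in>Espan \<beta> n. dist y a) < 3 / 2 * h" using ne by (simp add: infdist_def)
      then obtain a where "a \<in> Espan \<beta> n" "dist y a < 3 / 2 * h"
        using cINF_less_iff[OF ne, of "dist y"] by (metis bdd_below.I2 zero_le_dist)
      then show ?thesis using rpos by (intro bexI[of _ a]) (auto simp: dist_norm)
    qed
    show "\<exists>y\<in>K. y \<notin> Espan \<beta> n"
    proof (rule ccontr)
      assume "\<not> ?thesis"
      then have "H = (SUP y\<in>K. ennreal 0)"
        unfolding H_def height_def by (intro SUP_cong) auto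
      also have "\<dots> \<le> 0" by (intro SUP_least) simp
      finally show False using H0 by simp
    qed
  qed
qed

theorem small_lipschitz_retract_imp_FDD:
  fixes J :: "'a::real_normed_vector \<Rightarrow> ('z::real_normed_vector \<Rightarrow>\<^sub>L real)" and K :: "'a set"
  assumes J: "dual_identification J" and K: "small K" "lipschitz_retract K"
  shows "\<exists>V :: nat \<Rightarrow> 'a set. FDD V"
proof -
  interpret dual_space J
    using J by unfold_locales (auto simp: dual_identification_def linear_add linear_cmul)
  obtain \<epsilon> :: real and \<beta> :: "nat \<Rightarrow> 'a" and \<sigma> :: "nat \<Rightarrow> nat" where
    bK: "bounded K" and \<epsilon>: "0 < \<epsilon>" "\<epsilon> < 1" and \<beta>: "fundamental \<beta>" and \<sigma>: "strict_mono \<sigma>" "\<And>n. 0 < \<sigma> n" and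
    ratio: "\<And>n. 0 < height \<beta> K (\<sigma> n) / inner_radius \<beta> K (\<sigma> n)"
      "\<And>n. height \<beta> K (\<sigma> n) / inner_radius \<beta> K (\<sigma> n)
         \<le> ennreal (1 / (2 * real (\<sigma> n) ^ 2 * ((1 + 2 / \<epsilon>) ^ \<sigma> n + 2)))"
    using K(1) unfolding small_def by blast
  obtain R L where R: "L-lipschitz_on UNIV R" "range R \<subseteq> K" "\<And>x. x \<in> K \<Longrightarrow> R x = x"
    using K(2) unfolding lipschitz_retract_def by blast
  have L: "L \<ge> 0" using R(1) by (rule lipschitz_on_nonneg)
  obtain b where b: "\<And>y. y \<in> K \<Longrightarrow> norm y \<le> b" using bK by (auto simp: bounded_iff)
  define B where "B = (\<lambda>n. \<beta> ` {..<\<sigma> n})"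
  define F where "F = (\<lambda>n. span (B n))"
  have FE: "F n = Espan \<beta> (\<sigma> n)" for n by (simp add: F_def B_def Espan_def)
  have finB: "finite (B n)" for n by (simp add: B_def)
  have cardB: "card (B n) \<le> \<sigma> n" for n unfolding B_def using card_image_le[of "{..<\<sigma> n}" \<beta>] by simp
  have mono: "incseq F"
    unfolding F_def B_def incseq_def
    using \<sigma>(1) by (intro allI impI span_mono image_mono) (auto simp: strict_mono_less_eq)
  have un: "(\<Union>n. F n) = span (range \<beta>)"
  proof (intro equalityI subsetI)
    fix x assume "x \<in> (\<Union>n. F n)"
    then show "x \<in> span (range \<beta>)" unfolding F_def B_def using span_mono[of "\<beta> ` _" "range \<beta>"] by blast
  next
    fix x assume "x \<in> span (range \<beta>)"
    then obtain T where T: "finite T" "T \<subseteq> range \<beta>" "x \<in> span T"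
      by (auto simp: span_explicit intro: span_sum span_scale span_base)
    obtain N where N: "finite N" "T = \<beta> ` N" using finite_subset_image[OF T(1,2)] by blast
    have "N \<subseteq> {..<\<sigma> (Suc (Max (insert 0 N)))}"
      using N(1) seq_suble[OF \<sigma>(1)] by (auto simp: less_Suc_eq_le intro!: less_le_trans[OF _ seq_suble[OF \<sigma>(1)]])
    then have "x \<in> F (Suc (Max (insert 0 N)))"
      using T(3) span_mono[of T "B (Suc (Max (insert 0 N)))"] unfolding N(2) F_def B_def by (meson image_mono subsetD)
    then show "x \<in> (\<Union>n. F n)" by blast
  qed
  have dense: "closure (\<Union>n. F n) = UNIV" using \<beta> by (simp add: un fundamental_def)
  define \<Lambda> where "\<Lambda> = (5 * L + 19) / (1 - \<epsilon>)"
  have "\<exists>S :: 'z \<Rightarrow>\<^sub>L 'z. norm S \<le> \<Lambda> \<and> (\<forall>x. adjoint_map S x \<in> F n) \<and> (\<forall>x\<in>F n. adjoint_map S x = x)" for n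
  proof -
    define m where "m = \<sigma> n"
    define q where "q = 1 / (2 * real m ^ 2 * ((1 + 2 / \<epsilon>) ^ m + 2))"
    obtain x0 r \<eta> where x0: "x0 \<in> Espan \<beta> m" "r > 0" "cball x0 r \<inter> Espan \<beta> m \<subseteq> K" and \<eta>: "\<eta> > 0" "\<eta> \<le> 2 * q"
      "\<And>y. y \<in> K \<Longrightarrow> \<exists>a\<in>Espan \<beta> m. norm (y - a) \<le> \<eta> * r"
      by (rule small_radius_height[of \<beta> K m q]) (use ratio[of n] in \<open>auto simp: m_def q_def\<close>)
    have E: "Espan \<beta> m = span (B n)" "subspace (Espan \<beta> m)" by (simp_all add: m_def Espan_def B_def)
    \<comment> \<open>Blowing up around \<open>x0\<close> turns the inscribed ball into the unit
      ball and the distance \<open>\<eta> * r\<close> into \<eta>, while the Lipschitz constant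
      stays \<open>L\<close>. The bound \<Lambda> is therefore the same for all
      \<open>n\<close>.\<close>
    define f where "f = (\<lambda>x. (1 / r) *\<^sub>R (R (x0 + r *\<^sub>R x) - x0))"
    have RK: "R x \<in> K" for x using R(2) by auto
    have f1: "norm (f x - f y) \<le> L * norm (x - y)" for x y
    proof -
      have "f x - f y = (1 / r) *\<^sub>R (R (x0 + r *\<^sub>R x) - R (x0 + r *\<^sub>R y))"
        by (simp add: f_def scaleR_diff_right)
      also have "norm \<dots> = norm (R (x0 + r *\<^sub>R x) - R (x0 + r *\<^sub>R y)) / r" using x0(2) by simp
      also have "\<dots> \<le> (L * norm ((x0 + r *\<^sub>R x) - (x0 + r *\<^sub>R y))) / r"
        using lipschitz_onD[OF R(1), of "x0 + r *\<^sub>R x" "x0 + r *\<^sub>R y"] x0(2)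
        by (intro divide_right_mono) (auto simp: dist_norm)
      also have "(x0 + r *\<^sub>R x) - (x0 + r *\<^sub>R y) = r *\<^sub>R (x - y)" by (simp add: scaleR_diff_right)
      finally show ?thesis using x0(2) by simp
    qed
    have f2: "f x = x" if x: "x \<in> span (B n)" "norm x \<le> 1" for x
    proof -
      have "x0 + r *\<^sub>R x \<in> Espan \<beta> m" using x(1) x0(1) E by (auto intro: subspace_add subspace_scale)
      moreover have "x0 + r *\<^sub>R x \<in> cball x0 r" using x(2) x0(2) by (simp add: dist_norm mult_left_le)
      ultimately have "x0 + r *\<^sub>R x \<in> K" using x0(3) by blast
      then show ?thesis using R(3) x0(2) by (simp add: f_def)
    qed
    have near: "\<exists>a\<in>span (B n). norm (f x - a) \<le> \<eta>" for x
    proof -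
      obtain a where a: "a \<in> Espan \<beta> m" "norm (R (x0 + r *\<^sub>R x) - a) \<le> \<eta> * r" using \<eta>(3)[OF RK] by blast
      have "f x - (1 / r) *\<^sub>R (a - x0) = (1 / r) *\<^sub>R (R (x0 + r *\<^sub>R x) - a)"
        by (simp add: f_def scaleR_diff_right)
      then have "norm (f x - (1 / r) *\<^sub>R (a - x0)) = norm (R (x0 + r *\<^sub>R x) - a) / r" using x0(2) by simp
      also have "\<dots> \<le> \<eta>" using a(2) x0(2) by (simp add: pos_divide_le_eq)
      finally have "norm (f x - (1 / r) *\<^sub>R (a - x0)) \<le> \<eta>" .
      moreover have "(1 / r) *\<^sub>R (a - x0) \<in> span (B n)"
        using a(1) x0(1) E by (metis subspace_diff subspace_scale)
      ultimately show ?thesis by blast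
    qed
    have bound: "norm (f x) \<le> (b + norm x0) / r" for x
    proof -
      have "norm (R (x0 + r *\<^sub>R x) - x0) \<le> b + norm x0"
        using norm_triangle_ineq4[of "R (x0 + r *\<^sub>R x)" x0] b[OF RK[of "x0 + r *\<^sub>R x"]] by simp
      then show ?thesis using x0(2) by (simp add: f_def divide_right_mono)
    qed
    \<comment> \<open>Here \<open>2 * q\<close> equals \<open>1 / (m^2 * (X + 2))\<close>, so the
      factor \<open>m^2\<close> cancels and \<open>X / (X + 2)\<close> remains.\<close>
    have gap: "\<eta> * (real m ^ 2 * (1 + 2 / \<epsilon>) ^ m) \<le> 1"
    proof -
      define X where "X = (1 + 2 / \<epsilon>) ^ m"
      have X: "X > 0" using \<epsilon> by (simp add: X_def add_pos_pos)
      have m: "real m > 0" using \<sigma>(2)[of n] by (simp add: m_def)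
      have "\<eta> * (real m ^ 2 * X) \<le> 2 * q * (real m ^ 2 * X)" using \<eta>(2) X by (intro mult_right_mono) auto
      also have "\<dots> = X / (X + 2)" using m X by (simp add: q_def X_def[symmetric])
      also have "\<dots> \<le> 1" using X by simp
      finally show ?thesis by (simp add: X_def)
    qed
    obtain S :: "'z \<Rightarrow>\<^sub>L 'z" where S: "norm S \<le> \<Lambda>"
      "\<And>x. \<exists>a\<in>span (B n). J x o\<^sub>L S = J a" "\<And>x. x \<in> span (B n) \<Longrightarrow> J x o\<^sub>L S = J x"
      unfolding \<Lambda>_def
      by (rule local_retraction_projection[OF finB cardB[of n, folded m_def] f1 f2 near bound \<epsilon> L \<eta>(1) gap]) (blast+)
    then show ?thesis unfolding F_def by (metis adjoint_map_eqI)
  qed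
  then obtain S :: "nat \<Rightarrow> 'z \<Rightarrow>\<^sub>L 'z" where S: "\<And>n. norm (S n) \<le> \<Lambda>" "\<And>n x. adjoint_map (S n) x \<in> F n"
    "\<And>n x. x \<in> F n \<Longrightarrow> adjoint_map (S n) x = x" by metis
  interpret weak_star_projections J F S \<Lambda>
  proof unfold_locales
    show "\<exists>B. finite B \<and> F n = span B" for n using finB by (auto simp: F_def)
    show "\<exists>m>n. F m \<noteq> F n" for n
    proof (rule ccontr)
      assume "\<not> ?thesis"
      then have eq: "F m = F n" if "m > n" for m using that by blast
      have "F m \<subseteq> F n" for m using eq[of m] mono by (cases "m > n") (auto simp: incseq_def)
      then have "(\<Union>n. F n) = F n" by blast
      \<comment> \<open>If the subspaces became stationary, the last one would be closed and dense,
        hence everything; positive height provides a point of \<open>K\<close> outside it.\<close>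
      then have "F n = UNIV" using dense closed_span_finite[OF finB[of n]] by (simp add: F_def closure_closed)
      moreover obtain y where "y \<in> K" "y \<notin> Espan \<beta> (\<sigma> n)"
        by (rule small_radius_height[OF ratio(1,2)[of n]]) blast
      ultimately show False by (simp add: FE)
    qed
  qed (use mono dense S in auto)
  show ?thesis by (rule exists_FDD)
qed

section \<open>Boundedness of the projections of an FDD\<close>

locale finite_dim_decomposition =
  fixes V :: "nat \<Rightarrow> 'a::banach set"
  assumes FDD: "FDD V"
begin

lemma V_subspace: "subspace (V n)" and V_span: "\<exists>B. finite B \<and> span B = V n" and V_nonzero: "V n \<noteq> {0}"
  using FDD by (simp_all add: FDD_def)

lemma V_closed: "closed (V n)"
  using V_span[of n] closed_span_finite by metis

definition coord :: "nat \<Rightarrow> 'a \<Rightarrow> 'a" where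
  "coord n x = (THE y. (\<forall>n. y n \<in> V n) \<and> y sums x) n"

lemma coord_props: "(\<forall>n. coord n x \<in> V n) \<and> (\<lambda>n. coord n x) sums x"
proof -
  have "\<exists>!y. (\<forall>n. y n \<in> V n) \<and> y sums x" using FDD by (simp add: FDD_def)
  then have "(\<forall>n. (THE y. (\<forall>n. y n \<in> V n) \<and> y sums x) n \<in> V n) \<and> (THE y. (\<forall>n. y n \<in> V n) \<and> y sums x) sums x"
    by (rule theI')
  then show ?thesis by (simp add: coord_def[abs_def])
qed

lemma coord_in: "coord n x \<in> V n" and coord_sums: "(\<lambda>n. coord n x) sums x"
  using coord_props by auto

lemma coord_unique:
  assumes "\<And>n. y n \<in> V n" "y sums x"
  shows "coord n x = y n"
proof -
  have "\<exists>!y. (\<forall>n. y n \<in> V n) \<and> y sums x" using FDD by (simp add: FDD_def)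
  then obtain u where u: "\<And>y. (\<forall>n. y n \<in> V n) \<and> y sums x \<Longrightarrow> y = u" by (elim ex1E) blast
  have "(\<lambda>n. coord n x) = y" using u[OF coord_props] u[of y] assms by simp
  then show ?thesis by (rule fun_cong)
qed

lemma coord_linear: "linear (coord n)"
proof (rule linearI)
  show "coord n (x + y) = coord n x + coord n y" for x y
    by (rule coord_unique) (auto intro: subspace_add V_subspace coord_in sums_add coord_sums)
  show "coord n (c *\<^sub>R x) = c *\<^sub>R coord n x" for c x
    by (rule coord_unique) (auto intro: subspace_scale V_subspace coord_in sums_scaleR_right coord_sums)
qed

lemma coord_of_V:
  assumes "v \<in> V i"
  shows "coord n v = (if n = i then v else 0)"
proof (rule coord_unique)
  show "(if n = i then v else 0) \<in> V n" for n using assms subspace_0[OF V_subspace] by auto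
  show "(\<lambda>n. if n = i then v else 0) sums v" using sums_single[of i "\<lambda>_. v"] by simp
qed

definition proj :: "nat \<Rightarrow> 'a \<Rightarrow> 'a" where
  "proj n x = (\<Sum>i<n. coord i x)"

lemma proj_linear: "linear (proj n)"
  unfolding proj_def[abs_def] by (rule linear_compose_sum) (simp add: coord_linear)

lemma proj_tendsto: "(\<lambda>n. proj n x) \<longlonglongrightarrow> x"
  using coord_sums[of x] by (simp add: sums_def proj_def)

lemma coord_proj: "coord i x = proj (Suc i) x - proj i x"
  by (simp add: proj_def)

lemma expansion_bounded:
  obtains k :: nat where "\<And>n. norm (proj n x) \<le> k"
proof -
  have "Bseq (\<lambda>n. proj n x)" using proj_tendsto by (rule convergentI[THEN convergent_imp_Bseq])
  then obtain c where "\<And>n. norm (proj n x) \<le> c" by (auto simp: Bseq_def)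
  then show ?thesis using that[of "nat \<lceil>c\<rceil>"] real_nat_ceiling_ge[of c] by (meson order_trans)
qed

text \<open>The successive approximation argument of the open mapping theorem, applied to the complete
  norm \<open>x \<mapsto> sup\<^sub>n norm (proj n x)\<close>.\<close>

lemma proj_bound_by_approximation:
  assumes \<kappa>: "\<kappa> \<ge> 0" and r: "r > 0"
    and approx: "\<And>z \<delta>. norm z < r \<Longrightarrow> \<delta> > 0 \<Longrightarrow> \<exists>a. (\<forall>n. norm (proj n a) \<le> \<kappa>) \<and> norm (z - a) < \<delta>"
    and x: "norm x < r"
  shows "norm (proj n x) \<le> 2 * \<kappa>"
proof -
  define h where "h = (\<lambda>j. (1/2::real) ^ j)"
  have h: "h j > 0" for j by (simp add: h_def)
  have step: "\<exists>a. (\<forall>n. norm (proj n a) \<le> \<kappa> * h j) \<and> norm (z - a) < r * h (Suc j)" if z: "norm z < r * h j" for z j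
  proof -
    have "norm ((1 / h j) *\<^sub>R z) < r" using z h[of j] by (simp add: divide_less_eq)
    then obtain a where a: "\<And>n. norm (proj n a) \<le> \<kappa>" "norm ((1 / h j) *\<^sub>R z - a) < r / 2"
      using approx[of "(1 / h j) *\<^sub>R z" "r / 2"] r by auto
    have "norm (z - h j *\<^sub>R a) = h j * norm ((1 / h j) *\<^sub>R z - a)"
    proof -
      have "z - h j *\<^sub>R a = h j *\<^sub>R ((1 / h j) *\<^sub>R z - a)" using h[of j] by (simp add: scaleR_diff_right)
      then show ?thesis using h[of j] by simp
    qed
    also have "\<dots> < h j * (r / 2)" using a(2) h[of j] by simp
    finally have "norm (z - h j *\<^sub>R a) < r * h (Suc j)" by (simp add: h_def mult.commute)
    moreover have "norm (proj n (h j *\<^sub>R a)) \<le> \<kappa> * h j" for n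
      using a(1)[of n] h[of j] by (simp add: linear_cmul[OF proj_linear] mult.commute mult_left_mono)
    ultimately show ?thesis by blast
  qed
  define g where "g = (\<lambda>j z. SOME a. (\<forall>n. norm (proj n a) \<le> \<kappa> * h j) \<and> norm (z - a) < r * h (Suc j))"
  have g: "norm (proj n (g j z)) \<le> \<kappa> * h j" "norm (z - g j z) < r * h (Suc j)" if "norm z < r * h j" for j z n
    using someI_ex[OF step[OF that]] unfolding g_def by blast+
  define X where "X = rec_nat x (\<lambda>j z. z - g j z)"
  have X0: "X 0 = x" and XS: "X (Suc j) = X j - g j (X j)" for j by (simp_all add: X_def)
  have Xn: "norm (X j) < r * h j" for j
    by (induction j) (use x g(2) in \<open>auto simp: X0 XS h_def\<close>)
  define a where "a = (\<lambda>j. g j (X j))"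
  have an: "norm (proj n (a j)) \<le> \<kappa> * h j" for n j unfolding a_def by (rule g(1)[OF Xn])
  have part: "(\<Sum>j<J. a j) = x - X J" for J
    by (induction J) (auto simp: X0 XS a_def)
  have sumh: "summable (\<lambda>j. \<kappa> * h j)" by (auto simp: h_def intro!: summable_mult summable_geometric)
  have tailh: "(\<Sum>j. \<kappa> * h (j + J)) = 2 * \<kappa> * h J" for J
  proof -
    have "(\<Sum>j. \<kappa> * h (j + J)) = (\<Sum>j. (\<kappa> * h J) * (1/2) ^ j)"
      by (rule suminf_cong) (simp add: h_def power_add)
    also have "\<dots> = (\<kappa> * h J) * (\<Sum>j. (1/2) ^ j)" by (rule suminf_mult) (simp add: summable_geometric)
    also have "\<dots> = 2 * \<kappa> * h J" by (simp add: suminf_geometric)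
    finally show ?thesis .
  qed
  have sum_proj: "summable (\<lambda>j. proj n (a j))" for n
    by (rule summable_comparison_test[OF _ sumh]) (use an in auto)
  have coord_sum: "summable (\<lambda>j. coord i (a j))" for i
    unfolding coord_proj by (intro summable_diff sum_proj)
  \<comment> \<open>The candidate coordinates of \<open>x\<close> are summed blockwise. Continuity
    of \<open>coord\<close> is not yet known, so they cannot be obtained by applying
    \<open>coord\<close> to the series; closedness of the finite dimensional blocks keeps them in
    place.\<close>
  define Y where "Y = (\<lambda>i. \<Sum>j. coord i (a j))"
  define Q where "Q = (\<lambda>n. \<Sum>j. proj n (a j))"
  have YQ: "(\<Sum>i<n. Y i) = Q n" for n
    unfolding Y_def Q_def proj_def using coord_sum by (intro suminf_sum[symmetric])
  have YV: "Y i \<in> V i" for i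
  proof (rule Lim_in_closed_set[OF V_closed])
    show "\<forall>\<^sub>F J in sequentially. (\<Sum>j<J. coord i (a j)) \<in> V i"
      by (intro always_eventually allI subspace_sum[OF V_subspace] coord_in)
    show "(\<lambda>J. \<Sum>j<J. coord i (a j)) \<longlonglongrightarrow> Y i"
      unfolding Y_def using summable_LIMSEQ[OF coord_sum] .
  qed simp
  \<comment> \<open>The bound is uniform in \<open>n\<close>. A finite stage \<open>J\<close> can
    therefore be fixed first, after which \<open>proj n\<close> is applied to a single vector and
    converges.\<close>
  have tail: "norm (Q n - proj n (\<Sum>j<J. a j)) \<le> 2 * \<kappa> * h J" for n J
  proof -
    have "Q n - proj n (\<Sum>j<J. a j) = (\<Sum>j. proj n (a (j + J)))"
      unfolding Q_def linear_sum[OF proj_linear] using suminf_minus_initial_segment[OF sum_proj] by simp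
    also have "norm \<dots> \<le> (\<Sum>j. \<kappa> * h (j + J))"
    proof (rule norm_suminf_le)
      show "norm (proj n (a (j + J))) \<le> \<kappa> * h (j + J)" for j by (rule an)
      show "summable (\<lambda>j. \<kappa> * h (j + J))" using sumh by (rule summable_ignore_initial_segment)
    qed
    finally show ?thesis by (simp add: tailh)
  qed
  have Qlim: "Q \<longlonglongrightarrow> x"
  proof (rule LIMSEQ_I)
    fix e :: real assume e: "e > 0"
    have "(\<lambda>J. 2 * \<kappa> * h J + r * h J) \<longlonglongrightarrow> 2 * \<kappa> * 0 + r * 0"
      unfolding h_def by (intro tendsto_intros LIMSEQ_power_zero) auto
    then have "\<forall>\<^sub>F J in sequentially. 2 * \<kappa> * h J + r * h J < e / 2"
      by (rule order_tendstoD(2)) (use e in simp)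
    then obtain J where J: "2 * \<kappa> * h J + r * h J < e / 2" by (auto simp: eventually_sequentially)
    obtain n0 where n0: "\<And>n. n \<ge> n0 \<Longrightarrow> norm (proj n (\<Sum>j<J. a j) - (\<Sum>j<J. a j)) < e / 2"
      using LIMSEQ_D[OF proj_tendsto, of "e / 2"] e by (metis half_gt_zero)
    have "norm (Q n - x) < e" if "n \<ge> n0" for n
    proof -
      have "Q n - x = (Q n - proj n (\<Sum>j<J. a j)) + (proj n (\<Sum>j<J. a j) - (\<Sum>j<J. a j)) - X J"
        by (simp add: part)
      also have "norm \<dots> \<le> norm (Q n - proj n (\<Sum>j<J. a j)) + norm (proj n (\<Sum>j<J. a j) - (\<Sum>j<J. a j)) + norm (X J)"
        by (rule order_trans[OF norm_triangle_ineq4 add_right_mono[OF norm_triangle_ineq]])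
      finally show ?thesis using tail[of n J] n0[OF that] Xn[of J] J by linarith
    qed
    then show "\<exists>n0. \<forall>n\<ge>n0. norm (Q n - x) < e" by blast
  qed
  \<comment> \<open>Uniqueness of the expansion identifies the constructed coordinates with the
    given ones.\<close>
  have "coord i x = Y i" for i
    by (rule coord_unique[OF YV]) (use Qlim in \<open>simp add: sums_def YQ\<close>)
  then have "proj n x = Q n" by (simp add: proj_def YQ[symmetric])
  then show ?thesis using tail[of n 0] linear_0[OF proj_linear] by (simp add: h_def)
qed

text \<open>The sets \<open>A k\<close> of vectors with partial sums bounded by \<open>k\<close>
  cover the space, but are not known to be closed, as \<open>proj n\<close> is not known to be
  continuous. Baire's theorem only yields a ball in the closure of some \<open>A k\<close>;
  differences of elements approximate small vectors with bound \<open>2 * k\<close>, and successive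
  approximation turns this into a true bound.\<close>

lemma proj_uniformly_bounded:
  obtains C where "C \<ge> 1" "\<And>n x. norm (proj n x) \<le> C * norm x"
proof -
  define A where "A = (\<lambda>k::nat. {x. \<forall>n. norm (proj n x) \<le> k})"
  have cover: "(\<Union>k. A k) = UNIV"
  proof -
    have "\<exists>k. x \<in> A k" for x using expansion_bounded[of x] unfolding A_def by blast
    then show ?thesis by blast
  qed
  have "\<exists>k. interior (closure (A k)) \<noteq> {}"
  proof (rule ccontr)
    assume "\<not> ?thesis"
    then have emp: "interior (closure (A k)) = {}" for k by blast
    have "(euclidean :: 'a topology) closure_of \<Inter> (range (\<lambda>k. - closure (A k))) = topspace euclidean"
    proof (rule Baire_category)
      have "completely_metrizable_space (Met_TC.mtopology :: 'a topology)"
        by (rule Met_TC.completely_metrizable_space_mtopology)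
          (auto simp: Met_TC.mcomplete_def intro: Cauchy_convergent simp: convergent_def[symmetric])
      then show "completely_metrizable_space (euclidean :: 'a topology) \<or> locally_compact_space (euclidean :: 'a topology) \<and> regular_space (euclidean :: 'a topology)"
        by simp
      fix T assume "T \<in> range (\<lambda>k. - closure (A k))"
      then show "openin euclidean T \<and> euclidean closure_of T = topspace euclidean"
        using emp by (auto simp: closure_complement open_Compl)
    qed auto
    moreover have "\<Inter> (range (\<lambda>k. - closure (A k))) = {}" using cover closure_subset by blast
    ultimately show False by simp
  qed
  then obtain k x0 where "x0 \<in> interior (closure (A k))" by blast
  then obtain r where r: "r > 0" "ball x0 r \<subseteq> closure (A k)"
    by (meson interior_subset open_contains_ball open_interior subset_trans)
  have bound: "norm (proj n x) \<le> 2 * (2 * real k)" if "norm x < r" for n x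
  proof (rule proj_bound_by_approximation[OF _ r(1) _ that])
    fix z :: 'a and \<delta> :: real assume z: "norm z < r" "\<delta> > 0"
    have "x0 + z \<in> closure (A k)" "x0 \<in> closure (A k)" using r z by (auto simp: subset_iff dist_norm)
    then obtain a b where ab: "a \<in> A k" "b \<in> A k" "dist a (x0 + z) < \<delta> / 2" "dist b x0 < \<delta> / 2"
      using z(2) unfolding closure_approachable by (metis half_gt_zero)
    have "norm (proj n (a - b)) \<le> 2 * real k" for n
      using ab(1,2) norm_triangle_ineq4[of "proj n a" "proj n b"]
      by (auto simp: A_def linear_diff[OF proj_linear] intro: order_trans[OF norm_triangle_ineq4] add_mono
          dest!: spec[of _ n])
    moreover have "norm (z - (a - b)) < \<delta>"
    proof -
      have "z - (a - b) = (b - x0) - (a - (x0 + z))" by simp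
      then have "norm (z - (a - b)) \<le> norm (b - x0) + norm (a - (x0 + z))" by (metis norm_triangle_ineq4)
      then show ?thesis using ab(3,4) by (simp add: dist_norm)
    qed
    ultimately show "\<exists>a. (\<forall>n. norm (proj n a) \<le> 2 * real k) \<and> norm (z - a) < \<delta>" by blast
  qed simp
  \<comment> \<open>One factor 2 is due to differences, one to the geometric series, and one to
    scaling \<open>x\<close> to norm \<open>r / 2\<close>.\<close>
  define C where "C = max 1 (2 * (2 * (2 * real k)) / r)"
  show ?thesis
  proof (rule that[of C])
    show "C \<ge> 1" by (simp add: C_def)
    fix n x
    show "norm (proj n x) \<le> C * norm x"
    proof (cases "x = 0")
      case True
      then show ?thesis by (simp add: linear_0[OF proj_linear])
    next
      case False
      have "norm (proj n ((r / (2 * norm x)) *\<^sub>R x)) \<le> 2 * (2 * real k)"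
        using False r(1) by (intro bound) simp
      then have "r / (2 * norm x) * norm (proj n x) \<le> 2 * (2 * real k)"
        using r(1) by (simp add: linear_cmul[OF proj_linear])
      then have "norm (proj n x) \<le> 2 * (2 * (2 * real k)) / r * norm x"
        using False r(1) by (simp add: field_simps)
      also have "\<dots> \<le> C * norm x" by (intro mult_right_mono) (auto simp: C_def)
      finally show ?thesis .
    qed
  qed
qed

end

section \<open>Radial truncation in a normed space\<close>

definition truncate_norm :: "real \<Rightarrow> 'a::real_normed_vector \<Rightarrow> 'a" where
  "truncate_norm r v = (if norm v \<le> r then v else (r / norm v) *\<^sub>R v)"

lemma norm_truncate: "0 \<le> r \<Longrightarrow> norm (truncate_norm r v) \<le> r"
  by (auto simp: truncate_norm_def)

lemma truncate_norm_subspace: "subspace S \<Longrightarrow> v \<in> S \<Longrightarrow> truncate_norm r v \<in> S"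
  by (simp add: truncate_norm_def subspace_scale)

lemma truncate_diff_mixed:
  fixes v w :: "'a::real_normed_vector"
  assumes "norm v \<le> r" "\<not> norm w \<le> s" "0 \<le> s"
  shows "norm (truncate_norm r v - truncate_norm s w) \<le> 2 * norm (v - w) + \<bar>r - s\<bar>"
proof -
  have w: "norm w > 0" using assms by linarith
  have "w - (s / norm w) *\<^sub>R w = (1 - s / norm w) *\<^sub>R w" by (simp add: scaleR_diff_left)
  then have "norm (w - (s / norm w) *\<^sub>R w) = \<bar>1 - s / norm w\<bar> * norm w" by simp
  also have "\<dots> = norm w - s" using w assms by (simp add: field_simps abs_if)
  also have "\<dots> \<le> norm (v - w) + \<bar>r - s\<bar>"
    using assms(1) norm_triangle_ineq2[of w v] by (simp add: norm_minus_commute)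
  finally have "norm (w - truncate_norm s w) \<le> norm (v - w) + \<bar>r - s\<bar>"
    using assms(2) by (simp add: truncate_norm_def)
  moreover have "norm (v - truncate_norm s w) \<le> norm (v - w) + norm (w - truncate_norm s w)"
    using norm_triangle_ineq[of "v - w" "w - truncate_norm s w"] by simp
  ultimately show ?thesis using assms(1) by (simp add: truncate_norm_def)
qed

text \<open>In a general normed space the radial retraction onto a ball is Lipschitz with constant
  2, because normalising two vectors costs the difference of their norms besides their distance.
  Changing the radius costs at most \<open>\<bar>r - s\<bar>\<close> more.\<close>

lemma truncate_diff:
  fixes v w :: "'a::real_normed_vector"
  assumes "0 \<le> r" "0 \<le> s"
  shows "norm (truncate_norm r v - truncate_norm s w) \<le> 2 * norm (v - w) + \<bar>r - s\<bar>"
proof (cases "norm v \<le> r"; cases "norm w \<le> s")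
  assume "norm v \<le> r" "norm w \<le> s"
  then show ?thesis by (simp add: truncate_norm_def)
next
  assume "norm v \<le> r" "\<not> norm w \<le> s"
  then show ?thesis using truncate_diff_mixed assms by blast
next
  assume "\<not> norm v \<le> r" "norm w \<le> s"
  then show ?thesis using truncate_diff_mixed[of w s v r] assms by (simp add: norm_minus_commute abs_minus_commute)
next
  assume out: "\<not> norm v \<le> r" "\<not> norm w \<le> s"
  then have pos: "norm v > 0" "norm w > 0" using assms by linarith+
  define p where "p = (1 / norm v) *\<^sub>R v"
  define q where "q = (1 / norm w) *\<^sub>R w"
  have q: "norm q = 1" using pos by (simp add: q_def)
  have vp: "norm v *\<^sub>R p = v" and wq: "norm w *\<^sub>R q = w" using pos by (simp_all add: p_def q_def)
  have "norm v * norm (p - q) = norm (norm v *\<^sub>R (p - q))" by simp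
  also have "norm v *\<^sub>R (p - q) = (v - w) + (norm w - norm v) *\<^sub>R q"
    by (simp add: scaleR_diff_right scaleR_diff_left vp wq)
  also have "norm \<dots> \<le> norm (v - w) + \<bar>norm w - norm v\<bar>"
    using norm_triangle_ineq[of "v - w" "(norm w - norm v) *\<^sub>R q"] q by simp
  also have "\<bar>norm w - norm v\<bar> \<le> norm (v - w)" by (metis norm_minus_commute norm_triangle_ineq3)
  finally have "norm v * norm (p - q) \<le> 2 * norm (v - w)" by simp
  moreover have "r * norm (p - q) \<le> norm v * norm (p - q)" using out by (intro mult_right_mono) auto
  ultimately have a: "r * norm (p - q) \<le> 2 * norm (v - w)" by linarith
  have "truncate_norm r v = r *\<^sub>R p" "truncate_norm s w = s *\<^sub>R q"
    using out by (simp_all add: truncate_norm_def p_def q_def)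
  then have "truncate_norm r v - truncate_norm s w = r *\<^sub>R (p - q) + (r - s) *\<^sub>R q"
    by (simp add: scaleR_diff_right scaleR_diff_left)
  also have "norm \<dots> \<le> norm (r *\<^sub>R (p - q)) + norm ((r - s) *\<^sub>R q)" by (rule norm_triangle_ineq)
  also have "\<dots> = r * norm (p - q) + \<bar>r - s\<bar>" using assms q by simp
  finally show ?thesis using a by linarith
qed

section \<open>A small compact convex retract from an FDD\<close>

text \<open>Halving of the weights suffices for the retraction; the faster decay that makes the body
  small is imposed when the locale is instantiated.\<close>

locale weighted_decomposition = finite_dim_decomposition V
  for V :: "nat \<Rightarrow> 'a::banach set" +
  fixes C :: real and a :: "nat \<Rightarrow> real"
  assumes C_ge: "C \<ge> 1" and proj_bound: "norm (proj n x) \<le> C * norm x"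
    and a_0: "a 0 = 1" and a_pos: "a n > 0" and a_half: "a (Suc n) \<le> a n / 2"
begin

lemma coord_bound: "norm (coord n x) \<le> 2 * C * norm x"
  using norm_triangle_ineq4[of "proj (Suc n) x" "proj n x"] proj_bound[of "Suc n" x] proj_bound[of n x]
  by (simp add: coord_proj)

lemma coord_bounded_linear: "bounded_linear (coord n)"
  using coord_bound[of n] coord_linear[of n]
  by (intro bounded_linear_intro[where K = "2 * C"]) (auto simp: linear_add linear_cmul mult.commute)

lemma coord_diff: "coord n (x - y) = coord n x - coord n y"
  by (rule linear_diff[OF coord_linear])

lemma a_le: "m \<le> n \<Longrightarrow> a n \<le> a m"
proof (induction n rule: dec_induct)
  case (step n)
  then show ?case using a_half[of n] a_pos[of n] by linarith
qed simp

text \<open>Halving keeps the sum of the reciprocals comparable to its next term. Multiplied by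
  \<open>a n\<close>, the accumulated weight \<open>weight n\<close> thus becomes Lipschitz with
  constant \<open>2 * C\<close>, independently of \<open>n\<close>.\<close>

lemma a_sum: "a n * (\<Sum>i<n. 1 / a i) \<le> 1"
proof (induction n)
  case (Suc n)
  have s0: "0 \<le> (\<Sum>i<n. 1 / a i)" using a_pos by (intro sum_nonneg) (simp add: less_imp_le)
  have "a (Suc n) * (\<Sum>i<Suc n. 1 / a i) \<le> (a n / 2) * ((\<Sum>i<n. 1 / a i) + 1 / a n)"
    unfolding sum.lessThan_Suc using a_half s0 a_pos[of n] by (intro mult_right_mono add_nonneg_nonneg) auto
  also have "\<dots> = (a n * (\<Sum>i<n. 1 / a i) + 1) / 2" using a_pos[of n] by (simp add: field_simps)
  also have "\<dots> \<le> (1 + 1) / 2" using Suc.IH by (intro divide_right_mono add_right_mono) auto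
  finally show ?case by simp
qed simp

lemma a_tendsto_0: "a \<longlonglongrightarrow> 0"
proof (rule tendsto_sandwich[of "\<lambda>_. 0" _ _ "\<lambda>n. (1/2) ^ n"])
  have "a n \<le> (1/2) ^ n" for n
  proof (induction n)
    case (Suc n)
    then show ?case using a_half[of n] by simp
  qed (simp add: a_0)
  then show "\<forall>\<^sub>F n in sequentially. a n \<le> (1/2) ^ n" by simp
qed (use a_pos in \<open>auto simp: less_imp_le intro: LIMSEQ_power_zero\<close>)

definition weight :: "nat \<Rightarrow> 'a \<Rightarrow> real" where
  "weight n x = (\<Sum>i<n. norm (coord i x) / a i)"

text \<open>Bounding all partial sums expresses that the full weight is at most 1 without mentioning
  summability, and presents the set as an intersection of sublevel sets of continuous
  functions.\<close>

definition body :: "'a set" where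
  "body = {x. \<forall>n. weight n x \<le> 1}"

lemma weight_Suc: "weight (Suc n) x = weight n x + norm (coord n x) / a n"
  by (simp add: weight_def)

lemma weight_mono: "m \<le> n \<Longrightarrow> weight m x \<le> weight n x"
  unfolding weight_def using a_pos by (intro sum_mono2) (auto simp: less_imp_le)

lemma weight_cong: "(\<And>i. i < n \<Longrightarrow> coord i x = coord i y) \<Longrightarrow> weight n x = weight n y"
  by (simp add: weight_def)

lemma weight_diff: "\<bar>weight n x - weight n y\<bar> \<le> (\<Sum>i<n. 1 / a i) * (2 * C * norm (x - y))"
proof -
  have "\<bar>weight n x - weight n y\<bar> \<le> (\<Sum>i<n. \<bar>norm (coord i x) / a i - norm (coord i y) / a i\<bar>)"
    unfolding weight_def sum_subtractf[symmetric] by (rule sum_abs)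
  also have "\<dots> \<le> (\<Sum>i<n. 1 / a i * (2 * C * norm (x - y)))"
  proof (rule sum_mono)
    fix i
    have "\<bar>norm (coord i x) - norm (coord i y)\<bar> \<le> 2 * C * norm (x - y)"
      using norm_triangle_ineq3[of "coord i x" "coord i y"] coord_bound[of i "x - y"] by (simp add: coord_diff)
    then show "\<bar>norm (coord i x) / a i - norm (coord i y) / a i\<bar> \<le> 1 / a i * (2 * C * norm (x - y))"
      using a_pos[of i] by (simp add: diff_divide_distrib[symmetric] abs_divide divide_right_mono)
  qed
  finally show ?thesis by (simp add: sum_distrib_right)
qed

lemma a_weight_diff: "a n * \<bar>weight n x - weight n y\<bar> \<le> 2 * C * norm (x - y)"
proof -
  have "a n * \<bar>weight n x - weight n y\<bar> \<le> a n * ((\<Sum>i<n. 1 / a i) * (2 * C * norm (x - y)))"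
    using weight_diff a_pos[of n] by (intro mult_left_mono) auto
  also have "\<dots> \<le> 1 * (2 * C * norm (x - y))"
    unfolding mult.assoc[symmetric, of "a n"] using a_sum C_ge by (intro mult_right_mono) auto
  finally show ?thesis by simp
qed

lemma body_tail:
  assumes "x \<in> body"
  shows "norm (x - proj n x) \<le> a n * (1 - weight n x)"
proof -
  have le: "norm (proj m x - proj n x) \<le> a n * (1 - weight n x)" if "n \<le> m" for m
  proof -
    have "norm (proj m x - proj n x) \<le> a n * (weight m x - weight n x)"
      using that
    proof (induction m rule: dec_induct)
      case (step m)
      have "a m * (norm (coord m x) / a m) \<le> a n * (norm (coord m x) / a m)"
        using a_le[OF step(1)] a_pos[of m] by (intro mult_right_mono) auto
      then have "norm (coord m x) \<le> a n * (norm (coord m x) / a m)" using a_pos[of m] by simp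
      moreover have "norm (proj (Suc m) x - proj n x) \<le> norm (proj m x - proj n x) + norm (coord m x)"
        using norm_triangle_ineq[of "proj m x - proj n x" "coord m x"] by (simp add: proj_def algebra_simps)
      ultimately show ?case using step.IH by (simp add: weight_Suc algebra_simps)
    qed simp
    also have "\<dots> \<le> a n * (1 - weight n x)"
      using assms a_pos[of n] by (intro mult_left_mono) (auto simp: body_def)
    finally show ?thesis .
  qed
  have "(\<lambda>m. norm (proj m x - proj n x)) \<longlonglongrightarrow> norm (x - proj n x)"
    by (intro tendsto_intros proj_tendsto)
  then show ?thesis
    by (rule tendsto_upperbound) (use le in \<open>auto simp: eventually_sequentially\<close>)
qed

lemma weight_nonneg: "0 \<le> weight n x"
  unfolding weight_def using a_pos by (intro sum_nonneg) (simp add: less_imp_le)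

lemma body_tail_le:
  assumes "x \<in> body"
  shows "norm (x - proj n x) \<le> a n"
proof -
  have "a n * (1 - weight n x) \<le> a n * 1"
    using weight_nonneg[of n x] a_pos[of n] by (intro mult_left_mono) auto
  then show ?thesis using body_tail[OF assms, of n] by linarith
qed

lemma body_norm_le: "x \<in> body \<Longrightarrow> norm x \<le> 1"
  using body_tail_le[of x 0] by (simp add: proj_def a_0)

lemma weight_V:
  assumes "v \<in> V i"
  shows "weight n v = (if i < n then norm v / a i else 0)"
proof -
  have "weight n v = (\<Sum>j<n. if j = i then norm v / a i else 0)"
    unfolding weight_def by (intro sum.cong) (auto simp: coord_of_V[OF assms])
  then show ?thesis by simp
qed

lemma body_V: "v \<in> V i \<Longrightarrow> norm v \<le> a i \<Longrightarrow> v \<in> body"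
  using a_pos[of i] by (auto simp: body_def weight_V)

lemma body_convex: "convex body"
proof (rule convexI)
  fix x y and u v :: real
  assume xy: "x \<in> body" "y \<in> body" and uv: "0 \<le> u" "0 \<le> v" "u + v = 1"
  have "weight n (u *\<^sub>R x + v *\<^sub>R y) \<le> u * weight n x + v * weight n y" for n
    unfolding weight_def sum_distrib_left sum.distrib[symmetric]
  proof (rule sum_mono)
    fix i
    have "norm (coord i (u *\<^sub>R x + v *\<^sub>R y)) \<le> u * norm (coord i x) + v * norm (coord i y)"
      using norm_triangle_ineq[of "u *\<^sub>R coord i x" "v *\<^sub>R coord i y"] uv
      by (simp add: linear_add[OF coord_linear] linear_cmul[OF coord_linear])
    then show "norm (coord i (u *\<^sub>R x + v *\<^sub>R y)) / a i \<le> u * (norm (coord i x) / a i) + v * (norm (coord i y) / a i)"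
      using a_pos[of i] by (simp add: add_divide_distrib[symmetric] divide_right_mono)
  qed
  moreover have "u * weight n x + v * weight n y \<le> u * 1 + v * 1" for n
    using xy uv by (intro add_mono mult_left_mono) (auto simp: body_def)
  ultimately show "u *\<^sub>R x + v *\<^sub>R y \<in> body"
    using uv(3) unfolding body_def by (auto intro: order_trans)
qed

lemma body_closed: "closed body"
proof -
  have "body = (\<Inter>n. {x. weight n x \<le> 1})" by (auto simp: body_def)
  moreover have "closed {x. weight n x \<le> 1}" for n
    unfolding weight_def
    by (intro closed_Collect_le continuous_intros linear_continuous_on coord_bounded_linear)
      (use a_pos in \<open>auto simp: less_imp_neq[symmetric]\<close>)
  ultimately show ?thesis by auto
qed

section \<open>Finite dimensional sections and compactness of the body\<close>

definition partial_space :: "nat \<Rightarrow> 'a set" where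
  "partial_space n = range (proj n)"

lemma proj_coord: "proj n x = x \<longleftrightarrow> (\<forall>i\<ge>n. coord i x = 0)"
proof
  assume eq: "proj n x = x"
  show "\<forall>i\<ge>n. coord i x = 0"
  proof (intro allI impI)
    fix i assume i: "i \<ge> n"
    have "coord i (proj n x) = (\<Sum>j<n. coord i (coord j x))"
      unfolding proj_def by (rule linear_sum[OF coord_linear])
    also have "\<dots> = 0" using i by (intro sum.neutral) (auto simp: coord_of_V[OF coord_in])
    finally show "coord i x = 0" using eq by simp
  qed
next
  assume "\<forall>i\<ge>n. coord i x = 0"
  then have "(\<lambda>i. coord i x) sums (\<Sum>i<n. coord i x)" by (intro sums_finite) auto
  then show "proj n x = x" using sums_unique2[OF _ coord_sums] by (simp add: proj_def)
qed

lemma coord_proj_coord: "coord i (proj n x) = (if i < n then coord i x else 0)"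
proof -
  have "coord i (proj n x) = (\<Sum>j<n. coord i (coord j x))"
    unfolding proj_def by (rule linear_sum[OF coord_linear])
  also have "\<dots> = (\<Sum>j<n. if j = i then coord i x else 0)"
    by (intro sum.cong) (auto simp: coord_of_V[OF coord_in])
  finally show ?thesis by simp
qed

lemma partial_space_span:
  assumes B: "\<And>i. span (B i) = V i"
  shows "partial_space n = span (\<Union>i<n. B i)"
proof (intro equalityI subsetI)
  fix x assume "x \<in> partial_space n"
  then obtain y where x: "x = proj n y" by (auto simp: partial_space_def)
  have "coord i y \<in> span (\<Union>i<n. B i)" if "i < n" for i
    using coord_in[of i y] B[of i] span_mono[of "B i" "\<Union>i<n. B i"] that by blast
  then show "x \<in> span (\<Union>i<n. B i)" unfolding x proj_def by (intro span_sum) auto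
next
  fix x assume x: "x \<in> span (\<Union>i<n. B i)"
  have "proj n x = x"
    using x
  proof (rule span_induct[where P = "\<lambda>x. proj n x = x"])
    show "subspace {x. proj n x = x}"
      by (rule subspaceI) (auto simp: linear_0[OF proj_linear] linear_add[OF proj_linear] linear_cmul[OF proj_linear])
    fix b assume "b \<in> (\<Union>i<n. B i)"
    then obtain i where i: "i < n" "b \<in> V i" using B span_base by blast
    show "proj n b = b" unfolding proj_coord using i by (auto simp: coord_of_V[OF i(2)])
  qed
  then show "x \<in> partial_space n" unfolding partial_space_def by (metis rangeI)
qed

lemma partial_space_fixed: "x \<in> partial_space n \<longleftrightarrow> proj n x = x"
proof
  assume "x \<in> partial_space n"
  then obtain y where "x = proj n y" by (auto simp: partial_space_def)
  then show "proj n x = x" unfolding proj_coord by (simp add: coord_proj_coord)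
qed (metis partial_space_def rangeI)

lemma partial_space_finite: "\<exists>B. finite B \<and> partial_space n = span B"
proof -
  obtain B where B: "\<And>i. finite (B i)" "\<And>i. span (B i) = V i" using V_span by metis
  have "partial_space n = span (\<Union>i<n. B i)" using B(2) by (rule partial_space_span)
  then show ?thesis using B(1) by blast
qed

lemma body_compact: "compact body"
  unfolding compact_eq_totally_bounded
proof (intro conjI allI impI)
  show "complete body" using body_closed by (simp add: complete_eq_closed)
  fix e :: real assume e: "e > 0"
  obtain n where n: "a n < e / 2"
    using order_tendstoD(2)[OF a_tendsto_0, of "e / 2"] e by (auto simp: eventually_sequentially)
  obtain B where B: "finite B" "partial_space n = span B" using partial_space_finite by blast
  obtain W where W: "finite W" "\<And>x. x \<in> span B \<Longrightarrow> norm x \<le> C \<Longrightarrow> \<exists>w\<in>W. dist x w < e / 2"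
    using finite_dim_ball_net[OF B(1), of "e / 2" C] e by (metis half_gt_zero)
  have "body \<subseteq> (\<Union>w\<in>W. ball w e)"
  proof
    fix x assume x: "x \<in> body"
    have "C * norm x \<le> C * 1" using body_norm_le[OF x] C_ge by (intro mult_left_mono) auto
    then have "norm (proj n x) \<le> C" using proj_bound[of n x] by linarith
    moreover have "proj n x \<in> span B" unfolding B(2)[symmetric] by (simp add: partial_space_def)
    ultimately obtain w where w: "w \<in> W" "dist (proj n x) w < e / 2" using W(2) by blast
    have "dist x (proj n x) < e / 2" using body_tail_le[OF x, of n] n by (simp add: dist_norm)
    then have "dist w x < e" using w(2) dist_triangle_half_r[of "proj n x" w e x] by (simp add: dist_commute)
    then show "x \<in> (\<Union>w\<in>W. ball w e)" using w(1) by auto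
  qed
  then show "\<exists>k. finite k \<and> body \<subseteq> (\<Union>x\<in>k. ball x e)" using W(1) by blast
qed

lemma closure_span_body: "closure (span body) = UNIV"
proof -
  have V: "v \<in> span body" if v: "v \<in> V i" for v i
  proof (cases "v = 0")
    case False
    have "(a i / norm v) *\<^sub>R v \<in> body"
      using v False a_pos[of i] by (intro body_V[of _ i]) (auto intro: subspace_scale V_subspace)
    then have "(norm v / a i) *\<^sub>R ((a i / norm v) *\<^sub>R v) \<in> span body" by (intro span_scale span_base)
    then show ?thesis using False a_pos[of i] by simp
  qed (simp add: span_zero)
  have "x \<in> closure (span body)" for x
    unfolding closure_sequential
  proof (intro exI conjI allI)
    show "proj n x \<in> span body" for n unfolding proj_def by (intro span_sum V[OF coord_in])
    show "(\<lambda>n. proj n x) \<longlonglongrightarrow> x" by (rule proj_tendsto)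
  qed
  then show ?thesis by blast
qed

text \<open>The retraction keeps the coordinates of \<open>x\<close> as long as the accumulated weight is at most
  \<open>1\<close>, truncates the first coordinate exceeding the available weight, and drops the rest. After the
  truncated coordinate no weight is left, so only one constraint is active at a time; this is why no
  unconditionality of the decomposition is needed.\<close>

definition cut :: "nat \<Rightarrow> 'a \<Rightarrow> 'a" where
  "cut n x = proj n x + truncate_norm (a n * (1 - weight n x)) (coord n x)"

definition exit_index :: "'a \<Rightarrow> nat" where
  "exit_index x = (LEAST n. weight (Suc n) x > 1)"

definition retraction :: "'a \<Rightarrow> 'a" where
  "retraction x = (if x \<in> body then x else cut (exit_index x) x)"

lemma exit_index:
  assumes "x \<notin> body"
  shows "weight (Suc (exit_index x)) x > 1" "m \<le> exit_index x \<Longrightarrow> weight m x \<le> 1"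
proof -
  obtain n where n: "weight n x > 1" using assms by (auto simp: body_def not_le)
  then obtain k where "n = Suc k" by (cases n) (auto simp: weight_def)
  then have ex: "\<exists>n. weight (Suc n) x > 1" using n by blast
  then show "weight (Suc (exit_index x)) x > 1" unfolding exit_index_def by (rule LeastI_ex)
  show "weight m x \<le> 1" if "m \<le> exit_index x"
  proof (cases m)
    case (Suc k)
    then have "k < exit_index x" using that by simp
    then show ?thesis unfolding exit_index_def Suc using not_less_Least by (metis not_le)
  qed (simp add: weight_def)
qed

lemma coord_cut:
  "coord i (cut n x) = (if i < n then coord i x else if i = n then truncate_norm (a n * (1 - weight n x)) (coord n x) else 0)"
  unfolding cut_def linear_add[OF coord_linear] coord_proj_coord
  by (subst coord_of_V[of _ n]) (auto intro: truncate_norm_subspace V_subspace coord_in)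

lemma cut_in_body:
  assumes "weight n x \<le> 1"
  shows "cut n x \<in> body"
proof -
  have low: "weight m (cut n x) \<le> 1" if "m \<le> n" for m
  proof -
    have "weight m (cut n x) = weight m x" by (rule weight_cong) (use that in \<open>simp add: coord_cut\<close>)
    then show ?thesis using weight_mono[OF that, of x] assms by simp
  qed
  have high: "weight (Suc n + k) (cut n x) \<le> 1" for k
  proof (induction k)
    case 0
    have "weight n (cut n x) = weight n x" by (rule weight_cong) (simp add: coord_cut)
    moreover have "norm (truncate_norm (a n * (1 - weight n x)) (coord n x)) \<le> a n * (1 - weight n x)"
      using assms a_pos[of n] by (intro norm_truncate) simp
    ultimately show ?case using a_pos[of n] by (simp add: weight_Suc coord_cut pos_divide_le_eq) (simp add: field_simps)
  next
    case (Suc k)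
    then show ?case by (simp add: weight_Suc coord_cut)
  qed
  have "weight m (cut n x) \<le> 1" for m
  proof (cases "m \<le> n")
    case False
    then have "m = Suc n + (m - Suc n)" by simp
    then show ?thesis using high by metis
  qed (rule low)
  then show ?thesis by (simp add: body_def)
qed

lemma retraction_in_body: "retraction x \<in> body"
  using cut_in_body exit_index(2)[of x "exit_index x"] by (simp add: retraction_def)

text \<open>The constant is composed of \<open>C\<close> for the partial sum,
  \<open>2 * 2 * C\<close> for truncating the coordinate, and \<open>2 * C\<close> for the change of
  the available radius.\<close>

lemma cut_lipschitz:
  assumes "weight n x \<le> 1" "weight n y \<le> 1"
  shows "norm (cut n x - cut n y) \<le> 7 * C * norm (x - y)"
proof -
  let ?r = "a n * (1 - weight n x)" and ?s = "a n * (1 - weight n y)"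
  have "cut n x - cut n y = proj n (x - y) + (truncate_norm ?r (coord n x) - truncate_norm ?s (coord n y))"
    by (simp add: cut_def linear_diff[OF proj_linear])
  then have "norm (cut n x - cut n y) \<le> norm (proj n (x - y)) + norm (truncate_norm ?r (coord n x) - truncate_norm ?s (coord n y))"
    by (metis norm_triangle_ineq)
  also have "\<dots> \<le> C * norm (x - y) + (2 * norm (coord n x - coord n y) + \<bar>?r - ?s\<bar>)"
    using assms a_pos[of n] by (intro add_mono proj_bound truncate_diff) auto
  also have "\<bar>?r - ?s\<bar> = a n * \<bar>weight n x - weight n y\<bar>"
  proof -
    have "?r - ?s = a n * (weight n y - weight n x)" by (simp add: algebra_simps)
    then show ?thesis using a_pos[of n] by (simp add: abs_mult abs_minus_commute)
  qed
  finally show ?thesis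
    using a_weight_diff[of n x y] coord_bound[of n "x - y"] by (simp add: coord_diff)
qed

text \<open>Both points are compared at the earlier exit index \<open>n\<close>. What
  \<open>retraction y\<close> contains beyond \<open>cut n y\<close> is a tail of a point of the
  body, of norm at most \<open>a (Suc n) * (1 - weight (Suc n) y)\<close>; since \<open>x\<close>
  has already exceeded weight 1, this is at most \<open>a (Suc n)\<close> times the difference of
  the weights. It adds \<open>2 * C\<close> to the constant \<open>7 * C\<close>.\<close>

lemma retraction_close:
  assumes x: "x \<notin> body" and y: "y \<in> body \<or> exit_index x < exit_index y"
  shows "norm (retraction x - retraction y) \<le> 9 * C * norm (x - y)"
proof -
  define n where "n = exit_index x"
  have x1: "weight (Suc n) x > 1" "weight n x \<le> 1" using exit_index[OF x] by (simp_all add: n_def)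
  have y1: "weight (Suc n) y \<le> 1"
    using y exit_index(2)[of y "Suc n"] by (cases "y \<in> body") (auto simp: n_def body_def)
  have yn: "weight n y \<le> 1" using weight_mono[of n "Suc n" y] y1 by simp
  have same: "coord i (retraction y) = coord i y" if "i < Suc n" for i
    using y that by (auto simp: retraction_def coord_cut n_def)
  \<comment> \<open>At index \<open>n\<close> the point \<open>y\<close> has enough weight left, so
    the truncation acts trivially and \<open>cut n y\<close> is a partial sum of the retracted
    point.\<close>
  have cut_y: "cut n y = proj (Suc n) (retraction y)"
  proof -
    have "norm (coord n y) \<le> a n * (1 - weight n y)"
      using y1 a_pos[of n] by (simp add: weight_Suc field_simps)
    then have "cut n y = proj (Suc n) y" by (simp add: cut_def truncate_norm_def proj_def)
    also have "\<dots> = proj (Suc n) (retraction y)" unfolding proj_def using same by simp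
    finally show ?thesis .
  qed
  have "norm (retraction y - cut n y) \<le> a (Suc n) * (1 - weight (Suc n) (retraction y))"
    unfolding cut_y by (rule body_tail[OF retraction_in_body])
  also have "weight (Suc n) (retraction y) = weight (Suc n) y" using same by (rule weight_cong)
  also have "a (Suc n) * (1 - weight (Suc n) y) \<le> a (Suc n) * \<bar>weight (Suc n) x - weight (Suc n) y\<bar>"
    using x1 a_pos[of "Suc n"] by (intro mult_left_mono) auto
  also have "\<dots> \<le> 2 * C * norm (x - y)" by (rule a_weight_diff)
  finally have rest: "norm (retraction y - cut n y) \<le> 2 * C * norm (x - y)" .
  have "retraction x - retraction y = (cut n x - cut n y) - (retraction y - cut n y)"
    using x by (simp add: retraction_def n_def)
  then have "norm (retraction x - retraction y) \<le> norm (cut n x - cut n y) + norm (retraction y - cut n y)"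
    by (metis norm_triangle_ineq4)
  then show ?thesis using rest cut_lipschitz[OF x1(2) yn] by linarith
qed

lemma retraction_lipschitz: "norm (retraction x - retraction y) \<le> 9 * C * norm (x - y)"
proof -
  have C1: "norm (x - y) \<le> 9 * C * norm (x - y)" using C_ge mult_right_mono[of 1 "9 * C" "norm (x - y)"] by simp
  have sym: "norm (retraction x - retraction y) = norm (retraction y - retraction x)" "norm (x - y) = norm (y - x)"
    by (rule norm_minus_commute)+
  consider "x \<in> body" "y \<in> body" | "x \<notin> body" "y \<in> body \<or> exit_index x < exit_index y"
    | "y \<notin> body" "x \<in> body \<or> exit_index y < exit_index x" | "x \<notin> body" "y \<notin> body" "exit_index x = exit_index y"
    by linarith
  then show ?thesis
  proof cases
    case 1
    then show ?thesis using C1 by (simp add: retraction_def)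
  next
    case 2
    then show ?thesis by (rule retraction_close)
  next
    case 3
    then show ?thesis unfolding sym by (rule retraction_close)
  next
    case 4
    then have "norm (retraction x - retraction y) \<le> 7 * C * norm (x - y)"
      using exit_index(2) by (auto simp: retraction_def intro!: cut_lipschitz)
    also have "\<dots> \<le> 9 * C * norm (x - y)" using C_ge by (intro mult_right_mono) auto
    finally show ?thesis .
  qed
qed

lemma body_GCCR: "GCCR body"
proof -
  have "(9 * C)-lipschitz_on UNIV retraction"
    using retraction_lipschitz C_ge by (auto simp: lipschitz_on_def dist_norm)
  moreover have "range retraction \<subseteq> body" using retraction_in_body by blast
  ultimately have "lipschitz_retract body"
    unfolding lipschitz_retract_def by (meson retraction_def)
  then show ?thesis using body_convex body_compact closure_span_body by (simp add: GCCR_def)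
qed

section \<open>Heights and inner radii of the body\<close>

lemma body_height:
  assumes E: "Espan \<beta> m = partial_space (Suc n)"
  shows "0 < height \<beta> body m" "height \<beta> body m \<le> ennreal (a (Suc n))"
proof -
  have le: "infdist x (Espan \<beta> m) \<le> a (Suc n)" if x: "x \<in> body" for x
  proof -
    have "infdist x (Espan \<beta> m) \<le> dist x (proj (Suc n) x)"
      by (rule infdist_le) (simp add: E partial_space_def)
    then show ?thesis using body_tail_le[OF x, of "Suc n"] by (simp add: dist_norm)
  qed
  then show "height \<beta> body m \<le> ennreal (a (Suc n))"
    unfolding height_def by (intro SUP_least ennreal_leI) auto
  obtain v where v: "v \<in> V (Suc n)" "v \<noteq> 0" using V_nonzero subspace_0[OF V_subspace] by blast
  define w where "w = (a (Suc n) / norm v) *\<^sub>R v"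
  have w: "w \<in> V (Suc n)" "w \<noteq> 0" "norm w = a (Suc n)"
    using v a_pos[of "Suc n"] by (auto simp: w_def intro: subspace_scale V_subspace)
  have "w \<in> body" using w by (intro body_V[of _ "Suc n"]) auto
  have "w \<notin> Espan \<beta> m"
    unfolding E partial_space_fixed proj_coord using w by (auto simp: coord_of_V[OF w(1)] intro!: exI[of _ "Suc n"])
  moreover have "closed (Espan \<beta> m)" "Espan \<beta> m \<noteq> {}"
    using closed_span_finite[of "\<beta> ` {..<m}"] by (auto simp: Espan_def intro: span_zero)
  ultimately have "0 < infdist w (Espan \<beta> m)"
    by (intro infdist_pos_not_in_closed)
  then have "0 < ennreal (infdist w (Espan \<beta> m))" by simp
  also have "\<dots> \<le> height \<beta> body m" unfolding height_def using \<open>w \<in> body\<close> by (rule SUP_upper)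
  finally show "0 < height \<beta> body m" .
qed

text \<open>Each coordinate is bounded by \<open>2 * C\<close> times the norm, and
  \<open>a n\<close> times the sum of the first \<open>n + 1\<close> reciprocal weights is at most
  2, whence the radius \<open>a n / (4 * C)\<close>. The upper bound, from the diameter of the body,
  keeps the inner radius finite, so that the quotient by it is positive.\<close>

lemma body_inner_radius:
  assumes E: "Espan \<beta> m = partial_space (Suc n)"
  shows "ennreal (a n / (4 * C)) \<le> inner_radius \<beta> body m" "inner_radius \<beta> body m \<le> 2"
proof -
  have "cball 0 (a n / (4 * C)) \<inter> Espan \<beta> m \<subseteq> body \<inter> Espan \<beta> m"
  proof
    fix x assume x: "x \<in> cball 0 (a n / (4 * C)) \<inter> Espan \<beta> m"
    then have xn: "norm x \<le> a n / (4 * C)" and fix_x: "\<And>i. i \<ge> Suc n \<Longrightarrow> coord i x = 0"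
      by (auto simp: E partial_space_fixed proj_coord)
    have s: "a n * (\<Sum>i<Suc n. 1 / a i) \<le> 2"
      using a_sum[of n] a_pos[of n] by (simp add: algebra_simps)
    have "weight (Suc n) x \<le> (\<Sum>i<Suc n. 1 / a i) * (2 * C * norm x)"
      using weight_diff[of "Suc n" x 0] by (simp add: weight_def linear_0[OF coord_linear])
    also have "\<dots> \<le> (\<Sum>i<Suc n. 1 / a i) * (2 * C * (a n / (4 * C)))"
      using xn C_ge a_pos by (intro mult_left_mono sum_nonneg) (auto simp: less_imp_le)
    also have "\<dots> = a n * (\<Sum>i<Suc n. 1 / a i) / 2" using C_ge by (simp add: field_simps)
    also have "\<dots> \<le> 1" using s by simp
    finally have S: "weight (Suc n) x \<le> 1" .
    have "weight (Suc n + k) x \<le> 1" for k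
      by (induction k) (use S fix_x in \<open>auto simp: weight_Suc\<close>)
    then have "weight k x \<le> 1" for k using weight_mono[of k "Suc n + k" x] by (meson le_add2 order_trans)
    then show "x \<in> body \<inter> Espan \<beta> m" using x by (simp add: body_def)
  qed
  moreover have "0 \<in> Espan \<beta> m" by (simp add: Espan_def span_zero)
  moreover have "0 \<le> a n / (4 * C)" using a_pos[of n] C_ge by simp
  ultimately show "ennreal (a n / (4 * C)) \<le> inner_radius \<beta> body m"
    unfolding inner_radius_def by (intro Sup_upper) blast
  show "inner_radius \<beta> body m \<le> 2"
    unfolding inner_radius_def
  proof (rule Sup_least)
    fix \<rho> assume "\<rho> \<in> {ennreal r | r. 0 \<le> r \<and> (\<exists>x\<in>Espan \<beta> m. cball x r \<inter> Espan \<beta> m \<subseteq> body \<inter> Espan \<beta> m)}"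
    then obtain r x where r: "\<rho> = ennreal r" "0 \<le> r" "x \<in> Espan \<beta> m" "cball x r \<inter> Espan \<beta> m \<subseteq> body" by auto
    obtain v where v: "v \<in> V n" "v \<noteq> 0" using V_nonzero subspace_0[OF V_subspace] by blast
    have vE: "v \<in> Espan \<beta> m" unfolding E partial_space_fixed proj_coord by (auto simp: coord_of_V[OF v(1)])
    define y where "y = x + (r / norm v) *\<^sub>R v"
    have "y \<in> Espan \<beta> m"
      unfolding y_def using r(3) vE by (auto simp: Espan_def intro: span_add span_scale)
    then have "y \<in> body" "x \<in> body" using r v by (auto simp: y_def dist_norm)
    then have "norm (y - x) \<le> 2"
      using body_norm_le[of x] body_norm_le[of y] norm_triangle_ineq4[of y x] by linarith
    then have "r \<le> 2" using r(2) v(2) by (simp add: y_def)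
    then have "ennreal r \<le> ennreal 2" by (rule ennreal_leI)
    then show "\<rho> \<le> 2" using r(1) by simp
  qed
qed

end

text \<open>Strings bases of the blocks together into one sequence. As no list is empty, the first
  \<open>j + 1\<close> lists contain more than \<open>j\<close> entries, so the entry
  \<open>j\<close> exists there and is not changed by appending further lists.\<close>

lemma concat_nth_stable:
  fixes bl :: "nat \<Rightarrow> 'b list"
  defines "L \<equiv> \<lambda>n. concat (map bl [0..<n])"
  assumes ne: "\<And>i. bl i \<noteq> []"
  shows "(\<lambda>j. L (Suc j) ! j) ` {..<length (L n)} = (\<Union>i<n. set (bl i))" "strict_mono (\<lambda>n. length (L n))"
proof -
  have LS: "L (Suc n) = L n @ bl n" for n by (simp add: L_def)
  show sm: "strict_mono (\<lambda>n. length (L n))"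
    by (rule strict_monoI_Suc) (simp add: LS ne)
  have len: "j < length (L (Suc j))" for j using seq_suble[OF sm, of "Suc j"] by simp
  have pre: "L (m + k) ! j = L m ! j" if "j < length (L m)" for m k j
  proof (induction k)
    case (Suc k)
    have "length (L m) \<le> length (L (m + k))" using strict_mono_leD[OF sm, of m "m + k"] by simp
    then show ?case using Suc that by (simp add: LS nth_append)
  qed simp
  have "L (Suc j) ! j = L n ! j" if "j < length (L n)" for j
  proof (cases "n \<le> Suc j")
    case True
    then show ?thesis using pre[OF that, of "Suc j - n"] by simp
  next
    case False
    then show ?thesis using pre[OF len[of j], of "n - Suc j"] by simp
  qed
  then have "(\<lambda>j. L (Suc j) ! j) ` {..<length (L n)} = (\<lambda>j. L n ! j) ` {..<length (L n)}"
    by (intro image_cong) auto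
  also have "\<dots> = set (L n)" using nth_image[OF order_refl, of "L n"] by (simp add: lessThan_atLeast0)
  finally show "(\<lambda>j. L (Suc j) ! j) ` {..<length (L n)} = (\<Union>i<n. set (bl i))"
    by (auto simp: L_def)
qed

theorem FDD_imp_small_GCCR:
  fixes V :: "nat \<Rightarrow> 'a::banach set"
  assumes "FDD V"
  shows "\<exists>K :: 'a set. GCCR K \<and> small K"
proof -
  interpret finite_dim_decomposition V using assms by unfold_locales
  obtain C where C: "C \<ge> 1" "\<And>n x. norm (proj n x) \<le> C * norm x" using proj_uniformly_bounded by blast
  obtain B where B: "\<And>i. finite (B i)" "\<And>i. span (B i) = V i" using V_span by metis
  have "\<exists>xs. set xs = B i" for i using finite_list[OF B(1)] .
  then obtain bl where bl: "\<And>i. set (bl i) = B i" by metis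
  have ne: "bl i \<noteq> []" for i using V_nonzero[of i] B(2)[of i] bl[of i] by (metis list.set(1) span_empty)
  define L where "L = (\<lambda>n. concat (map bl [0..<n]))"
  define \<beta> where "\<beta> = (\<lambda>j. L (Suc j) ! j)"
  \<comment> \<open>The shift by one means that stage \<open>n\<close> comprises the blocks
    \<open>0\<close> to \<open>n\<close>; its height is then governed by \<open>a (Suc n)\<close>
    and its inner radius by \<open>a n\<close>.\<close>
  define \<sigma> where "\<sigma> = (\<lambda>n. length (L (Suc n)))"
  have \<beta>: "\<beta> ` {..<length (L n)} = (\<Union>i<n. B i)" for n
    using concat_nth_stable(1)[of bl n, OF ne] by (simp add: \<beta>_def L_def bl)
  have sm: "strict_mono (\<lambda>n. length (L n))" using concat_nth_stable(2)[of bl, OF ne] by (simp add: L_def)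
  define q where "q = (\<lambda>n. 1 / (2 * real (\<sigma> n) ^ 2 * ((1 + 2 / (1/2)) ^ \<sigma> n + 2)))"
  have \<sigma>0: "0 < \<sigma> n" for n using seq_suble[OF sm, of "Suc n"] unfolding \<sigma>_def by linarith
  have q: "q n > 0" for n using \<sigma>0[of n] by (auto simp: q_def intro!: divide_pos_pos mult_pos_pos add_pos_pos)
  \<comment> \<open>The sequence \<open>q\<close>, the bound of \<open>small\<close> for \<epsilon>
    = 1/2, depends only on the block lengths, so the weights can be chosen afterwards. The second
    entry of the minimum makes the height bound \<open>a (Suc n)\<close> at most \<open>q n\<close>
    times the radius bound \<open>a n / (4 * C)\<close>; the first gives the halving.\<close>
  define a where "a = rec_nat 1 (\<lambda>n x. x * min (1/2) (q n / (4 * C)))"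
  have a0: "a 0 = 1" and aS: "a (Suc n) = a n * min (1/2) (q n / (4 * C))" for n by (simp_all add: a_def)
  have a_pos: "a n > 0" for n by (induction n) (use q C(1) in \<open>auto simp: a0 aS\<close>)
  interpret weighted_decomposition V C a
  proof unfold_locales
    show "a (Suc n) \<le> a n / 2" for n
      using mult_left_mono[of "min (1/2) (q n / (4 * C))" "1/2" "a n"] a_pos[of n] by (simp add: aS)
  qed (use C a0 a_pos in auto)
  have E: "Espan \<beta> (\<sigma> n) = partial_space (Suc n)" for n
    unfolding Espan_def \<sigma>_def \<beta> using partial_space_span[OF B(2)] by simp
  have "fundamental \<beta>"
  proof -
    have "x \<in> closure (span (range \<beta>))" for x
      unfolding closure_sequential
    proof (intro exI[of _ "\<lambda>n. proj (Suc n) x"] conjI allI)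
      show "proj (Suc n) x \<in> span (range \<beta>)" for n
      proof -
        have "proj (Suc n) x \<in> Espan \<beta> (\<sigma> n)" by (simp add: E partial_space_def)
        then show ?thesis unfolding Espan_def using span_mono[of "\<beta> ` {..<\<sigma> n}" "range \<beta>"] by blast
      qed
      show "(\<lambda>n. proj (Suc n) x) \<longlonglongrightarrow> x" using LIMSEQ_Suc[OF proj_tendsto] .
    qed
    then show ?thesis by (auto simp: fundamental_def)
  qed
  moreover have "strict_mono \<sigma>" using sm by (simp add: \<sigma>_def strict_mono_def)
  moreover have "0 < height \<beta> body (\<sigma> n) / inner_radius \<beta> body (\<sigma> n)" for n
  proof -
    have "inner_radius \<beta> body (\<sigma> n) < top_class.top"
      using body_inner_radius(2)[OF E[of n]] by (rule le_less_trans) simp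
    then show ?thesis using body_height(1)[OF E[of n]] by (simp add: ennreal_zero_less_divide)
  qed
  moreover have "height \<beta> body (\<sigma> n) / inner_radius \<beta> body (\<sigma> n) \<le> ennreal (q n)" for n
  proof (rule divide_le_posI_ennreal)
    have pos: "a n / (4 * C) > 0" using a_pos[of n] C(1) by simp
    then have "0 < ennreal (a n / (4 * C))" by simp
    then show "0 < inner_radius \<beta> body (\<sigma> n)" using body_inner_radius(1)[OF E[of n]] by (rule less_le_trans)
    have "height \<beta> body (\<sigma> n) \<le> ennreal (a (Suc n))" by (rule body_height(2)[OF E])
    also have "a (Suc n) \<le> a n * (q n / (4 * C))"
      unfolding aS using a_pos[of n] by (intro mult_left_mono) auto
    then have "ennreal (a (Suc n)) \<le> ennreal (a n / (4 * C) * q n)"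
      by (intro ennreal_leI) (simp add: field_simps)
    also have "\<dots> = ennreal (a n / (4 * C)) * ennreal (q n)"
      using pos q[of n] by (intro ennreal_mult) auto
    also have "\<dots> \<le> inner_radius \<beta> body (\<sigma> n) * ennreal (q n)"
      using body_inner_radius(1)[OF E[of n]] by (rule mult_right_mono) simp
    finally show "height \<beta> body (\<sigma> n) \<le> inner_radius \<beta> body (\<sigma> n) * ennreal (q n)" .
  qed
  ultimately have "small body"
    unfolding small_def
    using body_compact compact_imp_bounded \<sigma>0
    by (intro conjI exI[of _ "1/2"] exI[of _ \<beta>] exI[of _ \<sigma>]) (auto simp: q_def)
  then show ?thesis using body_GCCR by blast
qed

theorem corollary4p8:
  fixes J :: "'a::banach \<Rightarrow> ('z::banach \<Rightarrow>\<^sub>L real)"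
  assumes "dual_identification J"
    and "separable_space (euclidean :: 'a topology)"
  shows "((\<exists>V :: nat \<Rightarrow> 'a set. FDD V) \<longleftrightarrow> (\<exists>K :: 'a set. GCCR K \<and> small K)) \<and>
         ((\<exists>K :: 'a set. GCCR K \<and> small K) \<longleftrightarrow> (\<exists>K :: 'a set. small K \<and> lipschitz_retract K))"
proof -
  have "\<exists>K :: 'a set. GCCR K \<and> small K" if "\<exists>V :: nat \<Rightarrow> 'a set. FDD V"
    using that FDD_imp_small_GCCR by blast
  moreover have "\<exists>K :: 'a set. small K \<and> lipschitz_retract K" if "\<exists>K :: 'a set. GCCR K \<and> small K"
    using that by (auto simp: GCCR_def)
  moreover have "\<exists>V :: nat \<Rightarrow> 'a set. FDD V" if "\<exists>K :: 'a set. small K \<and> lipschitz_retract K"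
    using that small_lipschitz_retract_imp_FDD[OF assms(1)] by blast
  ultimately show ?thesis by blast
qed

end
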